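(* Let $\Phi$ be a unital commutative associative ring containing $1/2$. Let $\Phi_C[t_1,t_2,t_3]$ be the ring of Cayley polynomials over $\Phi$, with its natural $\mathbb{N}^3$-grading, and let $D=(\Phi[z_1,z_2,z_3],z_1,z_2,z_3)$, with its natural $\mathbb{N}^3$-grading. Then $\Phi_C[t_1,t_2,t_3]$ is graded isomorphic to $D$. In particular, the center $Z$ of $\Phi_C[t_1,t_2,t_3]$ is $Z=\Phi[t_1^2,t_2^2,t_3^2]$, which is the ordinary (commutative associative) polynomial algebra over $\Phi$ in the three variables $t_1^2,t_2^2,t_3^2$, and $\Phi_C[t_1,t_2,t_3]$ is an octonion algebra $(Z,t_1^2,t_2^2,t_3^2)$ over $Z$.
   Context: All algebras are unital. For an algebra write $[a,b]=ab-ba$ and $(a,b,c)=(ab)c-a(bc)$. An algebra is alternative if $(a,a,b)=0=(b,a,a)$ for all $a,b$. The center of an alternative algebra $A$ is $\{z\in A\mid [z,a]=(z,a,b)=0 \text{ for all } a,b\in A\}$. Cayley-Dickson process. Let $k$ be a unital commutative associative ring containing $1/2$, $B$ a faithful unital $k$-algebra (i.e. $\alpha 1=0$ implies $\alpha=0$ for $\alpha\in k$) with a scalar involution $*$ (an anti-automorphism of period 2 with $bb^*\in k1$ for all $b$), and let $\mu\in k$ be a cancellable scalar (i.e. $\mu b=0$ implies $b=0$ for $b\in B$). Then $(B,\mu)$ is the algebra $B\oplus vB$ with product $(a+vb)(c+vd)=(ac+\mu db^* )+v(a^*d+cb)$ and new involution $(a+vb)^*=a^*-vb$; $v$ is called the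 basic generator and $v^2=\mu$. Iterating three times starting from $k$ with the trivial involution, with cancellable $\mu_1,\mu_2,\mu_3\in k$, gives the octonion algebra $(k,\mu_1,\mu_2,\mu_3)$ over $k$, with basic generators $v_1,v_2,v_3$ satisfying $v_i^2=\mu_i$. The ring of Cayley polynomials $\Phi_C[t_1,t_2,t_3]$ is the alternative algebra over $\Phi$ presented, in the category of (unital) alternative algebras, by generators $t_1,t_2,t_3$ and the Cayley relations $t_2t_1=-t_1t_2$, $t_3t_1=-t_1t_3$, $t_3t_2=-t_2t_3$, $(t_1t_2)t_3=-t_1(t_2t_3)$. Its natural $\mathbb{N}^3$-grading is given by $\deg t_1=(1,0,0)$, $\deg t_2=(0,1,0)$, $\deg t_3=(0,0,1)$. $\Phi[z_1,z_2,z_3]$ is the ordinary polynomial algebra, and $D=(\Phi[z_1,z_2,z_3],z_1,z_2,z_3)$ is the octonion algebra over $\Phi[z_1,z_2,z_3]$ with structure constants $z_1,z_2,z_3$ and basic generators $v_1,v_2,v_3$ ($v_i^2=z_i$). Its natural $\mathbb{N}^3$-grading (as a $\Phi$-algebra) is given by $\deg v_1=(1,0,0)$, $\deg v_2=(0,1,0)$, $\deg v_3=(0,0,1)$. *)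

theory Defs
  imports "HOL-Algebra.UnivPoly" "HOL-Algebra.QuotRing" "HOL-Library.Product_Plus"
begin

section \<open>Nonassociative algebras\<close>

text \<open>
  An algebra over the commutative ring \<open>R\<close> is a \<open>module\<close> record whose multiplication is
  bilinear and unital, but not necessarily associative.  Scalar rings may be trivial.
\<close>

locale unital_algebra = module R A for R (structure) and A (structure) +
  assumes mult_closed: "\<lbrakk>x \<in> carrier A; y \<in> carrier A\<rbrakk> \<Longrightarrow> x \<otimes>\<^bsub>A\<^esub> y \<in> carrier A"
    and unit_closed: "\<one>\<^bsub>A\<^esub> \<in> carrier A"
    and unit_left: "x \<in> carrier A \<Longrightarrow> \<one>\<^bsub>A\<^esub> \<otimes>\<^bsub>A\<^esub> x = x"
    and unit_right: "x \<in> carrier A \<Longrightarrow> x \<otimes>\<^bsub>A\<^esub> \<one>\<^bsub>A\<^esub> = x"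
    and mult_add_left: "\<lbrakk>x \<in> carrier A; y \<in> carrier A; z \<in> carrier A\<rbrakk>
      \<Longrightarrow> (x \<oplus>\<^bsub>A\<^esub> y) \<otimes>\<^bsub>A\<^esub> z = (x \<otimes>\<^bsub>A\<^esub> z) \<oplus>\<^bsub>A\<^esub> (y \<otimes>\<^bsub>A\<^esub> z)"
    and mult_add_right: "\<lbrakk>x \<in> carrier A; y \<in> carrier A; z \<in> carrier A\<rbrakk>
      \<Longrightarrow> z \<otimes>\<^bsub>A\<^esub> (x \<oplus>\<^bsub>A\<^esub> y) = (z \<otimes>\<^bsub>A\<^esub> x) \<oplus>\<^bsub>A\<^esub> (z \<otimes>\<^bsub>A\<^esub> y)"
    and mult_smult_left: "\<lbrakk>a \<in> carrier R; x \<in> carrier A; y \<in> carrier A\<rbrakk>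
      \<Longrightarrow> (a \<odot>\<^bsub>A\<^esub> x) \<otimes>\<^bsub>A\<^esub> y = a \<odot>\<^bsub>A\<^esub> (x \<otimes>\<^bsub>A\<^esub> y)"
    and mult_smult_right: "\<lbrakk>a \<in> carrier R; x \<in> carrier A; y \<in> carrier A\<rbrakk>
      \<Longrightarrow> x \<otimes>\<^bsub>A\<^esub> (a \<odot>\<^bsub>A\<^esub> y) = a \<odot>\<^bsub>A\<^esub> (x \<otimes>\<^bsub>A\<^esub> y)"

definition commutator :: "('b, 'm) ring_scheme \<Rightarrow> 'b \<Rightarrow> 'b \<Rightarrow> 'b" where
  "commutator A x y = (x \<otimes>\<^bsub>A\<^esub> y) \<ominus>\<^bsub>A\<^esub> (y \<otimes>\<^bsub>A\<^esub> x)"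

definition associator :: "('b, 'm) ring_scheme \<Rightarrow> 'b \<Rightarrow> 'b \<Rightarrow> 'b \<Rightarrow> 'b" where
  "associator A x y z = ((x \<otimes>\<^bsub>A\<^esub> y) \<otimes>\<^bsub>A\<^esub> z) \<ominus>\<^bsub>A\<^esub> (x \<otimes>\<^bsub>A\<^esub> (y \<otimes>\<^bsub>A\<^esub> z))"

locale alternative_algebra = unital_algebra +
  assumes left_alternative: "\<lbrakk>x \<in> carrier A; y \<in> carrier A\<rbrakk> \<Longrightarrow> associator A x x y = \<zero>\<^bsub>A\<^esub>"
    and right_alternative: "\<lbrakk>x \<in> carrier A; y \<in> carrier A\<rbrakk> \<Longrightarrow> associator A y x x = \<zero>\<^bsub>A\<^esub>"

definition alt_center :: "('b, 'm) ring_scheme \<Rightarrow> 'b set" where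
  "alt_center A = {z \<in> carrier A. \<forall>a\<in>carrier A. \<forall>b\<in>carrier A.
     commutator A z a = \<zero>\<^bsub>A\<^esub> \<and> associator A z a b = \<zero>\<^bsub>A\<^esub>}"

text \<open>
  \<open>ring_hom\<close> and \<open>ring_iso\<close> only ask for compatibility with sum, product and unit; they do not
  presuppose associativity.
\<close>

definition algebra_hom ::
  "('a, 'k) ring_scheme \<Rightarrow> ('a, 'b, 'm) module_scheme \<Rightarrow> ('a, 'c, 'n) module_scheme \<Rightarrow> ('b \<Rightarrow> 'c) set"
  where "algebra_hom R A B =
    {f \<in> ring_hom A B. \<forall>a\<in>carrier R. \<forall>x\<in>carrier A. f (a \<odot>\<^bsub>A\<^esub> x) = a \<odot>\<^bsub>B\<^esub> f x}"

definition algebra_iso ::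
  "('a, 'k) ring_scheme \<Rightarrow> ('a, 'b, 'm) module_scheme \<Rightarrow> ('a, 'c, 'n) module_scheme \<Rightarrow> ('b \<Rightarrow> 'c) set"
  where "algebra_iso R A B = algebra_hom R A B \<inter> ring_iso A B"

inductive_set subalgebra_gen ::
  "('a, 'k) ring_scheme \<Rightarrow> ('a, 'b, 'm) module_scheme \<Rightarrow> 'b set \<Rightarrow> 'b set"
  for R and A and S where
    gen: "x \<in> S \<Longrightarrow> x \<in> subalgebra_gen R A S"
  | one: "\<one>\<^bsub>A\<^esub> \<in> subalgebra_gen R A S"
  | add: "\<lbrakk>x \<in> subalgebra_gen R A S; y \<in> subalgebra_gen R A S\<rbrakk>
      \<Longrightarrow> x \<oplus>\<^bsub>A\<^esub> y \<in> subalgebra_gen R A S"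
  | mult: "\<lbrakk>x \<in> subalgebra_gen R A S; y \<in> subalgebra_gen R A S\<rbrakk>
      \<Longrightarrow> x \<otimes>\<^bsub>A\<^esub> y \<in> subalgebra_gen R A S"
  | smult: "\<lbrakk>a \<in> carrier R; x \<in> subalgebra_gen R A S\<rbrakk>
      \<Longrightarrow> a \<odot>\<^bsub>A\<^esub> x \<in> subalgebra_gen R A S"

text \<open>
  A (possibly nonassociative) ring acting on itself by left multiplication.  The scalars may also
  be taken from a subring of \<open>A\<close>, such as the center.
\<close>

definition self_algebra :: "('b, 'm) ring_scheme \<Rightarrow> ('b, 'b) module" where
  "self_algebra A = \<lparr>carrier = carrier A, mult = mult A, one = \<one>\<^bsub>A\<^esub>, zero = \<zero>\<^bsub>A\<^esub>, add = add A,
     smult = mult A\<rparr>"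

definition restrict_scalars ::
  "('a \<Rightarrow> 'k) \<Rightarrow> ('k, 'b, 'm) module_scheme \<Rightarrow> ('a, 'b) module" where
  "restrict_scalars h A = \<lparr>carrier = carrier A, mult = mult A, one = \<one>\<^bsub>A\<^esub>, zero = \<zero>\<^bsub>A\<^esub>,
     add = add A, smult = (\<lambda>a. smult A (h a))\<rparr>"


section \<open>Gradings\<close>

definition algebra_grading ::
  "('a, 'k) ring_scheme \<Rightarrow> ('a, 'b, 'm) module_scheme \<Rightarrow> ('i::monoid_add \<Rightarrow> 'b set) \<Rightarrow> bool" where
  "algebra_grading R A G \<longleftrightarrow>
     (\<forall>n. submodule (G n) R A) \<and>
     \<one>\<^bsub>A\<^esub> \<in> G 0 \<and>
     (\<forall>m n. \<forall>x\<in>G m. \<forall>y\<in>G n. x \<otimes>\<^bsub>A\<^esub> y \<in> G (m + n)) \<and>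
     (\<forall>x\<in>carrier A. \<exists>!f. (\<forall>n. f n \<in> G n) \<and> finite {n. f n \<noteq> \<zero>\<^bsub>A\<^esub>} \<and>
        x = (\<Oplus>\<^bsub>A\<^esub>n\<in>{n. f n \<noteq> \<zero>\<^bsub>A\<^esub>}. f n))"

text \<open>
  The family of components determined by assigning the degrees \<open>d j\<close> to generators \<open>g j\<close>:
  the component of degree \<open>n\<close> is spanned by all bracketed monomials in the \<open>g j\<close> of total
  degree \<open>n\<close>.
\<close>

inductive homogeneous ::
  "('a, 'k) ring_scheme \<Rightarrow> ('a, 'b, 'm) module_scheme \<Rightarrow> ('j \<Rightarrow> 'b) \<Rightarrow> ('j \<Rightarrow> 'i::monoid_add)
    \<Rightarrow> 'i \<Rightarrow> 'b \<Rightarrow> bool"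
  for R and A and g and d where
    zero: "homogeneous R A g d n \<zero>\<^bsub>A\<^esub>"
  | one: "homogeneous R A g d 0 \<one>\<^bsub>A\<^esub>"
  | gen: "homogeneous R A g d (d j) (g j)"
  | add: "\<lbrakk>homogeneous R A g d n x; homogeneous R A g d n y\<rbrakk> \<Longrightarrow> homogeneous R A g d n (x \<oplus>\<^bsub>A\<^esub> y)"
  | smult: "\<lbrakk>a \<in> carrier R; homogeneous R A g d n x\<rbrakk> \<Longrightarrow> homogeneous R A g d n (a \<odot>\<^bsub>A\<^esub> x)"
  | mult: "\<lbrakk>homogeneous R A g d m x; homogeneous R A g d n y\<rbrakk>
      \<Longrightarrow> homogeneous R A g d (m + n) (x \<otimes>\<^bsub>A\<^esub> y)"

definition component ::
  "('a, 'k) ring_scheme \<Rightarrow> ('a, 'b, 'm) module_scheme \<Rightarrow> ('j \<Rightarrow> 'b) \<Rightarrow> ('j \<Rightarrow> 'i::monoid_add)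
    \<Rightarrow> 'i \<Rightarrow> 'b set" where
  "component R A g d n = {x. homogeneous R A g d n x}"

definition graded_isomorphic ::
  "('a, 'k) ring_scheme \<Rightarrow> ('a, 'b, 'm) module_scheme \<Rightarrow> ('i::monoid_add \<Rightarrow> 'b set)
    \<Rightarrow> ('a, 'c, 'n) module_scheme \<Rightarrow> ('i \<Rightarrow> 'c set) \<Rightarrow> bool" where
  "graded_isomorphic R A G B H \<longleftrightarrow>
     algebra_grading R A G \<and> algebra_grading R B H \<and>
     (\<exists>f\<in>algebra_iso R A B. \<forall>n. f ` G n = H n)"

datatype gen3 = G1 | G2 | G3

fun deg3 :: "gen3 \<Rightarrow> nat \<times> nat \<times> nat" where
  "deg3 G1 = (1, 0, 0)"
| "deg3 G2 = (0, 1, 0)"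
| "deg3 G3 = (0, 0, 1)"


section \<open>The Cayley-Dickson process\<close>

record ('a, 'b) star_algebra = "('a, 'b) module" +
  star :: "'b \<Rightarrow> 'b"

locale scalar_involution_algebra = unital_algebra k B
  for k :: "('a, 'm) ring_scheme" (structure) and B :: "('a, 'b, 'n) star_algebra_scheme" (structure) +
  assumes half: "\<one>\<^bsub>k\<^esub> \<oplus>\<^bsub>k\<^esub> \<one>\<^bsub>k\<^esub> \<in> Units k"
    and faithful: "\<lbrakk>a \<in> carrier k; a \<odot>\<^bsub>B\<^esub> \<one>\<^bsub>B\<^esub> = \<zero>\<^bsub>B\<^esub>\<rbrakk> \<Longrightarrow> a = \<zero>\<^bsub>k\<^esub>"
    and star_closed: "x \<in> carrier B \<Longrightarrow> star B x \<in> carrier B"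
    and star_add: "\<lbrakk>x \<in> carrier B; y \<in> carrier B\<rbrakk>
      \<Longrightarrow> star B (x \<oplus>\<^bsub>B\<^esub> y) = star B x \<oplus>\<^bsub>B\<^esub> star B y"
    and star_smult: "\<lbrakk>a \<in> carrier k; x \<in> carrier B\<rbrakk>
      \<Longrightarrow> star B (a \<odot>\<^bsub>B\<^esub> x) = a \<odot>\<^bsub>B\<^esub> star B x"
    and star_mult: "\<lbrakk>x \<in> carrier B; y \<in> carrier B\<rbrakk>
      \<Longrightarrow> star B (x \<otimes>\<^bsub>B\<^esub> y) = star B y \<otimes>\<^bsub>B\<^esub> star B x"
    and star_star: "x \<in> carrier B \<Longrightarrow> star B (star B x) = x"
    and star_scalar: "x \<in> carrier B \<Longrightarrow> \<exists>a\<in>carrier k. x \<otimes>\<^bsub>B\<^esub> star B x = a \<odot>\<^bsub>B\<^esub> \<one>\<^bsub>B\<^esub>"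

definition cancellable_scalar ::
  "('a, 'm) ring_scheme \<Rightarrow> ('a, 'b, 'n) module_scheme \<Rightarrow> 'a \<Rightarrow> bool" where
  "cancellable_scalar k B \<mu> \<longleftrightarrow>
     \<mu> \<in> carrier k \<and> (\<forall>b\<in>carrier B. \<mu> \<odot>\<^bsub>B\<^esub> b = \<zero>\<^bsub>B\<^esub> \<longrightarrow> b = \<zero>\<^bsub>B\<^esub>)"

text \<open>The pair \<open>(a, b)\<close> stands for \<open>a + v b\<close>.\<close>

definition cayley_dickson ::
  "('a, 'b, 'n) star_algebra_scheme \<Rightarrow> 'a \<Rightarrow> ('a, 'b \<times> 'b) star_algebra" where
  "cayley_dickson B \<mu> = \<lparr>
     carrier = carrier B \<times> carrier B,
     mult = (\<lambda>(a, b) (c, d).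
       ((a \<otimes>\<^bsub>B\<^esub> c) \<oplus>\<^bsub>B\<^esub> (\<mu> \<odot>\<^bsub>B\<^esub> (d \<otimes>\<^bsub>B\<^esub> star B b)),
        (star B a \<otimes>\<^bsub>B\<^esub> d) \<oplus>\<^bsub>B\<^esub> (c \<otimes>\<^bsub>B\<^esub> b))),
     one = (\<one>\<^bsub>B\<^esub>, \<zero>\<^bsub>B\<^esub>),
     zero = (\<zero>\<^bsub>B\<^esub>, \<zero>\<^bsub>B\<^esub>),
     add = (\<lambda>(a, b) (c, d). (a \<oplus>\<^bsub>B\<^esub> c, b \<oplus>\<^bsub>B\<^esub> d)),
     smult = (\<lambda>r (a, b). (r \<odot>\<^bsub>B\<^esub> a, r \<odot>\<^bsub>B\<^esub> b)),
     star = (\<lambda>(a, b). (star B a, \<ominus>\<^bsub>B\<^esub> b))\<rparr>"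

definition cd_generator :: "('b, 'n) ring_scheme \<Rightarrow> 'b \<times> 'b" where
  "cd_generator B = (\<zero>\<^bsub>B\<^esub>, \<one>\<^bsub>B\<^esub>)"

definition cd_embed :: "('b, 'n) ring_scheme \<Rightarrow> 'b \<Rightarrow> 'b \<times> 'b" where
  "cd_embed B b = (b, \<zero>\<^bsub>B\<^esub>)"

definition cd_base :: "('a, 'm) ring_scheme \<Rightarrow> ('a, 'a) star_algebra" where
  "cd_base k = \<lparr>carrier = carrier k, mult = mult k, one = \<one>\<^bsub>k\<^esub>, zero = \<zero>\<^bsub>k\<^esub>, add = add k,
     smult = mult k, star = (\<lambda>x. x)\<rparr>"

abbreviation cd1 where "cd1 k \<mu>1 \<equiv> cayley_dickson (cd_base k) \<mu>1"
abbreviation cd2 where "cd2 k \<mu>1 \<mu>2 \<equiv> cayley_dickson (cd1 k \<mu>1) \<mu>2"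

type_synonym 'a oct = "(('a \<times> 'a) \<times> 'a \<times> 'a) \<times> ('a \<times> 'a) \<times> 'a \<times> 'a"

definition octonions ::
  "('a, 'm) ring_scheme \<Rightarrow> 'a \<Rightarrow> 'a \<Rightarrow> 'a \<Rightarrow> ('a, 'a oct) star_algebra" where
  "octonions k \<mu>1 \<mu>2 \<mu>3 = cayley_dickson (cd2 k \<mu>1 \<mu>2) \<mu>3"

text \<open>The hypotheses under which the process may be applied three times starting from \<open>k\<close>.\<close>

definition octonion_constants :: "('a, 'm) ring_scheme \<Rightarrow> 'a \<Rightarrow> 'a \<Rightarrow> 'a \<Rightarrow> bool" where
  "octonion_constants k \<mu>1 \<mu>2 \<mu>3 \<longleftrightarrow>
     scalar_involution_algebra k (cd_base k) \<and> cancellable_scalar k (cd_base k) \<mu>1 \<and>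
     scalar_involution_algebra k (cd1 k \<mu>1) \<and> cancellable_scalar k (cd1 k \<mu>1) \<mu>2 \<and>
     scalar_involution_algebra k (cd2 k \<mu>1 \<mu>2) \<and> cancellable_scalar k (cd2 k \<mu>1 \<mu>2) \<mu>3"

fun octonion_gen :: "('a, 'm) ring_scheme \<Rightarrow> 'a \<Rightarrow> 'a \<Rightarrow> gen3 \<Rightarrow> 'a oct" where
  "octonion_gen k \<mu>1 \<mu>2 G1 =
     cd_embed (cd2 k \<mu>1 \<mu>2) (cd_embed (cd1 k \<mu>1) (cd_generator (cd_base k)))"
| "octonion_gen k \<mu>1 \<mu>2 G2 = cd_embed (cd2 k \<mu>1 \<mu>2) (cd_generator (cd1 k \<mu>1))"
| "octonion_gen k \<mu>1 \<mu>2 G3 = cd_generator (cd2 k \<mu>1 \<mu>2)"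

definition is_octonion_algebra ::
  "('a, 'k) ring_scheme \<Rightarrow> 'a \<Rightarrow> 'a \<Rightarrow> 'a \<Rightarrow> ('a, 'b, 'm) module_scheme \<Rightarrow> bool" where
  "is_octonion_algebra k \<mu>1 \<mu>2 \<mu>3 A \<longleftrightarrow>
     octonion_constants k \<mu>1 \<mu>2 \<mu>3 \<and> algebra_iso k A (octonions k \<mu>1 \<mu>2 \<mu>3) \<noteq> {}"


section \<open>Polynomials in three variables\<close>

text \<open>Realised as \<open>R[z\<^sub>1][z\<^sub>2][z\<^sub>3]\<close>, with \<open>z\<^sub>3\<close> the outermost variable.\<close>

definition poly3_ring ::
  "('a, 'm) ring_scheme \<Rightarrow> (nat \<Rightarrow> nat \<Rightarrow> 'a, nat \<Rightarrow> nat \<Rightarrow> nat \<Rightarrow> 'a) up_ring" where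
  "poly3_ring R = UP (UP (UP R))"

definition poly3_const :: "('a, 'm) ring_scheme \<Rightarrow> 'a \<Rightarrow> nat \<Rightarrow> nat \<Rightarrow> nat \<Rightarrow> 'a" where
  "poly3_const R a = monom (UP (UP (UP R))) (monom (UP (UP R)) (monom (UP R) a 0) 0) 0"

fun poly3_var :: "('a, 'm) ring_scheme \<Rightarrow> gen3 \<Rightarrow> nat \<Rightarrow> nat \<Rightarrow> nat \<Rightarrow> 'a" where
  "poly3_var R G1 = monom (UP (UP (UP R))) (monom (UP (UP R)) (monom (UP R) \<one>\<^bsub>R\<^esub> 1) 0) 0"
| "poly3_var R G2 = monom (UP (UP (UP R))) (monom (UP (UP R)) \<one>\<^bsub>UP R\<^esub> 1) 0"
| "poly3_var R G3 = monom (UP (UP (UP R))) \<one>\<^bsub>UP (UP R)\<^esub> 1"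

definition poly3_algebra :: "('a, 'm) ring_scheme \<Rightarrow> ('a, nat \<Rightarrow> nat \<Rightarrow> nat \<Rightarrow> 'a) module" where
  "poly3_algebra R = restrict_scalars (poly3_const R) (self_algebra (poly3_ring R))"


section \<open>Alternative algebras presented by generators and relations\<close>

datatype ('a, 'j) aterm =
    TGen 'j
  | TZero
  | TOne
  | TAdd "('a, 'j) aterm" "('a, 'j) aterm"
  | TNeg "('a, 'j) aterm"
  | TSmult 'a "('a, 'j) aterm"
  | TMult "('a, 'j) aterm" "('a, 'j) aterm"

definition aterms :: "('a, 'm) ring_scheme \<Rightarrow> ('a, 'j) aterm set" where
  "aterms R = {t. set1_aterm t \<subseteq> carrier R}"

text \<open>
  The least congruence on terms that contains the given relations and the axioms of unital
  alternative \<open>R\<close>-algebras.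
\<close>

inductive alt_eq ::
  "('a, 'm) ring_scheme \<Rightarrow> (('a, 'j) aterm \<times> ('a, 'j) aterm) set
    \<Rightarrow> ('a, 'j) aterm \<Rightarrow> ('a, 'j) aterm \<Rightarrow> bool"
  for R and E where
    rel: "\<lbrakk>(s, t) \<in> E; s \<in> aterms R; t \<in> aterms R\<rbrakk> \<Longrightarrow> alt_eq R E s t"
  | refl: "s \<in> aterms R \<Longrightarrow> alt_eq R E s s"
  | sym: "alt_eq R E s t \<Longrightarrow> alt_eq R E t s"
  | trans: "\<lbrakk>alt_eq R E s t; alt_eq R E t u\<rbrakk> \<Longrightarrow> alt_eq R E s u"
  | cong_add: "\<lbrakk>alt_eq R E s s'; alt_eq R E t t'\<rbrakk> \<Longrightarrow> alt_eq R E (TAdd s t) (TAdd s' t')"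
  | cong_neg: "alt_eq R E s s' \<Longrightarrow> alt_eq R E (TNeg s) (TNeg s')"
  | cong_smult: "\<lbrakk>a \<in> carrier R; alt_eq R E s s'\<rbrakk> \<Longrightarrow> alt_eq R E (TSmult a s) (TSmult a s')"
  | cong_mult: "\<lbrakk>alt_eq R E s s'; alt_eq R E t t'\<rbrakk> \<Longrightarrow> alt_eq R E (TMult s t) (TMult s' t')"
  | add_assoc: "\<lbrakk>s \<in> aterms R; t \<in> aterms R; u \<in> aterms R\<rbrakk>
      \<Longrightarrow> alt_eq R E (TAdd (TAdd s t) u) (TAdd s (TAdd t u))"
  | add_comm: "\<lbrakk>s \<in> aterms R; t \<in> aterms R\<rbrakk> \<Longrightarrow> alt_eq R E (TAdd s t) (TAdd t s)"
  | add_zero: "s \<in> aterms R \<Longrightarrow> alt_eq R E (TAdd TZero s) s"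
  | add_neg: "s \<in> aterms R \<Longrightarrow> alt_eq R E (TAdd (TNeg s) s) TZero"
  | smult_add_scalar: "\<lbrakk>a \<in> carrier R; b \<in> carrier R; s \<in> aterms R\<rbrakk>
      \<Longrightarrow> alt_eq R E (TSmult (a \<oplus>\<^bsub>R\<^esub> b) s) (TAdd (TSmult a s) (TSmult b s))"
  | smult_add: "\<lbrakk>a \<in> carrier R; s \<in> aterms R; t \<in> aterms R\<rbrakk>
      \<Longrightarrow> alt_eq R E (TSmult a (TAdd s t)) (TAdd (TSmult a s) (TSmult a t))"
  | smult_smult: "\<lbrakk>a \<in> carrier R; b \<in> carrier R; s \<in> aterms R\<rbrakk>
      \<Longrightarrow> alt_eq R E (TSmult (a \<otimes>\<^bsub>R\<^esub> b) s) (TSmult a (TSmult b s))"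
  | smult_one: "s \<in> aterms R \<Longrightarrow> alt_eq R E (TSmult \<one>\<^bsub>R\<^esub> s) s"
  | mult_one_left: "s \<in> aterms R \<Longrightarrow> alt_eq R E (TMult TOne s) s"
  | mult_one_right: "s \<in> aterms R \<Longrightarrow> alt_eq R E (TMult s TOne) s"
  | mult_add_left: "\<lbrakk>s \<in> aterms R; t \<in> aterms R; u \<in> aterms R\<rbrakk>
      \<Longrightarrow> alt_eq R E (TMult (TAdd s t) u) (TAdd (TMult s u) (TMult t u))"
  | mult_add_right: "\<lbrakk>s \<in> aterms R; t \<in> aterms R; u \<in> aterms R\<rbrakk>
      \<Longrightarrow> alt_eq R E (TMult u (TAdd s t)) (TAdd (TMult u s) (TMult u t))"
  | mult_smult_left: "\<lbrakk>a \<in> carrier R; s \<in> aterms R; t \<in> aterms R\<rbrakk>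
      \<Longrightarrow> alt_eq R E (TMult (TSmult a s) t) (TSmult a (TMult s t))"
  | mult_smult_right: "\<lbrakk>a \<in> carrier R; s \<in> aterms R; t \<in> aterms R\<rbrakk>
      \<Longrightarrow> alt_eq R E (TMult s (TSmult a t)) (TSmult a (TMult s t))"
  | left_alt: "\<lbrakk>s \<in> aterms R; t \<in> aterms R\<rbrakk>
      \<Longrightarrow> alt_eq R E (TMult (TMult s s) t) (TMult s (TMult s t))"
  | right_alt: "\<lbrakk>s \<in> aterms R; t \<in> aterms R\<rbrakk>
      \<Longrightarrow> alt_eq R E (TMult (TMult t s) s) (TMult t (TMult s s))"

definition alt_class ::
  "('a, 'm) ring_scheme \<Rightarrow> (('a, 'j) aterm \<times> ('a, 'j) aterm) set
    \<Rightarrow> ('a, 'j) aterm \<Rightarrow> ('a, 'j) aterm set" where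
  "alt_class R E s = {t. alt_eq R E s t}"

definition presented_alt_algebra ::
  "('a, 'm) ring_scheme \<Rightarrow> (('a, 'j) aterm \<times> ('a, 'j) aterm) set
    \<Rightarrow> ('a, ('a, 'j) aterm set) module" where
  "presented_alt_algebra R E = \<lparr>
     carrier = alt_class R E ` aterms R,
     mult = (\<lambda>X Y. \<Union>s\<in>X. \<Union>t\<in>Y. alt_class R E (TMult s t)),
     one = alt_class R E TOne,
     zero = alt_class R E TZero,
     add = (\<lambda>X Y. \<Union>s\<in>X. \<Union>t\<in>Y. alt_class R E (TAdd s t)),
     smult = (\<lambda>a X. \<Union>s\<in>X. alt_class R E (TSmult a s))\<rparr>"

fun aterm_eval :: "('a, 'b, 'm) module_scheme \<Rightarrow> ('j \<Rightarrow> 'b) \<Rightarrow> ('a, 'j) aterm \<Rightarrow> 'b" where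
  "aterm_eval B g (TGen j) = g j"
| "aterm_eval B g TZero = \<zero>\<^bsub>B\<^esub>"
| "aterm_eval B g TOne = \<one>\<^bsub>B\<^esub>"
| "aterm_eval B g (TAdd s t) = aterm_eval B g s \<oplus>\<^bsub>B\<^esub> aterm_eval B g t"
| "aterm_eval B g (TNeg s) = \<ominus>\<^bsub>B\<^esub> aterm_eval B g s"
| "aterm_eval B g (TSmult a s) = a \<odot>\<^bsub>B\<^esub> aterm_eval B g s"
| "aterm_eval B g (TMult s t) = aterm_eval B g s \<otimes>\<^bsub>B\<^esub> aterm_eval B g t"

text \<open>
  The construction has the universal property of the presentation: see
  \<open>presented_alternative\<close>, \<open>presented_relation\<close> and \<open>presented_universal\<close>.
\<close>

lemma aterms_simps [simp]:
  "TGen j \<in> aterms R" "TZero \<in> aterms R" "TOne \<in> aterms R"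
  "TAdd s t \<in> aterms R \<longleftrightarrow> s \<in> aterms R \<and> t \<in> aterms R"
  "TNeg s \<in> aterms R \<longleftrightarrow> s \<in> aterms R"
  "TSmult a s \<in> aterms R \<longleftrightarrow> a \<in> carrier R \<and> s \<in> aterms R"
  "TMult s t \<in> aterms R \<longleftrightarrow> s \<in> aterms R \<and> t \<in> aterms R"
  by (auto simp: aterms_def)

lemma alt_eq_aterms:
  assumes "cring R" "alt_eq R E s t"
  shows "s \<in> aterms R \<and> t \<in> aterms R"
proof -
  interpret cring R by fact
  show ?thesis using assms(2) by induction auto
qed

lemma alt_class_eq_iff:
  assumes "s \<in> aterms R"
  shows "alt_class R E s = alt_class R E t \<longleftrightarrow> alt_eq R E s t"
  using assms unfolding alt_class_def
  by (auto intro: alt_eq.refl alt_eq.sym alt_eq.trans)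

lemma presented_ops:
  shows "\<lbrakk>s \<in> aterms R; t \<in> aterms R\<rbrakk> \<Longrightarrow>
      alt_class R E s \<oplus>\<^bsub>presented_alt_algebra R E\<^esub> alt_class R E t = alt_class R E (TAdd s t)"
    and "\<lbrakk>s \<in> aterms R; t \<in> aterms R\<rbrakk> \<Longrightarrow>
      alt_class R E s \<otimes>\<^bsub>presented_alt_algebra R E\<^esub> alt_class R E t = alt_class R E (TMult s t)"
    and "\<lbrakk>a \<in> carrier R; s \<in> aterms R\<rbrakk> \<Longrightarrow>
      a \<odot>\<^bsub>presented_alt_algebra R E\<^esub> alt_class R E s = alt_class R E (TSmult a s)"
  unfolding presented_alt_algebra_def alt_class_def
  by (auto intro: alt_eq.refl alt_eq.trans alt_eq.cong_add alt_eq.cong_mult alt_eq.cong_smult)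

lemma presented_consts:
  "carrier (presented_alt_algebra R E) = alt_class R E ` aterms R"
  "\<zero>\<^bsub>presented_alt_algebra R E\<^esub> = alt_class R E TZero"
  "\<one>\<^bsub>presented_alt_algebra R E\<^esub> = alt_class R E TOne"
  "s \<in> aterms R \<Longrightarrow> alt_class R E s \<in> alt_class R E ` aterms R"
  by (auto simp: presented_alt_algebra_def)

lemma presented_unital:
  assumes "cring R"
  shows "unital_algebra R (presented_alt_algebra R E)"
proof -
  interpret R: cring R by fact
  note ps = presented_ops presented_consts alt_class_eq_iff
  have ab: "abelian_group (presented_alt_algebra R E)"
  proof (rule abelian_groupI)
    fix x assume "x \<in> carrier (presented_alt_algebra R E)"
    then obtain s where s: "s \<in> aterms R" "x = alt_class R E s" by (auto del: equalityI simp: ps)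
    then show "\<exists>y\<in>carrier (presented_alt_algebra R E).
        y \<oplus>\<^bsub>presented_alt_algebra R E\<^esub> x = \<zero>\<^bsub>presented_alt_algebra R E\<^esub>"
      by (intro bexI[of _ "alt_class R E (TNeg s)"])
        (auto del: equalityI simp: ps intro: alt_eq.add_neg)
  qed (auto del: equalityI simp: ps
      intro: alt_eq.add_assoc alt_eq.add_comm alt_eq.add_zero)
  have "module R (presented_alt_algebra R E)"
    by (rule moduleI[OF assms ab])
      (auto del: equalityI simp: ps
        intro: alt_eq.smult_add_scalar alt_eq.smult_add alt_eq.smult_smult alt_eq.smult_one)
  then show ?thesis
    by (rule unital_algebra.intro)
      (unfold_locales, auto del: equalityI simp: ps
        intro: alt_eq.mult_one_left alt_eq.mult_one_right alt_eq.mult_add_left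
          alt_eq.mult_add_right alt_eq.mult_smult_left alt_eq.mult_smult_right)
qed

lemma presented_alternative:
  assumes "cring R"
  shows "alternative_algebra R (presented_alt_algebra R E)"
proof -
  interpret R: cring R by fact
  interpret A: unital_algebra R "presented_alt_algebra R E" by (rule presented_unital[OF assms])
  note ps = presented_ops presented_consts alt_class_eq_iff
  have *: "x \<ominus>\<^bsub>presented_alt_algebra R E\<^esub> y = \<zero>\<^bsub>presented_alt_algebra R E\<^esub>"
    if "x = y" "x \<in> carrier (presented_alt_algebra R E)" for x y
    using that by (simp add: a_minus_def A.M.r_neg)
  show ?thesis
    by unfold_locales
      (auto del: equalityI simp: associator_def ps intro!: *[unfolded ps]
        intro: alt_eq.left_alt alt_eq.right_alt)
qed

lemma presented_eval:
  assumes "cring R" "t \<in> aterms R"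
  shows "aterm_eval (presented_alt_algebra R E) (\<lambda>j. alt_class R E (TGen j)) t = alt_class R E t"
proof -
  interpret R: cring R by fact
  interpret A: unital_algebra R "presented_alt_algebra R E" by (rule presented_unital[OF assms(1)])
  note ps = presented_ops presented_consts alt_class_eq_iff
  show ?thesis using assms(2)
  proof (induction t)
    case (TNeg s)
    then have "s \<in> aterms R" by simp
    then show ?case using TNeg
      by (simp, intro A.M.minus_equality) (auto del: equalityI simp: ps alt_eq.add_neg)
  qed (auto del: equalityI simp: ps)
qed

lemma presented_relation:
  assumes "cring R" "(s, t) \<in> E" "s \<in> aterms R" "t \<in> aterms R"
  defines "A \<equiv> presented_alt_algebra R E" and "g \<equiv> \<lambda>j. alt_class R E (TGen j)"
  shows "aterm_eval A g s = aterm_eval A g t"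
  using assms by (auto simp: presented_eval alt_class_eq_iff intro: alt_eq.rel)

lemma aterm_eval_closed:
  assumes "alternative_algebra R B" "\<And>j. g j \<in> carrier B" "s \<in> aterms R"
  shows "aterm_eval B g s \<in> carrier B"
proof -
  interpret B: alternative_algebra R B by fact
  show ?thesis using assms(3)
    by (induction s) (auto simp: assms(2) B.unit_closed B.mult_closed)
qed

lemma aterm_eval_cong:
  assumes "alternative_algebra R B" "\<And>j. g j \<in> carrier B"
    and E: "\<And>s t. (s, t) \<in> E \<Longrightarrow> aterm_eval B g s = aterm_eval B g t"
    and "alt_eq R E s t"
  shows "aterm_eval B g s = aterm_eval B g t"
proof -
  interpret B: alternative_algebra R B by fact
  note cl = aterm_eval_closed[OF assms(1,2)]
  have eq: "x \<ominus>\<^bsub>B\<^esub> y = \<zero>\<^bsub>B\<^esub> \<longleftrightarrow> x = y" if "x \<in> carrier B" "y \<in> carrier B" for x y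
    using that B.M.minus_equality[of x "\<ominus>\<^bsub>B\<^esub> y"] by (auto simp: a_minus_def B.M.r_neg)
  have la: "(x \<otimes>\<^bsub>B\<^esub> x) \<otimes>\<^bsub>B\<^esub> y = x \<otimes>\<^bsub>B\<^esub> (x \<otimes>\<^bsub>B\<^esub> y)"
    and ra: "(y \<otimes>\<^bsub>B\<^esub> x) \<otimes>\<^bsub>B\<^esub> x = y \<otimes>\<^bsub>B\<^esub> (x \<otimes>\<^bsub>B\<^esub> x)"
    if "x \<in> carrier B" "y \<in> carrier B" for x y
    using B.left_alternative[OF that] B.right_alternative[OF that] that
    by (simp_all add: associator_def eq B.mult_closed)
  show ?thesis using assms(4)
    by induction
      (auto simp: cl E la ra B.M.a_ac B.M.l_neg B.M.r_neg B.smult_l_distr B.smult_r_distr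
        B.smult_assoc1 B.unit_left B.unit_right B.mult_add_left B.mult_add_right
        B.mult_smult_left B.mult_smult_right)
qed

theorem presented_universal:
  assumes R: "cring R" and B: "alternative_algebra R B" and g: "\<And>j. g j \<in> carrier B"
    and E: "\<And>s t. (s, t) \<in> E \<Longrightarrow> aterm_eval B g s = aterm_eval B g t"
  shows "\<exists>!f. f \<in> extensional (carrier (presented_alt_algebra R E)) \<and>
    f \<in> algebra_hom R (presented_alt_algebra R E) B \<and> (\<forall>j. f (alt_class R E (TGen j)) = g j)"
proof -
  interpret R: cring R by fact
  let ?A = "presented_alt_algebra R E"
  interpret A: unital_algebra R ?A by (rule presented_unital[OF R])
  interpret B: alternative_algebra R B by fact
  note cl = aterm_eval_closed[OF B g]
  note ps = presented_ops presented_consts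
  define f where "f = restrict (\<lambda>X. aterm_eval B g (SOME t. t \<in> X)) (carrier ?A)"
  have f: "f (alt_class R E s) = aterm_eval B g s" if s: "s \<in> aterms R" for s
  proof -
    have "s \<in> alt_class R E s" using s by (auto simp: alt_class_def intro: alt_eq.refl)
    then have "(SOME t. t \<in> alt_class R E s) \<in> alt_class R E s" by (rule someI)
    then have "alt_eq R E s (SOME t. t \<in> alt_class R E s)" by (simp add: alt_class_def)
    from aterm_eval_cong[OF B g E this] s show ?thesis by (simp add: f_def ps)
  qed
  show ?thesis
  proof (rule ex1I[of _ f])
    show "f \<in> extensional (carrier ?A) \<and> f \<in> algebra_hom R ?A B \<and>
        (\<forall>j. f (alt_class R E (TGen j)) = g j)"
      by (auto simp: algebra_hom_def ring_hom_def ps f cl) (simp add: f_def ps)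
  next
    fix h assume h: "h \<in> extensional (carrier ?A) \<and> h \<in> algebra_hom R ?A B \<and>
        (\<forall>j. h (alt_class R E (TGen j)) = g j)"
    then have hc: "h x \<in> carrier B" if "x \<in> carrier ?A" for x
      using that by (auto simp: algebra_hom_def ring_hom_def)
    have ha: "h (x \<oplus>\<^bsub>?A\<^esub> y) = h x \<oplus>\<^bsub>B\<^esub> h y" if "x \<in> carrier ?A" "y \<in> carrier ?A" for x y
      using h that by (auto simp: algebra_hom_def ring_hom_def)
    have hm: "h (x \<otimes>\<^bsub>?A\<^esub> y) = h x \<otimes>\<^bsub>B\<^esub> h y" if "x \<in> carrier ?A" "y \<in> carrier ?A" for x y
      using h that by (auto simp: algebra_hom_def ring_hom_def)
    have hs: "h (a \<odot>\<^bsub>?A\<^esub> x) = a \<odot>\<^bsub>B\<^esub> h x" if "a \<in> carrier R" "x \<in> carrier ?A" for a x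
      using h that by (auto simp: algebra_hom_def)
    have h1: "h \<one>\<^bsub>?A\<^esub> = \<one>\<^bsub>B\<^esub>" using h by (auto simp: algebra_hom_def ring_hom_def)
    have h0: "h \<zero>\<^bsub>?A\<^esub> = \<zero>\<^bsub>B\<^esub>"
      using hs[OF R.zero_closed A.M.zero_closed] hc[OF A.M.zero_closed] by simp
    have hn: "h (\<ominus>\<^bsub>?A\<^esub> x) = \<ominus>\<^bsub>B\<^esub> h x" if "x \<in> carrier ?A" for x
      using ha[OF A.M.a_inv_closed[OF that] that] that h0
      by (metis A.M.a_inv_closed A.M.l_neg B.M.minus_equality hc)
    have "h (aterm_eval ?A (\<lambda>j. alt_class R E (TGen j)) s) = aterm_eval B g s"
      if "s \<in> aterms R" for s
      using that
    proof (induction s)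
      case (TNeg s)
      then show ?case by (simp add: hn presented_eval[OF R] presented_consts)
    next
      case TZero
      then show ?case using h0 by simp
    next
      case TOne
      then show ?case using h1 by simp
    qed (auto simp: ha hm hs h presented_eval[OF R] presented_consts)
    then have "h x = f x" if "x \<in> carrier ?A" for x
      using that by (auto simp: presented_eval[OF R] f ps)
    then show "h = f"
      using h by (intro extensionalityI[of h "carrier ?A" f]) (auto simp: f_def)
  qed
qed


section \<open>Cayley polynomials\<close>

definition cayley_relations :: "(('a, gen3) aterm \<times> ('a, gen3) aterm) set" where
  "cayley_relations = (let t1 = TGen G1; t2 = TGen G2; t3 = TGen G3 in
    {(TMult t2 t1, TNeg (TMult t1 t2)),
     (TMult t3 t1, TNeg (TMult t1 t3)),
     (TMult t3 t2, TNeg (TMult t2 t3)),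
     (TMult (TMult t1 t2) t3, TNeg (TMult t1 (TMult t2 t3)))})"

definition cayley_polys :: "('a, 'm) ring_scheme \<Rightarrow> ('a, ('a, gen3) aterm set) module" where
  "cayley_polys R = presented_alt_algebra R cayley_relations"

definition cayley_gen :: "('a, 'm) ring_scheme \<Rightarrow> gen3 \<Rightarrow> ('a, gen3) aterm set" where
  "cayley_gen R j = alt_class R cayley_relations (TGen j)"

definition cayley_gen_sq :: "('a, 'm) ring_scheme \<Rightarrow> gen3 \<Rightarrow> ('a, gen3) aterm set" where
  "cayley_gen_sq R j = cayley_gen R j \<otimes>\<^bsub>cayley_polys R\<^esub> cayley_gen R j"

text \<open>The octonion algebra \<open>D\<close>, as an algebra over \<open>R[z\<^sub>1,z\<^sub>2,z\<^sub>3]\<close> and over \<open>R\<close>.\<close>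

definition poly3_octonions ::
  "('a, 'm) ring_scheme
    \<Rightarrow> (nat \<Rightarrow> nat \<Rightarrow> nat \<Rightarrow> 'a, (nat \<Rightarrow> nat \<Rightarrow> nat \<Rightarrow> 'a) oct) star_algebra" where
  "poly3_octonions R =
     octonions (poly3_ring R) (poly3_var R G1) (poly3_var R G2) (poly3_var R G3)"

definition poly3_octonions_base ::
  "('a, 'm) ring_scheme \<Rightarrow> ('a, (nat \<Rightarrow> nat \<Rightarrow> nat \<Rightarrow> 'a) oct) module" where
  "poly3_octonions_base R = restrict_scalars (poly3_const R) (poly3_octonions R)"

definition poly3_octonion_gen ::
  "('a, 'm) ring_scheme \<Rightarrow> gen3 \<Rightarrow> (nat \<Rightarrow> nat \<Rightarrow> nat \<Rightarrow> 'a) oct" where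
  "poly3_octonion_gen R = octonion_gen (poly3_ring R) (poly3_var R G1) (poly3_var R G2)"

end

theory Submission
  imports Defs "HOL-Library.Reflection"
begin

text \<open>
  The octonion algebra \<open>D = (\<Phi>[z\<^sub>1,z\<^sub>2,z\<^sub>3], z\<^sub>1, z\<^sub>2, z\<^sub>3)\<close> is alternative and its basic generators satisfy the
  Cayley relations, so the presentation provides a homomorphism \<open>\<phi>\<close> from the Cayley polynomials
  to \<open>D\<close>.  The point is to construct its inverse \<open>\<psi>\<close>.

  First, the squares \<open>t\<^sub>j\<^sup>2\<close> are central.  For three anticommuting elements with
  \<open>(x y) z = - x (y z)\<close> one checks that \<open>x\<^sup>2\<close> commutes and associates with \<open>x\<close>, \<open>y\<close> and \<open>z\<close>
  (\<open>cayley_triple_square_associates\<close>).  This suffices, because centrality in an alternative algebra can be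
  tested on generators (\<open>center_if_central_on_generators\<close>), a consequence of the skew-symmetry of the
  Kleinfeld function.  Hence \<open>z\<^sub>j \<mapsto> t\<^sub>j\<^sup>2\<close> makes the Cayley polynomials an alternative algebra over
  \<open>\<Phi>[z\<^sub>1,z\<^sub>2,z\<^sub>3]\<close>.

  Second, the Cayley-Dickson process has a universal property with respect to alternative algebras
  (\<open>cayley_dickson_extension\<close>): if \<open>h\<close> maps \<open>B\<close> to an alternative algebra and \<open>v\<close> satisfies
  \<open>v\<^sup>2 = \<mu>\<close> and \<open>h(b) v = v h(b\<^sup>*)\<close>, then \<open>a + v b \<mapsto> h(a) + v h(b)\<close> is a homomorphism.  Applied three
  times (\<open>octonion_extension\<close>), it gives \<open>\<psi>\<close>.  The composites of \<open>\<phi>\<close> and \<open>\<psi>\<close> fix generators.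

  The other assertions are read off from \<open>D\<close>.  Its center consists of the scalars, since an element
  that commutes with the last generator has components that are fixed by the involution
  (\<open>cayley_dickson_commutant\<close>).  Its grading is built along its construction: each adjunction of a
  variable or of a generator extends the grading (\<open>graded_ring_UP\<close>,
  \<open>graded_star_algebra_cayley_dickson\<close>), and components built in this way contain the spans of monomials,
  which is enough to make homogeneous decompositions unique
  (\<open>algebra_grading_by_projections\<close>).
\<close>

section \<open>Linear identities in an abelian group\<close>

text \<open>
  Rewriting with associativity and commutativity cannot cancel a term against its negative when
  other terms stand between them.  Comparing the integer coefficients of the atoms can.  So a
  linear identity is turned by \<open>reify\<close> into an equation between group terms, and \<open>group_eqI\<close>
  decides it.
\<close>

datatype group_term = Atom nat | Zero | Plus group_term group_term | Minus group_term group_term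
  | Neg group_term

datatype group_eq = Eq group_term group_term

primrec coefficient :: "group_term \<Rightarrow> nat \<Rightarrow> int" where
  "coefficient (Atom i) = (\<lambda>n. if n = i then 1 else 0)"
| "coefficient Zero = (\<lambda>n. 0)"
| "coefficient (Plus s t) = (\<lambda>n. coefficient s n + coefficient t n)"
| "coefficient (Minus s t) = (\<lambda>n. coefficient s n - coefficient t n)"
| "coefficient (Neg s) = (\<lambda>n. - coefficient s n)"

primrec atom_bound :: "group_term \<Rightarrow> nat" where
  "atom_bound (Atom i) = Suc i"
| "atom_bound Zero = 0"
| "atom_bound (Plus s t) = max (atom_bound s) (atom_bound t)"
| "atom_bound (Minus s t) = max (atom_bound s) (atom_bound t)"
| "atom_bound (Neg s) = atom_bound s"

context abelian_group
begin

primrec group_term_val :: "group_term \<Rightarrow> 'a list \<Rightarrow> 'a" where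
  "group_term_val (Atom i) vs = vs ! i"
| "group_term_val Zero vs = \<zero>"
| "group_term_val (Plus s t) vs = group_term_val s vs \<oplus> group_term_val t vs"
| "group_term_val (Minus s t) vs = group_term_val s vs \<ominus> group_term_val t vs"
| "group_term_val (Neg s) vs = \<ominus> group_term_val s vs"

primrec group_eq_val :: "group_eq \<Rightarrow> 'a list \<Rightarrow> bool" where
  "group_eq_val (Eq s t) vs \<longleftrightarrow> group_term_val s vs = group_term_val t vs"

lemmas group_reify = group_eq_val.simps group_term_val.simps

definition int_comb :: "(nat \<Rightarrow> int) \<Rightarrow> 'a list \<Rightarrow> 'a" where
  "int_comb c vs = (\<Oplus>i\<in>{..<length vs}. add_pow G (c i) (vs ! i))"

lemma int_comb_closed: "set vs \<subseteq> carrier G \<Longrightarrow> int_comb c vs \<in> carrier G"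
  by (auto simp: int_comb_def subset_iff intro!: finsum_closed)

lemma int_comb_zero: "set vs \<subseteq> carrier G \<Longrightarrow> int_comb (\<lambda>i. 0) vs = \<zero>"
  unfolding int_comb_def by (subst finsum_cong'[of _ _ "\<lambda>i. \<zero>"]) (auto simp: add_pow_def)

lemma int_comb_add:
  assumes "set vs \<subseteq> carrier G"
  shows "int_comb (\<lambda>i. c i + d i) vs = int_comb c vs \<oplus> int_comb d vs"
proof -
  have "vs ! i \<in> carrier G" if "i < length vs" for i
    using assms that by auto
  then show ?thesis
    unfolding int_comb_def
    by (subst finsum_addf[symmetric]) (auto simp: Pi_def add.int_pow_mult simp del: finsum_addf intro!: finsum_cong')
qed

lemma int_comb_neg:
  assumes "set vs \<subseteq> carrier G"
  shows "int_comb (\<lambda>i. - c i) vs = \<ominus> int_comb c vs"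
  using int_comb_add[OF assms, of "\<lambda>i. - c i" c] int_comb_zero[OF assms] int_comb_closed[OF assms]
  by (intro minus_equality[symmetric]) auto

lemma int_comb_atom:
  assumes "set vs \<subseteq> carrier G" "i < length vs"
  shows "int_comb (\<lambda>n. if n = i then 1 else 0) vs = vs ! i"
proof -
  have "vs ! j \<in> carrier G" if "j < length vs" for j
    using assms that by auto
  then have "int_comb (\<lambda>n. if n = i then 1 else 0) vs
      = (\<Oplus>n\<in>{..<length vs}. if i = n then vs ! n else \<zero>)"
    unfolding int_comb_def using assms by (intro finsum_cong') (auto simp: add_pow_def[of G 0])
  then show ?thesis
    using assms by (simp add: finsum_singleton[of i] subset_iff Pi_def)
qed

lemma group_term_val_int_comb:
  assumes "set vs \<subseteq> carrier G" "atom_bound s \<le> length vs"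
  shows "group_term_val s vs = int_comb (coefficient s) vs"
  using assms(2)
proof (induction s)
  case (Minus s t)
  then show ?case
    using int_comb_add[OF assms(1), of "coefficient s" "\<lambda>i. - coefficient t i"]
    by (simp add: int_comb_neg assms(1) a_minus_def)
qed (auto simp: int_comb_atom int_comb_zero int_comb_add int_comb_neg assms(1))

lemma group_eqI:
  assumes "set vs \<subseteq> carrier G" "max (atom_bound s) (atom_bound t) \<le> length vs"
    and "\<forall>i\<in>set [0..<length vs]. coefficient s i = coefficient t i"
  shows "group_eq_val (Eq s t) vs"
proof -
  have "int_comb (coefficient s) vs = int_comb (coefficient t) vs"
    unfolding int_comb_def using assms(1,3) by (intro finsum_cong') (auto simp: Pi_def intro!: add.int_pow_closed)
  then show ?thesis
    using assms(1,2) by (simp add: group_term_val_int_comb)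
qed

end

section \<open>Identities of alternative algebras\<close>

context unital_algebra
begin

abbreviation amult (infixl "\<cdot>" 70) where "x \<cdot> y \<equiv> x \<otimes>\<^bsub>A\<^esub> y"
abbreviation aplus (infixl "\<^bold>+" 65) where "x \<^bold>+ y \<equiv> x \<oplus>\<^bsub>A\<^esub> y"
abbreviation aminus (infixl "\<^bold>-" 65) where "x \<^bold>- y \<equiv> x \<ominus>\<^bsub>A\<^esub> y"
abbreviation azero ("\<^bold>0") where "\<^bold>0 \<equiv> \<zero>\<^bsub>A\<^esub>"
abbreviation assoc where "assoc \<equiv> associator A"
abbreviation comm where "comm \<equiv> commutator A"

declare mult_closed [simp] unit_closed [simp] unit_left [simp] unit_right [simp]

lemma associator_closed [simp]:
  "\<lbrakk>x \<in> carrier A; y \<in> carrier A; z \<in> carrier A\<rbrakk> \<Longrightarrow> assoc x y z \<in> carrier A"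
  by (simp add: associator_def)

lemma commutator_closed [simp]: "\<lbrakk>x \<in> carrier A; y \<in> carrier A\<rbrakk> \<Longrightarrow> comm x y \<in> carrier A"
  by (simp add: commutator_def)

lemma mult_zero_left [simp]: "x \<in> carrier A \<Longrightarrow> \<^bold>0 \<cdot> x = \<^bold>0"
  using mult_add_left[of "\<^bold>0" "\<^bold>0" x] by simp

lemma mult_zero_right [simp]: "x \<in> carrier A \<Longrightarrow> x \<cdot> \<^bold>0 = \<^bold>0"
  using mult_add_right[of "\<^bold>0" "\<^bold>0" x] by simp

lemma mult_neg_left:
  "\<lbrakk>x \<in> carrier A; y \<in> carrier A\<rbrakk> \<Longrightarrow> (\<ominus>\<^bsub>A\<^esub> x) \<cdot> y = \<ominus>\<^bsub>A\<^esub> (x \<cdot> y)"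
  by (intro M.minus_equality[symmetric]) (simp_all flip: mult_add_left add: M.l_neg)

lemma mult_neg_right:
  "\<lbrakk>x \<in> carrier A; y \<in> carrier A\<rbrakk> \<Longrightarrow> y \<cdot> (\<ominus>\<^bsub>A\<^esub> x) = \<ominus>\<^bsub>A\<^esub> (y \<cdot> x)"
  by (intro M.minus_equality[symmetric]) (simp_all flip: mult_add_right add: M.l_neg)

lemma mult_minus_left:
  "\<lbrakk>x \<in> carrier A; y \<in> carrier A; z \<in> carrier A\<rbrakk> \<Longrightarrow> (x \<^bold>- y) \<cdot> z = x \<cdot> z \<^bold>- y \<cdot> z"
  by (simp add: a_minus_def mult_add_left mult_neg_left)

lemma mult_minus_right:
  "\<lbrakk>x \<in> carrier A; y \<in> carrier A; z \<in> carrier A\<rbrakk> \<Longrightarrow> z \<cdot> (x \<^bold>- y) = z \<cdot> x \<^bold>- z \<cdot> y"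
  by (simp add: a_minus_def mult_add_right mult_neg_right)

lemmas bilinear = mult_add_left mult_add_right mult_minus_left mult_minus_right
  mult_neg_left mult_neg_right

lemma minus_eq_zero_iff:
  assumes [simp]: "x \<in> carrier A" "y \<in> carrier A"
  shows "x \<^bold>- y = \<^bold>0 \<longleftrightarrow> x = y"
proof
  assume "x \<^bold>- y = \<^bold>0"
  moreover have "x = (x \<^bold>- y) \<^bold>+ y"
    by (reify M.group_reify, rule M.group_eqI) simp_all
  ultimately show "x = y" by simp
qed (simp add: a_minus_def M.r_neg)

lemma minus_zero_right [simp]: "x \<in> carrier A \<Longrightarrow> x \<^bold>- \<^bold>0 = x"
  by (reify M.group_reify, rule M.group_eqI) simp_all

lemma minus_zero_left [simp]: "x \<in> carrier A \<Longrightarrow> \<^bold>0 \<^bold>- x = \<ominus>\<^bsub>A\<^esub> x"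
  by (reify M.group_reify, rule M.group_eqI) simp_all

lemma neg_zero [simp]: "\<ominus>\<^bsub>A\<^esub> \<^bold>0 = \<^bold>0"
  by (reify M.group_reify, rule M.group_eqI) simp_all

lemma minus_self [simp]: "x \<in> carrier A \<Longrightarrow> x \<^bold>- x = \<^bold>0"
  by (simp add: minus_eq_zero_iff)

lemma neg_eq_neg_iff [simp]:
  "\<lbrakk>x \<in> carrier A; y \<in> carrier A\<rbrakk> \<Longrightarrow> \<ominus>\<^bsub>A\<^esub> x = \<ominus>\<^bsub>A\<^esub> y \<longleftrightarrow> x = y"
  by (metis M.minus_minus)

text \<open>
  The identity holds in every nonassociative ring, since all ten products of four factors cancel.
  It is the only source of the identities of degree four below.
\<close>

lemma teichmuller:
  assumes [simp]: "a \<in> carrier A" "b \<in> carrier A" "c \<in> carrier A" "d \<in> carrier A"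
  shows "assoc (a \<cdot> b) c d \<^bold>- assoc a (b \<cdot> c) d \<^bold>+ assoc a b (c \<cdot> d)
    = a \<cdot> assoc b c d \<^bold>+ assoc a b c \<cdot> d"
  by (simp add: associator_def bilinear, reify M.group_reify, rule M.group_eqI) simp_all

end

context alternative_algebra
begin

lemma associator_swap_left:
  assumes [simp]: "a \<in> carrier A" "b \<in> carrier A" "c \<in> carrier A"
  shows "assoc b a c = \<ominus>\<^bsub>A\<^esub> assoc a b c"
proof -
  have "assoc b a c = assoc (a \<^bold>+ b) (a \<^bold>+ b) c \<^bold>- assoc a a c \<^bold>- assoc b b c \<^bold>- assoc a b c"
    by (simp add: associator_def bilinear, reify M.group_reify, rule M.group_eqI) simp_all
  then show ?thesis
    by (simp add: left_alternative)
qed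

lemma associator_swap_right:
  assumes [simp]: "a \<in> carrier A" "b \<in> carrier A" "c \<in> carrier A"
  shows "assoc a c b = \<ominus>\<^bsub>A\<^esub> assoc a b c"
proof -
  have "assoc a c b = assoc a (b \<^bold>+ c) (b \<^bold>+ c) \<^bold>- assoc a b b \<^bold>- assoc a c c \<^bold>- assoc a b c"
    by (simp add: associator_def bilinear, reify M.group_reify, rule M.group_eqI) simp_all
  then show ?thesis
    by (simp add: right_alternative)
qed

lemma associator_rotate:
  assumes [simp]: "a \<in> carrier A" "b \<in> carrier A" "c \<in> carrier A"
  shows "assoc b c a = assoc a b c"
  using associator_swap_right[of b a c] associator_swap_left[of a b c] by simp

lemma left_alternative_law:
  "\<lbrakk>x \<in> carrier A; y \<in> carrier A\<rbrakk> \<Longrightarrow> (x \<cdot> x) \<cdot> y = x \<cdot> (x \<cdot> y)"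
  using left_alternative[of x y] by (simp add: associator_def minus_eq_zero_iff)

lemma flexible_law:
  "\<lbrakk>x \<in> carrier A; y \<in> carrier A\<rbrakk> \<Longrightarrow> (x \<cdot> y) \<cdot> x = x \<cdot> (y \<cdot> x)"
  using associator_swap_right[of x x y] left_alternative[of x y]
  by (simp add: associator_def minus_eq_zero_iff)

lemma associator_reverse:
  assumes [simp]: "a \<in> carrier A" "b \<in> carrier A" "c \<in> carrier A"
  shows "assoc c b a = \<ominus>\<^bsub>A\<^esub> assoc a b c"
  using associator_rotate[of a b c] associator_swap_left[of b c a] by simp

lemma double_eq_zero:
  assumes half: "\<one>\<^bsub>R\<^esub> \<oplus>\<^bsub>R\<^esub> \<one>\<^bsub>R\<^esub> \<in> Units R" and x[simp]: "x \<in> carrier A" and "x \<^bold>+ x = \<^bold>0"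
  shows "x = \<^bold>0"
proof -
  let ?h = "inv\<^bsub>R\<^esub> (\<one>\<^bsub>R\<^esub> \<oplus>\<^bsub>R\<^esub> \<one>\<^bsub>R\<^esub>)"
  have [simp]: "?h \<in> carrier R" using half by simp
  have "x = (?h \<otimes>\<^bsub>R\<^esub> (\<one>\<^bsub>R\<^esub> \<oplus>\<^bsub>R\<^esub> \<one>\<^bsub>R\<^esub>)) \<odot>\<^bsub>A\<^esub> x"
    using half by simp
  also have "\<dots> = ?h \<odot>\<^bsub>A\<^esub> (x \<^bold>+ x)"
    by (simp add: smult_assoc1 smult_l_distr)
  also have "\<dots> = \<^bold>0" by (simp add: assms(3))
  finally show ?thesis .
qed

text \<open>
  The defect of the associator from being a twisted derivation in its first argument.  In an
  alternative algebra it is a skew-symmetric function of all four arguments.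
\<close>

definition kleinfeld :: "'c \<Rightarrow> 'c \<Rightarrow> 'c \<Rightarrow> 'c \<Rightarrow> 'c" where
  "kleinfeld a b c d = assoc (a \<cdot> b) c d \<^bold>- b \<cdot> assoc a c d \<^bold>- assoc b c d \<cdot> a"

lemma kleinfeld_closed [simp]:
  "\<lbrakk>a \<in> carrier A; b \<in> carrier A; c \<in> carrier A; d \<in> carrier A\<rbrakk> \<Longrightarrow> kleinfeld a b c d \<in> carrier A"
  by (simp add: kleinfeld_def)

lemma teichmuller_rotated:
  assumes [simp]: "x \<in> carrier A" "y \<in> carrier A" "z \<in> carrier A" "w \<in> carrier A"
  shows "assoc (x \<cdot> y) z w \<^bold>- assoc (y \<cdot> z) w x \<^bold>+ assoc (z \<cdot> w) x y
      \<^bold>- (x \<cdot> assoc y z w \<^bold>+ assoc x y z \<cdot> w) = \<^bold>0"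
  using teichmuller[of x y z w]
  by (simp add: minus_eq_zero_iff associator_rotate[of x "y \<cdot> z" w]
      associator_rotate[of "z \<cdot> w" x y])

text \<open>
  In the sum of the Teichmueller identities for \<open>(a,b,c,d)\<close> and \<open>(b,c,d,a)\<close> the associators with
  the products \<open>b c\<close> and \<open>c d\<close> cancel, and the sum of the two Kleinfeld functions remains.
\<close>

lemma kleinfeld_rotate:
  assumes [simp]: "a \<in> carrier A" "b \<in> carrier A" "c \<in> carrier A" "d \<in> carrier A"
  shows "kleinfeld d a b c = \<ominus>\<^bsub>A\<^esub> kleinfeld a b c d"
proof -
  have "kleinfeld d a b c =
      (assoc (a \<cdot> b) c d \<^bold>- assoc (b \<cdot> c) d a \<^bold>+ assoc (c \<cdot> d) a b
        \<^bold>- (a \<cdot> assoc b c d \<^bold>+ assoc a b c \<cdot> d))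
      \<^bold>+ (assoc (b \<cdot> c) d a \<^bold>- assoc (c \<cdot> d) a b \<^bold>+ assoc (d \<cdot> a) b c
        \<^bold>- (b \<cdot> assoc c d a \<^bold>+ assoc b c d \<cdot> a))
      \<^bold>- kleinfeld a b c d"
    unfolding kleinfeld_def associator_rotate[of a c d, simplified, symmetric]
      associator_rotate[of d b c, simplified, symmetric]
    by (reify M.group_reify, rule M.group_eqI) simp_all
  then show ?thesis by (simp add: teichmuller_rotated)
qed

lemma kleinfeld_swap_right:
  assumes [simp]: "a \<in> carrier A" "b \<in> carrier A" "c \<in> carrier A" "d \<in> carrier A"
  shows "kleinfeld a b d c = \<ominus>\<^bsub>A\<^esub> kleinfeld a b c d"
  unfolding kleinfeld_def associator_swap_right[of _ c d, simplified]
  by (simp add: associator_swap_right[of _ c d] bilinear, reify M.group_reify, rule M.group_eqI) simp_all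

text \<open>
  Write \<open>f\<close> for the Kleinfeld function, which is skew-symmetric.  Under the hypotheses both
  \<open>2 f(w,a,b,c) = f(w,a,b,c) - f(a,w,b,c)\<close> and the value of
  \<open>3 f(w,a,b,c) = f(w,a,b,c) - f(a,b,c,w) + f(b,c,w,a)\<close> that the Teichmueller identity gives
  reduce to \<open>[w,(a,b,c)] - [a,(w,b,c)]\<close>.
\<close>

lemma kleinfeld_vanishes:
  assumes [simp]: "w \<in> carrier A" "a \<in> carrier A" "b \<in> carrier A" "c \<in> carrier A"
    and wa: "w \<cdot> a = a \<cdot> w" and b: "assoc w a b = \<^bold>0" and c: "assoc w a c = \<^bold>0"
  shows "kleinfeld w a b c = \<^bold>0"
proof -
  let ?k = "kleinfeld w a b c"
  have z: "assoc b w a = \<^bold>0" "assoc c w a = \<^bold>0" "assoc a c w = \<^bold>0" "assoc a b w = \<^bold>0"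
    using b c associator_rotate[of w a b] associator_rotate[of w a c]
      associator_rotate[of a c w] associator_rotate[of a b w] by auto
  have "kleinfeld w a b c \<^bold>- kleinfeld a b c w \<^bold>+ kleinfeld b c w a =
      (assoc (w \<cdot> a) b c \<^bold>- assoc (a \<cdot> b) c w \<^bold>+ assoc (b \<cdot> c) w a
      \<^bold>- (w \<cdot> assoc a b c \<^bold>+ assoc w a b \<cdot> c)) \<^bold>+ (?k \<^bold>- kleinfeld a w b c)"
    unfolding kleinfeld_def wa b z associator_rotate[of w b c, simplified]
    by (simp, reify M.group_reify, rule M.group_eqI) simp_all
  moreover have "kleinfeld a b c w = \<ominus>\<^bsub>A\<^esub> ?k"
    using kleinfeld_rotate[of a b c w] by simp
  moreover have bcwa: "kleinfeld b c w a = ?k"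
    using kleinfeld_rotate[of a b c w] kleinfeld_rotate[of b c w a] by simp
  moreover have "kleinfeld a w b c = \<ominus>\<^bsub>A\<^esub> ?k"
    using kleinfeld_rotate[of w b c a] kleinfeld_rotate[of b c a w] kleinfeld_swap_right[of b c w a]
      bcwa by simp
  ultimately have "?k \<^bold>- (\<ominus>\<^bsub>A\<^esub> ?k) \<^bold>+ ?k = ?k \<^bold>- (\<ominus>\<^bsub>A\<^esub> ?k)"
    by (simp add: teichmuller_rotated)
  moreover have "?k = (?k \<^bold>- (\<ominus>\<^bsub>A\<^esub> ?k) \<^bold>+ ?k) \<^bold>- (?k \<^bold>- (\<ominus>\<^bsub>A\<^esub> ?k))"
    by (reify M.group_reify, rule M.group_eqI) simp_all
  ultimately show ?thesis by (simp add: minus_eq_zero_iff)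
qed

lemma kleinfeld_opposite:
  assumes [simp]: "a \<in> carrier A" "b \<in> carrier A" "c \<in> carrier A" "d \<in> carrier A"
  shows "kleinfeld c d a b = kleinfeld a b c d"
  using kleinfeld_rotate[of a b c d] kleinfeld_rotate[of d a b c] by simp

text \<open>
  With \<open>f\<close> the Kleinfeld function, in \<open>f(b,c,w,a) = f(w,a,b,c) = 0\<close> only the term \<open>(b c,w,a)\<close> survives.
\<close>

lemma nuclear_arguments_mult:
  assumes [simp]: "w \<in> carrier A" "a \<in> carrier A" "b \<in> carrier A" "c \<in> carrier A"
    and "w \<cdot> a = a \<cdot> w" and b: "assoc w a b = \<^bold>0" and c: "assoc w a c = \<^bold>0"
  shows "assoc w a (b \<cdot> c) = \<^bold>0"
proof -
  have "kleinfeld b c w a = \<^bold>0"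
    using kleinfeld_vanishes[OF assms] kleinfeld_opposite[of w a b c] by simp
  moreover have "assoc b w a = \<^bold>0" "assoc c w a = \<^bold>0"
    using b c associator_rotate[of b w a] associator_rotate[of c w a] by auto
  ultimately show ?thesis
    using associator_rotate[of "b \<cdot> c" w a] by (simp add: kleinfeld_def)
qed

text \<open>
  For the Kleinfeld function \<open>f\<close>, the equation \<open>f(a,b,c,w) = - f(w,a,b,c) = 0\<close> reduces to its term
  \<open>(a b,c,w)\<close>; commutation uses that \<open>w\<close> associates with \<open>a\<close> and \<open>b\<close>.
\<close>

lemma central_arguments_mult:
  assumes [simp]: "w \<in> carrier A" "a \<in> carrier A" "b \<in> carrier A"
    and wa: "w \<cdot> a = a \<cdot> w" and wb: "w \<cdot> b = b \<cdot> w"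
    and a: "\<And>c. c \<in> carrier A \<Longrightarrow> assoc w a c = \<^bold>0"
    and b: "\<And>c. c \<in> carrier A \<Longrightarrow> assoc w b c = \<^bold>0"
  shows "w \<cdot> (a \<cdot> b) = (a \<cdot> b) \<cdot> w"
    and "\<And>c. c \<in> carrier A \<Longrightarrow> assoc w (a \<cdot> b) c = \<^bold>0"
proof -
  have "assoc a w b = \<^bold>0" "assoc a b w = \<^bold>0"
    using a[of b] associator_swap_left[of w a b] associator_rotate[of w a b] by simp_all
  then have "(w \<cdot> a) \<cdot> b = w \<cdot> (a \<cdot> b)" "(a \<cdot> w) \<cdot> b = a \<cdot> (w \<cdot> b)" "(a \<cdot> b) \<cdot> w = a \<cdot> (b \<cdot> w)"
    using a[of b] by (simp_all add: associator_def minus_eq_zero_iff)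
  then show "w \<cdot> (a \<cdot> b) = (a \<cdot> b) \<cdot> w"
    by (metis wa wb)
next
  fix c assume [simp]: "c \<in> carrier A"
  have "kleinfeld w a b c = \<^bold>0"
    using kleinfeld_vanishes[of w a b c] wa a by simp
  then have "kleinfeld a b c w = \<^bold>0"
    using kleinfeld_rotate[of a b c w] neg_zero M.minus_minus[of "kleinfeld a b c w"] by auto
  moreover have "assoc a c w = \<^bold>0" "assoc b c w = \<^bold>0"
    using a[of c] b[of c] associator_rotate[of w a c] associator_rotate[of w b c] by auto
  ultimately have "assoc (a \<cdot> b) c w = \<^bold>0"
    by (simp add: kleinfeld_def)
  then show "assoc w (a \<cdot> b) c = \<^bold>0"
    using associator_rotate[of w "a \<cdot> b" c] by simp
qed

text \<open>
  Centrality can be tested on generators: for a generator \<open>s\<close> the elements \<open>c\<close> with \<open>(w,s,c) = 0\<close>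
  form a subalgebra, which must be everything; after that, so do the elements \<open>x\<close> that commute
  with \<open>w\<close> and satisfy \<open>(w,x,c) = 0\<close> for all \<open>c\<close>.
\<close>

lemma center_if_central_on_generators:
  assumes generated: "carrier A = subalgebra_gen R A S" and S: "S \<subseteq> carrier A"
    and w[simp]: "w \<in> carrier A"
    and comm: "\<And>s. s \<in> S \<Longrightarrow> w \<cdot> s = s \<cdot> w"
    and ass: "\<And>s s'. \<lbrakk>s \<in> S; s' \<in> S\<rbrakk> \<Longrightarrow> assoc w s s' = \<^bold>0"
  shows "w \<in> alt_center A"
proof -
  have 1: "assoc w s c = \<^bold>0" if s: "s \<in> S" and "c \<in> carrier A" for s c
  proof -
    have [simp]: "s \<in> carrier A" using s S by blast
    have "c \<in> carrier A \<and> assoc w s c = \<^bold>0"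
      using \<open>c \<in> carrier A\<close> unfolding generated
    proof induction
      case (gen x) then show ?case using ass s S by (auto simp flip: generated)
    next
      case one then show ?case by (simp add: associator_def minus_eq_zero_iff flip: generated)
    next
      case (add x y)
      then have [simp]: "x \<in> carrier A" "y \<in> carrier A" by (simp_all add: generated)
      have "assoc w s (x \<^bold>+ y) = assoc w s x \<^bold>+ assoc w s y"
        by (simp add: associator_def bilinear, reify M.group_reify, rule M.group_eqI) simp_all
      then show ?case using add by (simp flip: generated)
    next
      case (mult x y)
      then have [simp]: "x \<in> carrier A" "y \<in> carrier A" by (simp_all add: generated)
      then show ?case using mult nuclear_arguments_mult[of w s x y] comm[OF s]
        by (simp flip: generated)
    next
      case (smult r x)
      then have [simp]: "x \<in> carrier A" by (simp_all add: generated)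
      have "assoc w s (r \<odot>\<^bsub>A\<^esub> x) = r \<odot>\<^bsub>A\<^esub> assoc w s x"
        using \<open>r \<in> carrier R\<close>
        by (simp add: associator_def mult_smult_right a_minus_def smult_r_distr smult_r_minus)
      then show ?case using smult by (simp flip: generated)
    qed
    then show ?thesis by simp
  qed
  have "w \<cdot> x = x \<cdot> w \<and> (\<forall>c\<in>carrier A. assoc w x c = \<^bold>0)" if "x \<in> carrier A" for x
    using that unfolding generated
  proof induction
    case (gen x) then show ?case using comm 1 S by (auto simp flip: generated)
  next
    case one then show ?case by (simp add: associator_def minus_eq_zero_iff flip: generated)
  next
    case (add x y)
    then have [simp]: "x \<in> carrier A" "y \<in> carrier A" by (simp_all add: generated)
    have "assoc w (x \<^bold>+ y) c = assoc w x c \<^bold>+ assoc w y c" if [simp]: "c \<in> carrier A" for c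
      by (simp add: associator_def bilinear, reify M.group_reify, rule M.group_eqI) simp_all
    then show ?case using add by (simp add: bilinear flip: generated)
  next
    case (mult x y)
    then have [simp]: "x \<in> carrier A" "y \<in> carrier A" by (simp_all add: generated)
    show ?case using mult central_arguments_mult[of w x y]
      by (simp flip: generated)
  next
    case (smult r x)
    then have [simp]: "x \<in> carrier A" by (simp_all add: generated)
    have "assoc w (r \<odot>\<^bsub>A\<^esub> x) c = r \<odot>\<^bsub>A\<^esub> assoc w x c" if [simp]: "c \<in> carrier A" for c
      using \<open>r \<in> carrier R\<close>
      by (simp add: associator_def mult_smult_right mult_smult_left a_minus_def smult_r_distr smult_r_minus)
    then show ?case using smult by (simp add: mult_smult_left mult_smult_right flip: generated)
  qed
  then show ?thesis
    by (simp add: alt_center_def commutator_def minus_eq_zero_iff)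
qed

section \<open>The center of an alternative algebra\<close>

lemma alt_centerD:
  assumes "w \<in> alt_center A"
  shows "w \<in> carrier A"
    and "x \<in> carrier A \<Longrightarrow> w \<cdot> x = x \<cdot> w"
    and "\<lbrakk>x \<in> carrier A; y \<in> carrier A\<rbrakk> \<Longrightarrow> (w \<cdot> x) \<cdot> y = w \<cdot> (x \<cdot> y)"
    and "\<lbrakk>x \<in> carrier A; y \<in> carrier A\<rbrakk> \<Longrightarrow> x \<cdot> (w \<cdot> y) = w \<cdot> (x \<cdot> y)"
proof -
  show w: "w \<in> carrier A" using assms by (simp add: alt_center_def)
  have *: "w \<cdot> x = x \<cdot> w" "assoc w x y = \<^bold>0" if "x \<in> carrier A" "y \<in> carrier A" for x y
  proof -
    have "comm w x = \<^bold>0 \<and> assoc w x y = \<^bold>0"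
      using assms that unfolding alt_center_def by blast
    then show "w \<cdot> x = x \<cdot> w" "assoc w x y = \<^bold>0"
      using that w by (simp_all add: commutator_def minus_eq_zero_iff)
  qed
  show "x \<in> carrier A \<Longrightarrow> w \<cdot> x = x \<cdot> w" by (rule *)
  show 1: "(w \<cdot> x) \<cdot> y = w \<cdot> (x \<cdot> y)" if "x \<in> carrier A" "y \<in> carrier A" for x y
    using *(2)[OF that] w that by (simp add: associator_def minus_eq_zero_iff)
  show "x \<cdot> (w \<cdot> y) = w \<cdot> (x \<cdot> y)" if "x \<in> carrier A" "y \<in> carrier A"
  proof -
    have "assoc x w y = \<^bold>0" using *(2)[OF that] w that associator_swap_left[of w x y] by simp
    then have "x \<cdot> (w \<cdot> y) = (x \<cdot> w) \<cdot> y" using w that by (simp add: associator_def minus_eq_zero_iff)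
    then show ?thesis using *(1)[of x] 1[OF that] that by simp
  qed
qed

lemma alt_centerI:
  assumes "w \<in> carrier A" "\<And>x. x \<in> carrier A \<Longrightarrow> w \<cdot> x = x \<cdot> w"
    and "\<And>x y. \<lbrakk>x \<in> carrier A; y \<in> carrier A\<rbrakk> \<Longrightarrow> (w \<cdot> x) \<cdot> y = w \<cdot> (x \<cdot> y)"
  shows "w \<in> alt_center A"
proof -
  have "comm w x = \<^bold>0 \<and> assoc w x y = \<^bold>0" if "x \<in> carrier A" "y \<in> carrier A" for x y
    using assms(1) assms(2)[OF that(1)] assms(3)[OF that] that
    by (simp add: commutator_def associator_def minus_eq_zero_iff)
  then show ?thesis using assms(1) by (simp add: alt_center_def)
qed

lemma smult_one_central:
  assumes "r \<in> carrier R" shows "r \<odot>\<^bsub>A\<^esub> \<one>\<^bsub>A\<^esub> \<in> alt_center A"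
  using assms by (intro alt_centerI) (simp_all add: mult_smult_left mult_smult_right)

lemma one_in_center: "\<one>\<^bsub>A\<^esub> \<in> alt_center A"
  by (rule alt_centerI) simp_all

lemma zero_in_center: "\<^bold>0 \<in> alt_center A"
  by (rule alt_centerI) simp_all

lemma add_in_center:
  assumes v: "v \<in> alt_center A" and w: "w \<in> alt_center A" shows "v \<^bold>+ w \<in> alt_center A"
proof (rule alt_centerI)
  note [simp] = alt_centerD(1)[OF v] alt_centerD(1)[OF w]
  show "(v \<^bold>+ w) \<cdot> x = x \<cdot> (v \<^bold>+ w)" if "x \<in> carrier A" for x
    using that alt_centerD(2)[OF v that] alt_centerD(2)[OF w that] by (simp add: bilinear)
qed (simp_all add: bilinear alt_centerD(1,3)[OF v] alt_centerD(1,3)[OF w])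

lemma neg_in_center:
  assumes w: "w \<in> alt_center A" shows "\<ominus>\<^bsub>A\<^esub> w \<in> alt_center A"
proof (rule alt_centerI)
  note [simp] = alt_centerD(1)[OF w]
  show "(\<ominus>\<^bsub>A\<^esub> w) \<cdot> x = x \<cdot> (\<ominus>\<^bsub>A\<^esub> w)" if "x \<in> carrier A" for x
    using that alt_centerD(2)[OF w that] by (simp add: bilinear)
qed (simp_all add: bilinear alt_centerD(1,3)[OF w])

lemma mult_in_center:
  assumes v: "v \<in> alt_center A" and w: "w \<in> alt_center A" shows "v \<cdot> w \<in> alt_center A"
proof (rule alt_centerI)
  note [simp] = alt_centerD(1)[OF v] alt_centerD(1)[OF w]
  show "(v \<cdot> w) \<cdot> x = x \<cdot> (v \<cdot> w)" if "x \<in> carrier A" for x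
    using that alt_centerD(2)[OF w that]
    by (simp add: alt_centerD(3,4)[OF v])
qed (simp_all add: alt_centerD(1,3)[OF v] alt_centerD(1,3)[OF w])

lemma smult_in_center:
  assumes "r \<in> carrier R" "w \<in> alt_center A" shows "r \<odot>\<^bsub>A\<^esub> w \<in> alt_center A"
  using mult_in_center[OF smult_one_central[OF assms(1)] assms(2)] alt_centerD(1)[OF assms(2)] assms(1)
  by (simp add: mult_smult_left)

lemma center_cring: "cring (A\<lparr>carrier := alt_center A\<rparr>)"
proof (rule cringI)
  show "abelian_group (A\<lparr>carrier := alt_center A\<rparr>)"
  proof (rule abelian_groupI)
    fix x assume "x \<in> carrier (A\<lparr>carrier := alt_center A\<rparr>)"
    then show "\<exists>y\<in>carrier (A\<lparr>carrier := alt_center A\<rparr>).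
        y \<oplus>\<^bsub>A\<lparr>carrier := alt_center A\<rparr>\<^esub> x = \<zero>\<^bsub>A\<lparr>carrier := alt_center A\<rparr>\<^esub>"
      by (auto intro!: bexI[of _ "\<ominus>\<^bsub>A\<^esub> x"] simp: neg_in_center alt_centerD(1) M.l_neg)
  qed (auto simp: add_in_center zero_in_center alt_centerD(1) M.a_ac)
  show "comm_monoid (A\<lparr>carrier := alt_center A\<rparr>)"
    by (rule comm_monoidI)
      (auto simp: mult_in_center one_in_center alt_centerD(1,3) intro: alt_centerD(2))
qed (auto simp: alt_centerD(1) mult_add_left)

section \<open>Elements satisfying the Cayley relations\<close>

definition cayley_triple :: "'c \<Rightarrow> 'c \<Rightarrow> 'c \<Rightarrow> bool" where
  "cayley_triple x y z \<longleftrightarrow> x \<in> carrier A \<and> y \<in> carrier A \<and> z \<in> carrier A \<and>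
     y \<cdot> x = \<ominus>\<^bsub>A\<^esub> (x \<cdot> y) \<and> z \<cdot> x = \<ominus>\<^bsub>A\<^esub> (x \<cdot> z) \<and> z \<cdot> y = \<ominus>\<^bsub>A\<^esub> (y \<cdot> z) \<and>
     (x \<cdot> y) \<cdot> z = \<ominus>\<^bsub>A\<^esub> (x \<cdot> (y \<cdot> z))"

lemma cayley_tripleD:
  assumes "cayley_triple x y z"
  shows "x \<in> carrier A" "y \<in> carrier A" "z \<in> carrier A"
    and "y \<cdot> x = \<ominus>\<^bsub>A\<^esub> (x \<cdot> y)" "z \<cdot> x = \<ominus>\<^bsub>A\<^esub> (x \<cdot> z)" "z \<cdot> y = \<ominus>\<^bsub>A\<^esub> (y \<cdot> z)"
    and "x \<cdot> (y \<cdot> z) = \<ominus>\<^bsub>A\<^esub> ((x \<cdot> y) \<cdot> z)"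
  using assms by (auto simp: cayley_triple_def)

text \<open>
  The Cayley relations are symmetric in the three elements, because \<open>(x,y,z) = 2 (x y) z\<close> and the
  associator is alternating.  Two transpositions generate all permutations, so facts about one of
  the elements transfer to the others.
\<close>

lemma cayley_triple_swap_left:
  assumes "cayley_triple x y z" shows "cayley_triple y x z"
proof -
  note t = cayley_tripleD[OF assms] and [simp] = cayley_tripleD(1,2,3)[OF assms]
  have "y \<cdot> (x \<cdot> z) = (y \<cdot> x) \<cdot> z \<^bold>- assoc y x z"
    unfolding associator_def by (reify M.group_reify, rule M.group_eqI) simp_all
  also have "assoc y x z = \<ominus>\<^bsub>A\<^esub> ((x \<cdot> y) \<cdot> z \<^bold>+ (x \<cdot> y) \<cdot> z)"
    by (simp add: associator_swap_left[of x y z], simp add: associator_def t,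
        reify M.group_reify, rule M.group_eqI) simp_all
  also have "(y \<cdot> x) \<cdot> z \<^bold>- \<ominus>\<^bsub>A\<^esub> ((x \<cdot> y) \<cdot> z \<^bold>+ (x \<cdot> y) \<cdot> z) = \<ominus>\<^bsub>A\<^esub> ((y \<cdot> x) \<cdot> z)"
    by (simp add: t bilinear, reify M.group_reify, rule M.group_eqI) simp_all
  finally show ?thesis
    by (simp add: cayley_triple_def t(4-6))
qed

lemma cayley_triple_swap_right:
  assumes "cayley_triple x y z" shows "cayley_triple x z y"
proof -
  note t = cayley_tripleD[OF assms] and [simp] = cayley_tripleD(1,2,3)[OF assms]
  have "(x \<cdot> z) \<cdot> y = x \<cdot> (z \<cdot> y) \<^bold>+ assoc x z y"
    unfolding associator_def by (reify M.group_reify, rule M.group_eqI) simp_all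
  also have "assoc x z y = \<ominus>\<^bsub>A\<^esub> ((x \<cdot> y) \<cdot> z \<^bold>+ (x \<cdot> y) \<cdot> z)"
    by (simp add: associator_swap_right[of x y z], simp add: associator_def t,
        reify M.group_reify, rule M.group_eqI) simp_all
  also have "x \<cdot> (z \<cdot> y) \<^bold>+ \<ominus>\<^bsub>A\<^esub> ((x \<cdot> y) \<cdot> z \<^bold>+ (x \<cdot> y) \<cdot> z) = \<ominus>\<^bsub>A\<^esub> (x \<cdot> (z \<cdot> y))"
    by (simp add: t bilinear, reify M.group_reify, rule M.group_eqI) simp_all
  finally show ?thesis
    by (simp add: cayley_triple_def t(4-6))
qed

text \<open>
  The Cayley relations for the triples \<open>(z,x,y)\<close> and \<open>(x,z,y)\<close> give
  \<open>z (x y) = (x z) y = x (y z)\<close>.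
\<close>

lemma cayley_triple_product_anticommutes:
  assumes "cayley_triple x y z" shows "z \<cdot> (x \<cdot> y) = \<ominus>\<^bsub>A\<^esub> ((x \<cdot> y) \<cdot> z)"
proof -
  note t = cayley_tripleD[OF assms]
  note cayley_tripleD(7)[OF cayley_triple_swap_left[OF cayley_triple_swap_right[OF assms]]]
  then have "z \<cdot> (x \<cdot> y) = (x \<cdot> z) \<cdot> y"
    using t(1-3) by (simp add: t(5) bilinear)
  also have "\<dots> = x \<cdot> (y \<cdot> z)"
    using cayley_tripleD(7)[OF cayley_triple_swap_right[OF assms]] t(1-3)
    by (simp add: t(6) bilinear)
  finally show ?thesis by (simp add: t(7))
qed

text \<open>
  Comparing two instances of the Teichmueller identity gives
  \<open>2 (x\<^sup>2,y,z) = x (x,y,z) + (x,y,z) x\<close> because \<open>x\<close> and \<open>y\<close> anticommute, and the right-hand side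
  vanishes because \<open>x\<close> anticommutes with \<open>(x,y,z) = 2 (x y) z\<close>.
\<close>

lemma cayley_triple_square_associates:
  assumes half: "\<one>\<^bsub>R\<^esub> \<oplus>\<^bsub>R\<^esub> \<one>\<^bsub>R\<^esub> \<in> Units R" and xyz: "cayley_triple x y z"
  shows "assoc (x \<cdot> x) y z = \<^bold>0"
proof -
  note t = cayley_tripleD[OF xyz] and [simp] = cayley_tripleD(1,2,3)[OF xyz]
  let ?s = "assoc (x \<cdot> x) y z" and ?m = "(x \<cdot> y) \<cdot> z"
  have "x \<cdot> (y \<cdot> z) = \<ominus>\<^bsub>A\<^esub> ((y \<cdot> z) \<cdot> x)"
    by (intro cayley_triple_product_anticommutes
        cayley_triple_swap_right[OF cayley_triple_swap_left[OF xyz]])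
  then have "(y \<cdot> z) \<cdot> x = ?m" using t(7) by simp
  moreover have "(x \<cdot> (y \<cdot> z)) \<cdot> x = x \<cdot> ((y \<cdot> z) \<cdot> x)"
    by (rule flexible_law) simp_all
  ultimately have "(\<ominus>\<^bsub>A\<^esub> ?m) \<cdot> x = x \<cdot> ?m" by (simp only: t(7))
  then have "x \<cdot> ?m = \<ominus>\<^bsub>A\<^esub> (?m \<cdot> x)" by (simp add: bilinear)
  then have anti: "?m \<cdot> x = \<ominus>\<^bsub>A\<^esub> (x \<cdot> ?m)" by simp
  have p: "assoc x y z = ?m \<^bold>+ ?m"
    by (simp add: associator_def t(7)) (simp add: a_minus_def)
  have 1: "?s = assoc x (x \<cdot> y) z \<^bold>+ x \<cdot> assoc x y z"
  proof -
    have "?s = (assoc (x \<cdot> x) y z \<^bold>- assoc x (x \<cdot> y) z \<^bold>+ assoc x x (y \<cdot> z)) \<^bold>+ assoc x (x \<cdot> y) z"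
      by (simp add: left_alternative, reify M.group_reify, rule M.group_eqI) simp_all
    then show ?thesis
      by (simp only: teichmuller t(1-3)) (simp add: left_alternative M.a_ac)
  qed
  have 2: "assoc z y (x \<cdot> x) = assoc z (y \<cdot> x) x \<^bold>+ assoc z y x \<cdot> x"
  proof -
    have "assoc z y (x \<cdot> x) =
        (assoc (z \<cdot> y) x x \<^bold>- assoc z (y \<cdot> x) x \<^bold>+ assoc z y (x \<cdot> x)) \<^bold>+ assoc z (y \<cdot> x) x"
      by (simp add: right_alternative, reify M.group_reify, rule M.group_eqI) simp_all
    then show ?thesis
      by (simp only: teichmuller t(1-3)) (simp add: right_alternative M.a_ac)
  qed
  have 3: "assoc x (y \<cdot> x) z = \<ominus>\<^bsub>A\<^esub> assoc x (x \<cdot> y) z"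
    by (simp add: t(4) associator_def bilinear, reify M.group_reify, rule M.group_eqI) simp_all
  have "\<ominus>\<^bsub>A\<^esub> ?s = assoc x (x \<cdot> y) z \<^bold>- assoc x y z \<cdot> x"
    using 2 3 by (simp add: associator_reverse[of "x \<cdot> x" y z] associator_reverse[of x y z]
        associator_reverse[of x "y \<cdot> x" z] bilinear a_minus_def)
  then have "?s \<^bold>- (\<ominus>\<^bsub>A\<^esub> ?s) = x \<cdot> assoc x y z \<^bold>+ assoc x y z \<cdot> x"
    by (simp only: 1, reify M.group_reify, intro M.group_eqI) simp_all
  also have "\<dots> = \<^bold>0"
    by (simp add: p anti bilinear, reify M.group_reify, rule M.group_eqI) simp_all
  finally have "?s \<^bold>+ ?s = \<^bold>0" by (simp add: a_minus_def)
  then show ?thesis by (rule double_eq_zero[OF half, rotated]) simp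
qed

lemma cayley_triple_square_commutes:
  assumes "cayley_triple x y z" shows "(x \<cdot> x) \<cdot> y = y \<cdot> (x \<cdot> x)"
proof -
  note t = cayley_tripleD[OF assms] and [simp] = cayley_tripleD(1,2,3)[OF assms]
  have "(x \<cdot> x) \<cdot> y = \<ominus>\<^bsub>A\<^esub> (x \<cdot> (y \<cdot> x))"
    by (simp add: left_alternative_law t(4) bilinear)
  also have "\<dots> = \<ominus>\<^bsub>A\<^esub> ((x \<cdot> y) \<cdot> x)"
    by (simp add: flexible_law)
  also have "\<dots> = (y \<cdot> x) \<cdot> x"
    by (simp add: t(4) bilinear)
  also have "\<dots> = y \<cdot> (x \<cdot> x)"
    using right_alternative[of x y] by (simp add: associator_def minus_eq_zero_iff)
  finally show ?thesis .
qed

lemma cayley_triple_square_central: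
  assumes half: "\<one>\<^bsub>R\<^esub> \<oplus>\<^bsub>R\<^esub> \<one>\<^bsub>R\<^esub> \<in> Units R" and xyz: "cayley_triple x y z"
    and gen: "carrier A = subalgebra_gen R A {x, y, z}"
  shows "x \<cdot> x \<in> alt_center A"
proof (rule center_if_central_on_generators[OF gen])
  note [simp] = cayley_tripleD(1,2,3)[OF xyz]
  note xzy = cayley_triple_swap_right[OF xyz]
  show "{x, y, z} \<subseteq> carrier A" "x \<cdot> x \<in> carrier A" by auto
  show "(x \<cdot> x) \<cdot> s = s \<cdot> (x \<cdot> x)" if "s \<in> {x, y, z}" for s
    using that cayley_triple_square_commutes[OF xyz] cayley_triple_square_commutes[OF xzy]
      flexible_law[of x x] by auto
  have x: "assoc (x \<cdot> x) x s = \<^bold>0" if s: "s \<in> carrier A" for s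
  proof (rule double_eq_zero[OF half])
    show "assoc (x \<cdot> x) x s \<^bold>+ assoc (x \<cdot> x) x s = \<^bold>0"
      using teichmuller[of x x x s] associator_swap_left[of "x \<cdot> x" x s] s
      by (simp add: left_alternative a_minus_def)
  qed (simp add: s)
  show "assoc (x \<cdot> x) s s' = \<^bold>0" if "s \<in> {x, y, z}" "s' \<in> {x, y, z}" for s s'
    using that cayley_triple_square_associates[OF half xyz] x right_alternative
      cayley_triple_square_associates[OF half xzy]
      associator_swap_right[of "x \<cdot> x" x] by auto
qed

end

section \<open>The Cayley-Dickson process\<close>

lemma cayley_dickson_simps [simp]:
  "carrier (cayley_dickson B \<mu>) = carrier B \<times> carrier B"
  "(a, b) \<otimes>\<^bsub>cayley_dickson B \<mu>\<^esub> (c, d) =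
    ((a \<otimes>\<^bsub>B\<^esub> c) \<oplus>\<^bsub>B\<^esub> (\<mu> \<odot>\<^bsub>B\<^esub> (d \<otimes>\<^bsub>B\<^esub> star B b)), (star B a \<otimes>\<^bsub>B\<^esub> d) \<oplus>\<^bsub>B\<^esub> (c \<otimes>\<^bsub>B\<^esub> b))"
  "\<one>\<^bsub>cayley_dickson B \<mu>\<^esub> = (\<one>\<^bsub>B\<^esub>, \<zero>\<^bsub>B\<^esub>)"
  "\<zero>\<^bsub>cayley_dickson B \<mu>\<^esub> = (\<zero>\<^bsub>B\<^esub>, \<zero>\<^bsub>B\<^esub>)"
  "(a, b) \<oplus>\<^bsub>cayley_dickson B \<mu>\<^esub> (c, d) = (a \<oplus>\<^bsub>B\<^esub> c, b \<oplus>\<^bsub>B\<^esub> d)"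
  "r \<odot>\<^bsub>cayley_dickson B \<mu>\<^esub> (a, b) = (r \<odot>\<^bsub>B\<^esub> a, r \<odot>\<^bsub>B\<^esub> b)"
  "star (cayley_dickson B \<mu>) (a, b) = (star B a, \<ominus>\<^bsub>B\<^esub> b)"
  by (simp_all add: cayley_dickson_def)

context scalar_involution_algebra
begin

abbreviation bmult (infixl "\<bullet>" 70) where "x \<bullet> y \<equiv> x \<otimes>\<^bsub>B\<^esub> y"
abbreviation bplus (infixl "+\<^sub>B" 65) where "x +\<^sub>B y \<equiv> x \<oplus>\<^bsub>B\<^esub> y"
abbreviation bminus (infixl "-\<^sub>B" 65) where "x -\<^sub>B y \<equiv> x \<ominus>\<^bsub>B\<^esub> y"
abbreviation bzero ("0\<^sub>B") where "0\<^sub>B \<equiv> \<zero>\<^bsub>B\<^esub>"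

declare star_closed [simp] star_star [simp]

lemma star_zero [simp]: "star B 0\<^sub>B = 0\<^sub>B"
  using star_add[of "0\<^sub>B" "0\<^sub>B"] by simp

lemma star_neg: "x \<in> carrier B \<Longrightarrow> star B (\<ominus>\<^bsub>B\<^esub> x) = \<ominus>\<^bsub>B\<^esub> star B x"
  by (intro M.minus_equality[symmetric]) (simp_all flip: star_add add: M.l_neg)

lemma star_one [simp]: "star B \<one>\<^bsub>B\<^esub> = \<one>\<^bsub>B\<^esub>"
  using star_mult[of "\<one>\<^bsub>B\<^esub>" "star B \<one>\<^bsub>B\<^esub>"] by simp

lemma norm_scalar:
  assumes "x \<in> carrier B"
  obtains n where "n \<in> carrier k" "x \<bullet> star B x = n \<odot>\<^bsub>B\<^esub> \<one>\<^bsub>B\<^esub>"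
  using star_scalar[OF assms] by blast

text \<open>
  Besides \<open>x x\<^sup>*\<close>, also \<open>(1 + x) (1 + x)\<^sup>* = 1 + (x + x\<^sup>*) + x x\<^sup>*\<close> is a scalar.
\<close>

lemma trace_scalar:
  assumes [simp]: "x \<in> carrier B"
  obtains t where "t \<in> carrier k" "x +\<^sub>B star B x = t \<odot>\<^bsub>B\<^esub> \<one>\<^bsub>B\<^esub>"
proof -
  obtain n where n[simp]: "n \<in> carrier k" "x \<bullet> star B x = n \<odot>\<^bsub>B\<^esub> \<one>\<^bsub>B\<^esub>"
    using norm_scalar[of x] by auto
  obtain m where m[simp]: "m \<in> carrier k"
    "(\<one>\<^bsub>B\<^esub> +\<^sub>B x) \<bullet> star B (\<one>\<^bsub>B\<^esub> +\<^sub>B x) = m \<odot>\<^bsub>B\<^esub> \<one>\<^bsub>B\<^esub>"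
    using norm_scalar[of "\<one>\<^bsub>B\<^esub> +\<^sub>B x"] by auto
  have "x +\<^sub>B star B x = (\<one>\<^bsub>B\<^esub> +\<^sub>B x) \<bullet> star B (\<one>\<^bsub>B\<^esub> +\<^sub>B x) -\<^sub>B x \<bullet> star B x -\<^sub>B \<one>\<^bsub>B\<^esub>"
    by (simp del: n m add: star_add bilinear, reify M.group_reify, rule M.group_eqI) simp_all
  also have "\<dots> = (m \<ominus>\<^bsub>k\<^esub> n \<ominus>\<^bsub>k\<^esub> \<one>\<^bsub>k\<^esub>) \<odot>\<^bsub>B\<^esub> \<one>\<^bsub>B\<^esub>"
    by (simp add: a_minus_def smult_l_distr smult_l_minus)
  finally show ?thesis by (intro that[of "m \<ominus>\<^bsub>k\<^esub> n \<ominus>\<^bsub>k\<^esub> \<one>\<^bsub>k\<^esub>"]) simp_all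
qed

lemma star_trace:
  assumes [simp]: "x \<in> carrier B" "t \<in> carrier k" and "x +\<^sub>B star B x = t \<odot>\<^bsub>B\<^esub> \<one>\<^bsub>B\<^esub>"
  shows "star B x = t \<odot>\<^bsub>B\<^esub> \<one>\<^bsub>B\<^esub> -\<^sub>B x"
  unfolding assms(3)[symmetric] by (reify M.group_reify, rule M.group_eqI) simp_all

lemma star_mult_self:
  assumes [simp]: "x \<in> carrier B"
  shows "star B x \<bullet> x = x \<bullet> star B x"
proof -
  obtain t where "t \<in> carrier k" "x +\<^sub>B star B x = t \<odot>\<^bsub>B\<^esub> \<one>\<^bsub>B\<^esub>"
    using trace_scalar[of x] by auto
  with star_trace[of x t] show ?thesis
    by (simp add: bilinear mult_smult_left mult_smult_right)
qed

lemma star_eq_self_imp_scalar: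
  assumes [simp]: "x \<in> carrier B" and "star B x = x"
  obtains r where "r \<in> carrier k" "x = r \<odot>\<^bsub>B\<^esub> \<one>\<^bsub>B\<^esub>"
proof -
  obtain t where t: "t \<in> carrier k" "x +\<^sub>B star B x = t \<odot>\<^bsub>B\<^esub> \<one>\<^bsub>B\<^esub>"
    using trace_scalar[of x] by auto
  let ?h = "inv\<^bsub>k\<^esub> (\<one>\<^bsub>k\<^esub> \<oplus>\<^bsub>k\<^esub> \<one>\<^bsub>k\<^esub>)"
  have h: "?h \<in> carrier k" using half by simp
  have "x = (?h \<otimes>\<^bsub>k\<^esub> (\<one>\<^bsub>k\<^esub> \<oplus>\<^bsub>k\<^esub> \<one>\<^bsub>k\<^esub>)) \<odot>\<^bsub>B\<^esub> x"
    using half by simp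
  also have "\<dots> = ?h \<odot>\<^bsub>B\<^esub> (x +\<^sub>B x)"
    using h by (simp add: smult_assoc1 smult_l_distr)
  also have "\<dots> = (?h \<otimes>\<^bsub>k\<^esub> t) \<odot>\<^bsub>B\<^esub> \<one>\<^bsub>B\<^esub>"
    using t h by (simp add: assms(2) smult_assoc1)
  finally show ?thesis using h t by (intro that) auto
qed

text \<open>
  Since \<open>x\<^sup>2 = t x - n\<close> with the scalars \<open>t = x + x\<^sup>*\<close> and \<open>n = x x\<^sup>*\<close>, the left alternative law amounts
  to \<open>x\<^sup>* (x y) = n y\<close>; the involution exchanges the two alternative laws.
\<close>

lemma alternative_if_norm_composes:
  assumes norm: "\<And>x y. \<lbrakk>x \<in> carrier B; y \<in> carrier B\<rbrakk> \<Longrightarrow> star B x \<bullet> (x \<bullet> y) = (star B x \<bullet> x) \<bullet> y"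
  shows "alternative_algebra k B"
proof -
  have left: "(x \<bullet> x) \<bullet> y = x \<bullet> (x \<bullet> y)" if [simp]: "x \<in> carrier B" "y \<in> carrier B" for x y
  proof -
    obtain t where t[simp]: "t \<in> carrier k" and tr: "x +\<^sub>B star B x = t \<odot>\<^bsub>B\<^esub> \<one>\<^bsub>B\<^esub>"
      using trace_scalar[of x] by auto
    have x: "x = t \<odot>\<^bsub>B\<^esub> \<one>\<^bsub>B\<^esub> -\<^sub>B star B x"
      unfolding tr[symmetric] by (reify M.group_reify, rule M.group_eqI) simp_all
    have *: "x \<bullet> z = t \<odot>\<^bsub>B\<^esub> z -\<^sub>B star B x \<bullet> z" if "z \<in> carrier B" for z
      using that by (subst x) (simp add: bilinear mult_smult_left)
    have "(x \<bullet> x) \<bullet> y = t \<odot>\<^bsub>B\<^esub> (x \<bullet> y) -\<^sub>B star B x \<bullet> (x \<bullet> y)"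
      using *[of x] by (simp add: norm bilinear mult_smult_left)
    also have "\<dots> = x \<bullet> (x \<bullet> y)"
      using *[of "x \<bullet> y"] by simp
    finally show ?thesis .
  qed
  have right: "(y \<bullet> x) \<bullet> x = y \<bullet> (x \<bullet> x)" if [simp]: "x \<in> carrier B" "y \<in> carrier B" for x y
  proof -
    have "star B ((y \<bullet> x) \<bullet> x) = star B (y \<bullet> (x \<bullet> x))"
      using left[of "star B x" "star B y"] by (simp add: star_mult)
    then have "star B (star B ((y \<bullet> x) \<bullet> x)) = star B (star B (y \<bullet> (x \<bullet> x)))" by (rule arg_cong)
    then show ?thesis by simp
  qed
  show ?thesis
    by unfold_locales (simp_all add: associator_def left right)
qed

context
  fixes \<mu>
  assumes mu [simp]: "\<mu> \<in> carrier k"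
begin

lemma cayley_dickson_abelian_group: "abelian_group (cayley_dickson B \<mu>)"
proof (rule abelian_groupI)
  fix x assume "x \<in> carrier (cayley_dickson B \<mu>)"
  then show "\<exists>y\<in>carrier (cayley_dickson B \<mu>). y \<oplus>\<^bsub>cayley_dickson B \<mu>\<^esub> x = \<zero>\<^bsub>cayley_dickson B \<mu>\<^esub>"
    by (intro bexI[of _ "(\<ominus>\<^bsub>B\<^esub> fst x, \<ominus>\<^bsub>B\<^esub> snd x)"]) (auto simp: M.l_neg)
qed (auto simp: M.a_ac)

lemma cayley_dickson_neg:
  assumes "a \<in> carrier B" "b \<in> carrier B"
  shows "\<ominus>\<^bsub>cayley_dickson B \<mu>\<^esub> (a, b) = (\<ominus>\<^bsub>B\<^esub> a, \<ominus>\<^bsub>B\<^esub> b)"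
  using assms by (intro abelian_group.minus_equality[OF cayley_dickson_abelian_group]) (auto simp: M.l_neg)

lemma cayley_dickson_unital: "unital_algebra k (cayley_dickson B \<mu>)"
proof (rule unital_algebra.intro)
  show "module k (cayley_dickson B \<mu>)"
    by (rule moduleI[OF R.cring_axioms cayley_dickson_abelian_group])
      (auto simp: smult_l_distr smult_r_distr smult_assoc1)
  show "unital_algebra_axioms k (cayley_dickson B \<mu>)"
    by unfold_locales (auto simp: star_add star_smult bilinear mult_smult_left mult_smult_right
       smult_r_distr smult_assoc1[symmetric] R.m_comm M.a_ac)
qed

text \<open>
  The mixed terms of \<open>(a + v b) (a\<^sup>* - v b)\<close> cancel, which leaves the scalar
  \<open>a a\<^sup>* - \<mu> b b\<^sup>*\<close>.
\<close>

lemma cayley_dickson_scalar_involution: "scalar_involution_algebra k (cayley_dickson B \<mu>)"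
proof (rule scalar_involution_algebra.intro[OF cayley_dickson_unital])
  have sc: "\<exists>a\<in>carrier k. x \<otimes>\<^bsub>cayley_dickson B \<mu>\<^esub> star (cayley_dickson B \<mu>) x
      = a \<odot>\<^bsub>cayley_dickson B \<mu>\<^esub> \<one>\<^bsub>cayley_dickson B \<mu>\<^esub>"
    if x: "x \<in> carrier (cayley_dickson B \<mu>)" for x
  proof (cases x)
    case (Pair a b)
    then have [simp]: "a \<in> carrier B" "b \<in> carrier B" using x by auto
    obtain n where n: "n \<in> carrier k" "a \<bullet> star B a = n \<odot>\<^bsub>B\<^esub> \<one>\<^bsub>B\<^esub>"
      using norm_scalar[of a] by auto
    obtain m where m: "m \<in> carrier k" "b \<bullet> star B b = m \<odot>\<^bsub>B\<^esub> \<one>\<^bsub>B\<^esub>"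
      using norm_scalar[of b] by auto
    show ?thesis
      using n m by (intro bexI[of _ "n \<ominus>\<^bsub>k\<^esub> \<mu> \<otimes>\<^bsub>k\<^esub> m"])
        (simp_all add: Pair bilinear M.l_neg smult_l_distr smult_r_minus smult_l_minus smult_assoc1
          a_minus_def)
  qed
  show "scalar_involution_algebra_axioms k (cayley_dickson B \<mu>)"
    by unfold_locales (use half faithful sc in \<open>auto simp: star_add star_smult star_mult star_neg
      bilinear smult_r_distr smult_r_minus M.a_ac M.minus_add\<close>)
qed

end

text \<open>
  No cancellation is needed: both bracketings expand into the same sum of monomials once the
  factors may be permuted.
\<close>

lemma cayley_dickson_associative:
  assumes assoc: "\<And>x y z. \<lbrakk>x \<in> carrier B; y \<in> carrier B; z \<in> carrier B\<rbrakk> \<Longrightarrow> (x \<bullet> y) \<bullet> z = x \<bullet> (y \<bullet> z)"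
    and comm: "\<And>x y. \<lbrakk>x \<in> carrier B; y \<in> carrier B\<rbrakk> \<Longrightarrow> x \<bullet> y = y \<bullet> x"
    and mu [simp]: "\<mu> \<in> carrier k"
    and "x \<in> carrier (cayley_dickson B \<mu>)" "y \<in> carrier (cayley_dickson B \<mu>)" "z \<in> carrier (cayley_dickson B \<mu>)"
  shows "(x \<otimes>\<^bsub>cayley_dickson B \<mu>\<^esub> y) \<otimes>\<^bsub>cayley_dickson B \<mu>\<^esub> z
    = x \<otimes>\<^bsub>cayley_dickson B \<mu>\<^esub> (y \<otimes>\<^bsub>cayley_dickson B \<mu>\<^esub> z)"
proof -
  have lcomm: "x \<bullet> (y \<bullet> z) = y \<bullet> (x \<bullet> z)"
    if "x \<in> carrier B" "y \<in> carrier B" "z \<in> carrier B" for x y z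
    using that by (metis assoc comm)
  obtain a b c d e f where [simp]: "x = (a, b)" "y = (c, d)" "z = (e, f)"
    using prod.exhaust by metis
  have [simp]: "a \<in> carrier B" "b \<in> carrier B" "c \<in> carrier B" "d \<in> carrier B" "e \<in> carrier B"
    "f \<in> carrier B"
    using assms by auto
  show ?thesis
    by (simp add: star_add star_smult star_mult bilinear mult_smult_left mult_smult_right
       smult_r_distr assoc comm lcomm M.a_ac)
qed

lemma cayley_dickson_commutative:
  assumes comm: "\<And>x y. \<lbrakk>x \<in> carrier B; y \<in> carrier B\<rbrakk> \<Longrightarrow> x \<bullet> y = y \<bullet> x"
    and star: "\<And>x. x \<in> carrier B \<Longrightarrow> star B x = x"
    and mu [simp]: "\<mu> \<in> carrier k"
    and "x \<in> carrier (cayley_dickson B \<mu>)" "y \<in> carrier (cayley_dickson B \<mu>)"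
  shows "x \<otimes>\<^bsub>cayley_dickson B \<mu>\<^esub> y = y \<otimes>\<^bsub>cayley_dickson B \<mu>\<^esub> x"
  using assms(4,5) by (auto simp: star comm M.a_ac)

text \<open>
  Writing \<open>n(x) = x\<^sup>* x\<close>, one has \<open>n(a + v b) = n(a) - \<mu> n(b)\<close>, and both components of
  \<open>x\<^sup>* (x y)\<close> reduce to this scalar because \<open>n(a)\<close> and \<open>n(b)\<close> can be moved through products.
\<close>

lemma cayley_dickson_alternative:
  assumes assoc: "\<And>x y z. \<lbrakk>x \<in> carrier B; y \<in> carrier B; z \<in> carrier B\<rbrakk> \<Longrightarrow> (x \<bullet> y) \<bullet> z = x \<bullet> (y \<bullet> z)"
    and mu [simp]: "\<mu> \<in> carrier k"
  shows "alternative_algebra k (cayley_dickson B \<mu>)"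
proof -
  interpret C: scalar_involution_algebra k "cayley_dickson B \<mu>"
    by (rule cayley_dickson_scalar_involution[OF mu])
  show ?thesis
  proof (rule C.alternative_if_norm_composes)
    fix x y assume xy: "x \<in> carrier (cayley_dickson B \<mu>)" "y \<in> carrier (cayley_dickson B \<mu>)"
    obtain a b c d where [simp]: "x = (a, b)" "y = (c, d)"
      using prod.exhaust by metis
    have [simp]: "a \<in> carrier B" "b \<in> carrier B" "c \<in> carrier B" "d \<in> carrier B"
      using xy by auto
    obtain n where [simp]: "n \<in> carrier k" and n: "a \<bullet> star B a = n \<odot>\<^bsub>B\<^esub> \<one>\<^bsub>B\<^esub>"
      using norm_scalar[of a] by auto
    obtain m where [simp]: "m \<in> carrier k" and m: "b \<bullet> star B b = m \<odot>\<^bsub>B\<^esub> \<one>\<^bsub>B\<^esub>"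
      using norm_scalar[of b] by auto
    have n': "star B a \<bullet> a = n \<odot>\<^bsub>B\<^esub> \<one>\<^bsub>B\<^esub>" and m': "star B b \<bullet> b = m \<odot>\<^bsub>B\<^esub> \<one>\<^bsub>B\<^esub>"
      using n m by (simp_all add: star_mult_self)
    have nn: "star B a \<bullet> (a \<bullet> z) = n \<odot>\<^bsub>B\<^esub> z" "a \<bullet> (star B a \<bullet> z) = n \<odot>\<^bsub>B\<^esub> z"
      "z \<bullet> (star B b \<bullet> b) = m \<odot>\<^bsub>B\<^esub> z" "z \<bullet> (b \<bullet> star B b) = m \<odot>\<^bsub>B\<^esub> z"
      if "z \<in> carrier B" for z
      using that by (simp_all add: assoc[symmetric] n n')
        (simp_all add: assoc m m' mult_smult_left mult_smult_right)
    show "star (cayley_dickson B \<mu>) x \<otimes>\<^bsub>cayley_dickson B \<mu>\<^esub> (x \<otimes>\<^bsub>cayley_dickson B \<mu>\<^esub> y) =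
          (star (cayley_dickson B \<mu>) x \<otimes>\<^bsub>cayley_dickson B \<mu>\<^esub> x) \<otimes>\<^bsub>cayley_dickson B \<mu>\<^esub> y"
      by (simp add: nn assoc n m n' m' bilinear mult_smult_left mult_smult_right
        star_neg star_add star_smult smult_r_distr smult_r_minus M.l_neg, intro conjI)
        (reify M.group_reify, rule M.group_eqI, simp_all)+
  qed
qed

lemma cayley_dickson_decompose:
  assumes "a \<in> carrier B" "b \<in> carrier B" and mu [simp]: "\<mu> \<in> carrier k"
  shows "(a, b) = cd_embed B a \<oplus>\<^bsub>cayley_dickson B \<mu>\<^esub> cd_generator B \<otimes>\<^bsub>cayley_dickson B \<mu>\<^esub> cd_embed B b"
  using assms by (simp add: cd_embed_def cd_generator_def)

text \<open>
  Commuting with \<open>v\<close> makes the components of \<open>a + v b\<close> symmetric, hence scalar; commuting with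
  an element \<open>c\<close> of \<open>B\<close> gives \<open>b (c - c\<^sup>*) = 0\<close>.
\<close>

lemma cayley_dickson_commutant:
  assumes mu: "cancellable_scalar k B \<mu>"
    and z: "z \<in> carrier (cayley_dickson B \<mu>)"
    and comm: "\<And>x. x \<in> carrier (cayley_dickson B \<mu>) \<Longrightarrow>
      z \<otimes>\<^bsub>cayley_dickson B \<mu>\<^esub> x = x \<otimes>\<^bsub>cayley_dickson B \<mu>\<^esub> z"
    and c: "c \<in> carrier B"
    and cancel: "\<And>r. \<lbrakk>r \<in> carrier k; r \<odot>\<^bsub>B\<^esub> c = r \<odot>\<^bsub>B\<^esub> star B c\<rbrakk> \<Longrightarrow> r = \<zero>\<^bsub>k\<^esub>"
  obtains r where "r \<in> carrier k" "z = r \<odot>\<^bsub>cayley_dickson B \<mu>\<^esub> \<one>\<^bsub>cayley_dickson B \<mu>\<^esub>"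
proof -
  have [simp]: "\<mu> \<in> carrier k" and mu0: "\<And>b. \<lbrakk>b \<in> carrier B; \<mu> \<odot>\<^bsub>B\<^esub> b = 0\<^sub>B\<rbrakk> \<Longrightarrow> b = 0\<^sub>B"
    using mu by (auto simp: cancellable_scalar_def)
  obtain a b where [simp]: "z = (a, b)" by force
  have [simp]: "a \<in> carrier B" "b \<in> carrier B" using z by auto
  have a: "star B a = a" and b: "\<mu> \<odot>\<^bsub>B\<^esub> star B b = \<mu> \<odot>\<^bsub>B\<^esub> b"
    using comm[of "cd_generator B"] by (auto simp: cd_generator_def)
  have "star B b -\<^sub>B b = 0\<^sub>B"
    using b by - (rule mu0, simp_all add: a_minus_def smult_r_distr smult_r_minus M.r_neg)
  then have b: "star B b = b" by (simp add: minus_eq_zero_iff)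
  obtain s where s: "s \<in> carrier k" "b = s \<odot>\<^bsub>B\<^esub> \<one>\<^bsub>B\<^esub>"
    using star_eq_self_imp_scalar[OF _ b] by auto
  have "c \<bullet> b = star B c \<bullet> b"
    using comm[of "cd_embed B c"] c by (auto simp: cd_embed_def)
  then have "s \<odot>\<^bsub>B\<^esub> c = s \<odot>\<^bsub>B\<^esub> star B c"
    using c s by (simp add: mult_smult_right)
  from cancel[OF s(1) this] have "b = 0\<^sub>B" using s by simp
  moreover obtain r where "r \<in> carrier k" "a = r \<odot>\<^bsub>B\<^esub> \<one>\<^bsub>B\<^esub>"
    using star_eq_self_imp_scalar[OF _ a] by auto
  ultimately show ?thesis by (intro that) auto
qed

lemma cancellable_scalar_cayley_dickson:
  assumes "\<mu> \<in> carrier k" "cancellable_scalar k B \<nu>"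
  shows "cancellable_scalar k (cayley_dickson B \<mu>) \<nu>"
  using assms by (auto simp: cancellable_scalar_def)

end

section \<open>Homomorphisms from the Cayley-Dickson process to alternative algebras\<close>

context alternative_algebra
begin

text \<open>
  Every element \<open>b\<close> of the image of \<open>B\<close> satisfies \<open>b v = v b\<^sup>*\<close> and has a scalar trace \<open>b + b\<^sup>*\<close>.
  The linearised alternative laws then give the three rules
  \<open>a (v d) = v (a\<^sup>* d)\<close>, \<open>(v b) c = v (c b)\<close> and \<open>(v b)(v d) = v\<^sup>2 d b\<^sup>*\<close>, which are the product of the
  Cayley-Dickson process.
\<close>

lemma cayley_dickson_extension:
  assumes B: "scalar_involution_algebra R B" and h: "h \<in> algebra_hom R B A"
    and v [simp]: "v \<in> carrier A" and mu [simp]: "\<mu> \<in> carrier R"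
    and vv: "v \<cdot> v = \<mu> \<odot>\<^bsub>A\<^esub> \<one>\<^bsub>A\<^esub>"
    and skew: "\<And>b. b \<in> carrier B \<Longrightarrow> h b \<cdot> v = v \<cdot> h (star B b)"
  shows "(\<lambda>(a, b). h a \<^bold>+ v \<cdot> h b) \<in> algebra_hom R (cayley_dickson B \<mu>) A"
proof -
  interpret B: scalar_involution_algebra R B by fact
  note [simp] = B.mult_closed B.unit_closed B.star_closed
  have [simp]: "h x \<in> carrier A" if "x \<in> carrier B" for x
    using h that by (auto simp: algebra_hom_def ring_hom_def)
  have h_mult: "h (x \<otimes>\<^bsub>B\<^esub> y) = h x \<cdot> h y" and h_add: "h (x \<oplus>\<^bsub>B\<^esub> y) = h x \<^bold>+ h y"
    if "x \<in> carrier B" "y \<in> carrier B" for x y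
    using h that by (auto simp: algebra_hom_def ring_hom_def)
  have h_smult: "h (r \<odot>\<^bsub>B\<^esub> x) = r \<odot>\<^bsub>A\<^esub> h x" if "r \<in> carrier R" "x \<in> carrier B" for r x
    using h that by (auto simp: algebra_hom_def)
  have h_one: "h \<one>\<^bsub>B\<^esub> = \<one>\<^bsub>A\<^esub>" using h by (auto simp: algebra_hom_def ring_hom_def)
  have h_zero: "h \<zero>\<^bsub>B\<^esub> = \<^bold>0" using h_smult[of "\<zero>\<^bsub>R\<^esub>" "\<zero>\<^bsub>B\<^esub>"] by simp
  have trace: "\<exists>t\<in>carrier R. h (star B b) = t \<odot>\<^bsub>A\<^esub> \<one>\<^bsub>A\<^esub> \<^bold>- h b" if b: "b \<in> carrier B" for b
  proof -
    obtain t where t: "t \<in> carrier R" "b \<oplus>\<^bsub>B\<^esub> star B b = t \<odot>\<^bsub>B\<^esub> \<one>\<^bsub>B\<^esub>"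
      using B.trace_scalar[OF b] by auto
    have "h b \<^bold>+ h (star B b) = t \<odot>\<^bsub>A\<^esub> \<one>\<^bsub>A\<^esub>"
      using arg_cong[OF t(2), of h] t(1) b by (simp add: h_add h_smult h_one)
    moreover have "h (star B b) = h b \<^bold>+ h (star B b) \<^bold>- h b"
      using b by (reify M.group_reify, intro M.group_eqI) simp_all
    ultimately show ?thesis using t(1) by auto
  qed
  have left: "h a \<cdot> (v \<cdot> h d) = v \<cdot> (h (star B a) \<cdot> h d)"
    if [simp]: "a \<in> carrier B" "d \<in> carrier B" for a d
  proof -
    obtain t where [simp]: "t \<in> carrier R" and t: "h (star B a) = t \<odot>\<^bsub>A\<^esub> \<one>\<^bsub>A\<^esub> \<^bold>- h a"
      using trace[of a] by auto
    have "h a \<cdot> (v \<cdot> h d) = (h a \<cdot> v \<^bold>+ v \<cdot> h a) \<cdot> h d \<^bold>- v \<cdot> (h a \<cdot> h d)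
        \<^bold>- (assoc (h a) v (h d) \<^bold>+ assoc v (h a) (h d))"
      by (simp add: associator_def bilinear, reify M.group_reify, rule M.group_eqI) simp_all
    also have "h a \<cdot> v \<^bold>+ v \<cdot> h a = t \<odot>\<^bsub>A\<^esub> v"
      by (simp add: skew t bilinear mult_smult_right, reify M.group_reify, rule M.group_eqI) simp_all
    finally show ?thesis
      using associator_swap_left[of v "h a" "h d"]
      by (simp add: t bilinear mult_smult_left mult_smult_right M.l_neg)
  qed
  have right: "(v \<cdot> h b) \<cdot> h c = v \<cdot> (h c \<cdot> h b)"
    if [simp]: "b \<in> carrier B" "c \<in> carrier B" for b c
  proof -
    obtain t where [simp]: "t \<in> carrier R" and t: "h (star B c) = t \<odot>\<^bsub>A\<^esub> \<one>\<^bsub>A\<^esub> \<^bold>- h c"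
      using trace[of c] by auto
    have bv: "h (star B b) \<cdot> v = v \<cdot> h b"
      using skew[of "star B b"] by simp
    have bcv: "(h (star B b) \<cdot> h c) \<cdot> v = v \<cdot> (h (star B c) \<cdot> h b)"
      using skew[of "star B b \<otimes>\<^bsub>B\<^esub> c"] by (simp add: h_mult B.star_mult)
    have "(v \<cdot> h b) \<cdot> h c = h (star B b) \<cdot> (v \<cdot> h c \<^bold>+ h c \<cdot> v) \<^bold>- (h (star B b) \<cdot> h c) \<cdot> v
        \<^bold>+ (assoc (h (star B b)) v (h c) \<^bold>+ assoc (h (star B b)) (h c) v)"
      unfolding bv[symmetric]
      by (simp add: associator_def bilinear, reify M.group_reify, rule M.group_eqI) simp_all
    also have "v \<cdot> h c \<^bold>+ h c \<cdot> v = t \<odot>\<^bsub>A\<^esub> v"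
      by (simp add: skew t bilinear mult_smult_right, reify M.group_reify, rule M.group_eqI) simp_all
    also have "h (star B b) \<cdot> (t \<odot>\<^bsub>A\<^esub> v) = t \<odot>\<^bsub>A\<^esub> (v \<cdot> h b)"
      by (simp add: mult_smult_right bv)
    finally have "(v \<cdot> h b) \<cdot> h c = t \<odot>\<^bsub>A\<^esub> (v \<cdot> h b) \<^bold>- v \<cdot> ((t \<odot>\<^bsub>A\<^esub> \<one>\<^bsub>A\<^esub> \<^bold>- h c) \<cdot> h b)"
      using associator_swap_right[of "h (star B b)" v "h c"]
      by (simp add: bcv t M.r_neg)
    then show ?thesis
      by (simp add: bilinear mult_smult_left mult_smult_right,
        reify M.group_reify, intro M.group_eqI) simp_all
  qed
  have both: "(v \<cdot> h b) \<cdot> (v \<cdot> h d) = \<mu> \<odot>\<^bsub>A\<^esub> (h d \<cdot> h (star B b))"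
    if [simp]: "b \<in> carrier B" "d \<in> carrier B" for b d
  proof -
    obtain t where [simp]: "t \<in> carrier R" and t: "h (star B b) = t \<odot>\<^bsub>A\<^esub> \<one>\<^bsub>A\<^esub> \<^bold>- h b"
      using trace[of b] by auto
    have vv': "v \<cdot> (v \<cdot> z) = \<mu> \<odot>\<^bsub>A\<^esub> z" if "z \<in> carrier A" for z
      using that by (simp add: left_alternative_law[symmetric] vv mult_smult_left)
    have vbv: "(v \<cdot> h b) \<cdot> v = \<mu> \<odot>\<^bsub>A\<^esub> h (star B b)"
      by (simp add: flexible_law skew vv')
    \<comment> \<open>Moving the middle \<open>v\<close> to the left by the linearised left alternative law leaves only
      products with two adjacent factors \<open>v\<close>.\<close>
    have "(v \<cdot> h b) \<cdot> (v \<cdot> h d) = ((v \<cdot> h b) \<cdot> v) \<cdot> h d \<^bold>+ (v \<cdot> (v \<cdot> h b)) \<cdot> h d \<^bold>- v \<cdot> ((v \<cdot> h b) \<cdot> h d)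
        \<^bold>- (assoc (v \<cdot> h b) v (h d) \<^bold>+ assoc v (v \<cdot> h b) (h d))"
      by (simp add: associator_def bilinear, reify M.group_reify, rule M.group_eqI) simp_all
    also have "\<dots> = \<mu> \<odot>\<^bsub>A\<^esub> (h (star B b) \<cdot> h d) \<^bold>+ \<mu> \<odot>\<^bsub>A\<^esub> (h b \<cdot> h d) \<^bold>- \<mu> \<odot>\<^bsub>A\<^esub> (h d \<cdot> h b)"
      using associator_swap_left[of v "v \<cdot> h b" "h d"]
      by (simp add: vbv right vv' mult_smult_left M.l_neg)
    also have "\<dots> = \<mu> \<odot>\<^bsub>A\<^esub> (h d \<cdot> h (star B b))"
      by (simp add: t bilinear mult_smult_left mult_smult_right smult_r_distr smult_r_minus
          a_minus_def, reify M.group_reify, rule M.group_eqI) simp_all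
    finally show ?thesis .
  qed
  show ?thesis
    unfolding algebra_hom_def ring_hom_def
    by (auto simp: h_add h_mult h_smult h_one h_zero bilinear left right both smult_r_distr
        mult_smult_right) (reify M.group_reify, rule M.group_eqI, simp_all)+
qed

end

section \<open>Octonion algebras\<close>

lemma cd_base_simps [simp]:
  "carrier (cd_base k) = carrier k" "mult (cd_base k) = mult k" "\<one>\<^bsub>cd_base k\<^esub> = \<one>\<^bsub>k\<^esub>"
  "\<zero>\<^bsub>cd_base k\<^esub> = \<zero>\<^bsub>k\<^esub>" "add (cd_base k) = add k" "smult (cd_base k) = mult k"
  "star (cd_base k) x = x"
  by (simp_all add: cd_base_def)

lemma a_inv_cd_base [simp]: "a_inv (cd_base k) = a_inv k"
  by (auto simp: a_inv_def m_inv_def fun_eq_iff)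

lemma cd_base_scalar_involution:
  assumes "cring k" and half: "\<one>\<^bsub>k\<^esub> \<oplus>\<^bsub>k\<^esub> \<one>\<^bsub>k\<^esub> \<in> Units k"
  shows "scalar_involution_algebra k (cd_base k)"
proof -
  interpret cring k by fact
  have "abelian_group (cd_base k)"
    by (rule abelian_groupI) (auto simp: a_ac intro!: bexI[of _ "\<ominus>\<^bsub>k\<^esub> x" for x] l_neg)
  then have "module k (cd_base k)"
    by (intro moduleI) (auto simp: l_distr r_distr m_assoc is_cring)
  then have "unital_algebra k (cd_base k)"
    by (rule unital_algebra.intro) (unfold_locales, auto simp: l_distr r_distr m_ac)
  then show ?thesis
    by (rule scalar_involution_algebra.intro) (unfold_locales, auto simp: half m_comm)
qed

lemma octonion_constantsI:
  assumes "cring k" "\<one>\<^bsub>k\<^esub> \<oplus>\<^bsub>k\<^esub> \<one>\<^bsub>k\<^esub> \<in> Units k"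
    and "cancellable_scalar k (cd_base k) \<mu>1" "cancellable_scalar k (cd_base k) \<mu>2"
      "cancellable_scalar k (cd_base k) \<mu>3"
  shows "octonion_constants k \<mu>1 \<mu>2 \<mu>3"
proof -
  have [simp]: "\<mu>1 \<in> carrier k" "\<mu>2 \<in> carrier k" "\<mu>3 \<in> carrier k"
    using assms(3-5) by (auto simp: cancellable_scalar_def)
  note 0 = cd_base_scalar_involution[OF assms(1,2)]
  note 1 = scalar_involution_algebra.cayley_dickson_scalar_involution[OF 0, of \<mu>1, simplified]
  note 2 = scalar_involution_algebra.cayley_dickson_scalar_involution[OF 1, of \<mu>2, simplified]
  show ?thesis
    unfolding octonion_constants_def
    using 0 1 2 assms(3-5)
    by (simp add: scalar_involution_algebra.cancellable_scalar_cayley_dickson)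
qed

locale octonion_process =
  fixes k :: "('a, 'm) ring_scheme" and \<mu>1 \<mu>2 \<mu>3
  assumes constants: "octonion_constants k \<mu>1 \<mu>2 \<mu>3"
begin

abbreviation (input) "\<O> \<equiv> octonions k \<mu>1 \<mu>2 \<mu>3"
abbreviation (input) "v \<equiv> octonion_gen k \<mu>1 \<mu>2"

sublocale B0: scalar_involution_algebra k "cd_base k"
  using constants by (simp add: octonion_constants_def)

sublocale B1: scalar_involution_algebra k "cd1 k \<mu>1"
  using constants by (simp add: octonion_constants_def)

sublocale B2: scalar_involution_algebra k "cd2 k \<mu>1 \<mu>2"
  using constants by (simp add: octonion_constants_def)

lemma mu_closed [simp]: "\<mu>1 \<in> carrier k" "\<mu>2 \<in> carrier k" "\<mu>3 \<in> carrier k"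
  using constants by (auto simp: octonion_constants_def cancellable_scalar_def)

sublocale B3: scalar_involution_algebra k \<O>
  unfolding octonions_def by (rule B2.cayley_dickson_scalar_involution) simp

sublocale alternative_algebra k \<O>
  unfolding octonions_def
proof (rule B2.cayley_dickson_alternative)
  fix x y z
  assume "x \<in> carrier (cd2 k \<mu>1 \<mu>2)" "y \<in> carrier (cd2 k \<mu>1 \<mu>2)" "z \<in> carrier (cd2 k \<mu>1 \<mu>2)"
  moreover have comm1: "x \<otimes>\<^bsub>cd1 k \<mu>1\<^esub> y = y \<otimes>\<^bsub>cd1 k \<mu>1\<^esub> x"
    if "x \<in> carrier (cd1 k \<mu>1)" "y \<in> carrier (cd1 k \<mu>1)" for x y
    using that by (intro B0.cayley_dickson_commutative) (auto simp: B0.R.m_comm)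
  moreover have "(x \<otimes>\<^bsub>cd1 k \<mu>1\<^esub> y) \<otimes>\<^bsub>cd1 k \<mu>1\<^esub> z = x \<otimes>\<^bsub>cd1 k \<mu>1\<^esub> (y \<otimes>\<^bsub>cd1 k \<mu>1\<^esub> z)"
    if "x \<in> carrier (cd1 k \<mu>1)" "y \<in> carrier (cd1 k \<mu>1)" "z \<in> carrier (cd1 k \<mu>1)" for x y z
    using that by (intro B0.cayley_dickson_associative) (auto simp: B0.R.m_ac)
  ultimately show "(x \<otimes>\<^bsub>cd2 k \<mu>1 \<mu>2\<^esub> y) \<otimes>\<^bsub>cd2 k \<mu>1 \<mu>2\<^esub> z = x \<otimes>\<^bsub>cd2 k \<mu>1 \<mu>2\<^esub> (y \<otimes>\<^bsub>cd2 k \<mu>1 \<mu>2\<^esub> z)"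
    by (intro B1.cayley_dickson_associative) simp_all
qed simp

lemma gen_closed [simp]: "v j \<in> carrier \<O>"
  by (cases j) (simp_all add: octonions_def cd_embed_def cd_generator_def)

lemmas octonion_neg = B0.cayley_dickson_neg B1.cayley_dickson_neg B2.cayley_dickson_neg

lemma gen_square:
  "v G1 \<otimes>\<^bsub>\<O>\<^esub> v G1 = \<mu>1 \<odot>\<^bsub>\<O>\<^esub> \<one>\<^bsub>\<O>\<^esub>" "v G2 \<otimes>\<^bsub>\<O>\<^esub> v G2 = \<mu>2 \<odot>\<^bsub>\<O>\<^esub> \<one>\<^bsub>\<O>\<^esub>" "v G3 \<otimes>\<^bsub>\<O>\<^esub> v G3 = \<mu>3 \<odot>\<^bsub>\<O>\<^esub> \<one>\<^bsub>\<O>\<^esub>"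
  by (simp_all add: octonions_def cd_embed_def cd_generator_def octonion_neg)

lemma gen_cayley_triple: "cayley_triple (v G1) (v G2) (v G3)"
  unfolding cayley_triple_def
  by (simp add: octonions_def cd_embed_def cd_generator_def octonion_neg)

text \<open>
  By \<open>cayley_dickson_commutant\<close>, applied to the last step of the process with \<open>c = v\<^sub>2\<close>: since
  \<open>v\<^sub>2\<^sup>* = - v\<^sub>2\<close>, the equation \<open>r v\<^sub>2 = r v\<^sub>2\<^sup>*\<close> means \<open>2 r = 0\<close>.
\<close>

lemma octonion_center: "alt_center \<O> = (\<lambda>r. r \<odot>\<^bsub>\<O>\<^esub> \<one>\<^bsub>\<O>\<^esub>) ` carrier k"
proof
  show "(\<lambda>r. r \<odot>\<^bsub>\<O>\<^esub> \<one>\<^bsub>\<O>\<^esub>) ` carrier k \<subseteq> alt_center \<O>"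
    by (auto intro: smult_one_central)
  show "alt_center \<O> \<subseteq> (\<lambda>r. r \<odot>\<^bsub>\<O>\<^esub> \<one>\<^bsub>\<O>\<^esub>) ` carrier k"
  proof
    fix z assume z: "z \<in> alt_center \<O>"
    obtain r where "r \<in> carrier k" "z = r \<odot>\<^bsub>\<O>\<^esub> \<one>\<^bsub>\<O>\<^esub>"
      unfolding octonions_def
    proof (rule B2.cayley_dickson_commutant)
      show "cancellable_scalar k (cd2 k \<mu>1 \<mu>2) \<mu>3"
        using constants by (simp add: octonion_constants_def)
      show "cd_generator (cd1 k \<mu>1) \<in> carrier (cd2 k \<mu>1 \<mu>2)"
        by (simp add: cd_generator_def)
      show "r = \<zero>\<^bsub>k\<^esub>" if r: "r \<in> carrier k"
        and eq: "r \<odot>\<^bsub>cd2 k \<mu>1 \<mu>2\<^esub> cd_generator (cd1 k \<mu>1)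
          = r \<odot>\<^bsub>cd2 k \<mu>1 \<mu>2\<^esub> star (cd2 k \<mu>1 \<mu>2) (cd_generator (cd1 k \<mu>1))" for r
      proof -
        have "r \<odot>\<^bsub>cd_base k\<^esub> \<one>\<^bsub>cd_base k\<^esub> = r \<odot>\<^bsub>cd_base k\<^esub> (\<ominus>\<^bsub>cd_base k\<^esub> \<one>\<^bsub>cd_base k\<^esub>)"
          using eq by (simp add: cd_generator_def B0.cayley_dickson_neg del: cd_base_simps)
        then have "r = \<ominus>\<^bsub>cd_base k\<^esub> r" using r B0.smult_r_minus[of r "\<one>\<^bsub>k\<^esub>"] by simp
        then have "r \<oplus>\<^bsub>cd_base k\<^esub> r = \<zero>\<^bsub>cd_base k\<^esub>" using r by (metis B0.M.l_neg cd_base_simps(1))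
        then have "(\<one>\<^bsub>k\<^esub> \<oplus>\<^bsub>k\<^esub> \<one>\<^bsub>k\<^esub>) \<otimes>\<^bsub>k\<^esub> r = \<zero>\<^bsub>k\<^esub>" using r by (simp add: B0.R.l_distr)
        then show ?thesis using B0.half r
          by (metis B0.R.Units_closed B0.R.Units_inv_closed B0.R.Units_l_inv B0.R.l_one B0.R.m_assoc B0.R.r_null)
      qed
    qed (use z alt_centerD[OF z] in \<open>auto simp: octonions_def\<close>)
    then show "z \<in> (\<lambda>r. r \<odot>\<^bsub>\<O>\<^esub> \<one>\<^bsub>\<O>\<^esub>) ` carrier k" by blast
  qed
qed

text \<open>
  Each step of the process adds to \<open>B\<close> only the multiples \<open>v b\<close> of its generator.
\<close>

lemma octonions_generated:
  assumes scal: "\<And>r. r \<in> carrier k \<Longrightarrow> r \<odot>\<^bsub>\<O>\<^esub> \<one>\<^bsub>\<O>\<^esub> \<in> S" and gen: "\<And>j. v j \<in> S"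
    and add: "\<And>x y. \<lbrakk>x \<in> S; y \<in> S\<rbrakk> \<Longrightarrow> x \<oplus>\<^bsub>\<O>\<^esub> y \<in> S"
    and mult: "\<And>x y. \<lbrakk>x \<in> S; y \<in> S\<rbrakk> \<Longrightarrow> x \<otimes>\<^bsub>\<O>\<^esub> y \<in> S"
  shows "carrier \<O> \<subseteq> S"
proof -
  let ?e2 = "cd_embed (cd2 k \<mu>1 \<mu>2)" and ?e1 = "\<lambda>x. cd_embed (cd2 k \<mu>1 \<mu>2) (cd_embed (cd1 k \<mu>1) x)"
  have 0: "?e1 (cd_embed (cd_base k) r) \<in> S" if "r \<in> carrier k" for r
    using scal[OF that] that by (simp add: octonions_def cd_embed_def)
  have 1: "?e1 x \<in> S" if "x \<in> carrier (cd1 k \<mu>1)" for x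
  proof -
    obtain a b where ab: "x = (a, b)" "a \<in> carrier k" "b \<in> carrier k" using \<open>x \<in> _\<close> by auto
    have "?e1 x = ?e1 (cd_embed (cd_base k) a) \<oplus>\<^bsub>\<O>\<^esub> v G1 \<otimes>\<^bsub>\<O>\<^esub> ?e1 (cd_embed (cd_base k) b)"
      using ab by (simp add: octonions_def cd_embed_def cd_generator_def octonion_neg)
    then show ?thesis by (simp only:) (intro add mult gen 0 ab)
  qed
  have 2: "?e2 x \<in> S" if "x \<in> carrier (cd2 k \<mu>1 \<mu>2)" for x
  proof -
    obtain a b where ab: "x = (a, b)" "a \<in> carrier (cd1 k \<mu>1)" "b \<in> carrier (cd1 k \<mu>1)"
      using \<open>x \<in> _\<close> by (metis SigmaE cayley_dickson_simps(1))
    have "?e2 x = ?e1 a \<oplus>\<^bsub>\<O>\<^esub> v G2 \<otimes>\<^bsub>\<O>\<^esub> ?e1 b"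
      using ab by (auto simp: octonions_def cd_embed_def cd_generator_def octonion_neg)
    then show ?thesis by (simp only:) (intro add mult gen 1 ab)
  qed
  show ?thesis
  proof
    fix x assume x: "x \<in> carrier \<O>"
    obtain a b where ab: "x = (a, b)" by (cases x)
    then have a: "a \<in> carrier (cd2 k \<mu>1 \<mu>2)" and b: "b \<in> carrier (cd2 k \<mu>1 \<mu>2)"
      using x by (auto simp: octonions_def)
    have "x = ?e2 a \<oplus>\<^bsub>\<O>\<^esub> v G3 \<otimes>\<^bsub>\<O>\<^esub> ?e2 b"
      using B2.cayley_dickson_decompose[OF a b mu_closed(3)] by (simp only: octonions_def ab octonion_gen.simps)
    with add[OF 2[OF a] mult[OF gen[of G3] 2[OF b]]] show "x \<in> S" by (rule ssubst[rotated])
  qed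
qed

end

text \<open>
  The homomorphism is extended from the scalars in three steps.  In each step the new generator
  must be moved past the image \<open>b\<close> of the previous stage, with \<open>b\<close> turning into \<open>b\<^sup>*\<close>.  For \<open>y\<close> this
  says that \<open>x\<close> and \<open>y\<close> anticommute; for \<open>z\<close> it says that \<open>z\<close> anticommutes with \<open>x\<close>, \<open>y\<close> and \<open>y x\<close>.
\<close>

lemma (in alternative_algebra) octonion_extension:
  assumes "octonion_constants R \<mu>1 \<mu>2 \<mu>3" and xyz: "cayley_triple x y z"
    and sq: "x \<cdot> x = \<mu>1 \<odot>\<^bsub>A\<^esub> \<one>\<^bsub>A\<^esub>" "y \<cdot> y = \<mu>2 \<odot>\<^bsub>A\<^esub> \<one>\<^bsub>A\<^esub>" "z \<cdot> z = \<mu>3 \<odot>\<^bsub>A\<^esub> \<one>\<^bsub>A\<^esub>"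
  obtains f where "f \<in> algebra_hom R (octonions R \<mu>1 \<mu>2 \<mu>3) A"
    and "f (octonion_gen R \<mu>1 \<mu>2 G1) = x" "f (octonion_gen R \<mu>1 \<mu>2 G2) = y"
      "f (octonion_gen R \<mu>1 \<mu>2 G3) = z"
proof -
  interpret O: octonion_process R \<mu>1 \<mu>2 \<mu>3
    by unfold_locales fact
  note t = cayley_tripleD[OF xyz] and [simp] = cayley_tripleD(1,2,3)[OF xyz]
  define h0 where "h0 r = r \<odot>\<^bsub>A\<^esub> \<one>\<^bsub>A\<^esub>" for r
  define h1 where "h1 = (\<lambda>(a, b). h0 a \<^bold>+ x \<cdot> h0 b)"
  define h2 where "h2 = (\<lambda>(a, b). h1 a \<^bold>+ y \<cdot> h1 b)"
  define h3 where "h3 = (\<lambda>(a, b). h2 a \<^bold>+ z \<cdot> h2 b)"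
  have h0_closed [simp]: "h0 r \<in> carrier A" if "r \<in> carrier R" for r
    using that by (simp add: h0_def)
  have h0: "h0 \<in> algebra_hom R (cd_base R) A"
    by (auto simp: algebra_hom_def ring_hom_def h0_def mult_smult_left smult_l_distr
        simp flip: smult_assoc1)
  have h1: "h1 \<in> algebra_hom R (cd1 R \<mu>1) A"
    unfolding h1_def
    by (rule cayley_dickson_extension[OF O.B0.scalar_involution_algebra_axioms h0])
      (simp_all add: sq h0_def mult_smult_left mult_smult_right)
  have h1_skew: "h1 b \<cdot> w = w \<cdot> h1 (star (cd1 R \<mu>1) b)"
    if "b \<in> carrier (cd1 R \<mu>1)" "w \<in> carrier A" "w \<cdot> x = \<ominus>\<^bsub>A\<^esub> (x \<cdot> w)" for b w
  proof -
    have "x \<cdot> w = \<ominus>\<^bsub>A\<^esub> (w \<cdot> x)" using that by simp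
    then show ?thesis
      using that(1,2) by (auto simp: h1_def h0_def bilinear mult_smult_left mult_smult_right
        smult_r_minus smult_l_minus)
  qed
  have h2: "h2 \<in> algebra_hom R (cd2 R \<mu>1 \<mu>2) A"
    unfolding h2_def
    by (rule cayley_dickson_extension[OF O.B1.scalar_involution_algebra_axioms h1])
      (simp_all add: sq h1_skew t(4) del: cayley_dickson_simps)
  have yh1_skew: "(y \<cdot> h1 b) \<cdot> z = \<ominus>\<^bsub>A\<^esub> (z \<cdot> (y \<cdot> h1 b))" if "b \<in> carrier (cd1 R \<mu>1)" for b
  proof -
    have "(y \<cdot> x) \<cdot> z = \<ominus>\<^bsub>A\<^esub> (z \<cdot> (y \<cdot> x))"
      using cayley_triple_product_anticommutes[OF cayley_triple_swap_left[OF xyz]] by simp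
    moreover have "y \<cdot> z = \<ominus>\<^bsub>A\<^esub> (z \<cdot> y)" using t(6) by simp
    ultimately show ?thesis
      using that by (auto simp: h1_def h0_def bilinear mult_smult_left mult_smult_right
        smult_r_minus M.minus_add)
  qed
  have h1_neg: "h1 (\<ominus>\<^bsub>cd1 R \<mu>1\<^esub> b) = \<ominus>\<^bsub>A\<^esub> h1 b" if "b \<in> carrier (cd1 R \<mu>1)" for b
    using that by (auto simp: h1_def O.octonion_neg h0_def smult_l_minus bilinear M.minus_add)
  have h1_closed: "h1 b \<in> carrier A" if "b \<in> carrier (cd1 R \<mu>1)" for b
    using that h1 by (auto simp: algebra_hom_def ring_hom_def)
  have h3: "h3 \<in> algebra_hom R (octonions R \<mu>1 \<mu>2 \<mu>3) A"
    unfolding h3_def octonions_def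
  proof (rule cayley_dickson_extension[OF O.B2.scalar_involution_algebra_axioms h2])
    fix b assume "b \<in> carrier (cd2 R \<mu>1 \<mu>2)"
    then obtain p q where b: "b = (p, q)" "p \<in> carrier (cd1 R \<mu>1)" "q \<in> carrier (cd1 R \<mu>1)"
      by (metis SigmaE cayley_dickson_simps(1))
    have [simp]: "h1 p \<in> carrier A" "h1 q \<in> carrier A" "h1 (star (cd1 R \<mu>1) p) \<in> carrier A"
      using b by (auto intro!: h1_closed simp del: cayley_dickson_simps)
    show "h2 b \<cdot> z = z \<cdot> h2 (star (cd2 R \<mu>1 \<mu>2) b)"
      using b by (simp add: h2_def bilinear h1_skew[OF _ _ t(5)] yh1_skew h1_neg
          del: cayley_dickson_simps(1))
  qed (simp_all add: sq)
  show ?thesis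
    by (rule that[OF h3])
      (simp_all add: h3_def h2_def h1_def h0_def cd_embed_def cd_generator_def)
qed

section \<open>Functoriality in the scalar ring\<close>

text \<open>
  The process is functorial: an isomorphism of the scalar rings acts coordinatewise.
\<close>

definition semilinear_star_iso ::
  "('a, 'm) ring_scheme \<Rightarrow> ('a \<Rightarrow> 'c) \<Rightarrow> ('a, 'b, 'n) star_algebra_scheme
    \<Rightarrow> ('c, 'd, 'o) star_algebra_scheme \<Rightarrow> ('b \<Rightarrow> 'd) \<Rightarrow> bool" where
  "semilinear_star_iso k e B B' h \<longleftrightarrow> h \<in> ring_iso B B' \<and>
     (\<forall>r\<in>carrier k. \<forall>x\<in>carrier B. h (r \<odot>\<^bsub>B\<^esub> x) = e r \<odot>\<^bsub>B'\<^esub> h x) \<and>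
     (\<forall>x\<in>carrier B. h (star B x) = star B' (h x))"

lemma semilinear_star_iso_cayley_dickson:
  assumes B: "scalar_involution_algebra k B" and B': "scalar_involution_algebra k' B'"
    and h: "semilinear_star_iso k e B B' h" and mu: "\<mu> \<in> carrier k"
  shows "semilinear_star_iso k e (cayley_dickson B \<mu>) (cayley_dickson B' (e \<mu>)) (map_prod h h)"
proof -
  interpret B: scalar_involution_algebra k B by fact
  interpret B': scalar_involution_algebra k' B' by fact
  note [simp] = B.mult_closed B.unit_closed B.star_closed mu
  have bij: "bij_betw h (carrier B) (carrier B')"
    using h by (auto simp: semilinear_star_iso_def ring_iso_def)
  have h_closed [simp]: "h x \<in> carrier B'" if "x \<in> carrier B" for x
    using h that by (auto simp: semilinear_star_iso_def ring_iso_def ring_hom_def)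
  have [simp]: "h (x \<otimes>\<^bsub>B\<^esub> y) = h x \<otimes>\<^bsub>B'\<^esub> h y" "h (x \<oplus>\<^bsub>B\<^esub> y) = h x \<oplus>\<^bsub>B'\<^esub> h y"
    "h \<one>\<^bsub>B\<^esub> = \<one>\<^bsub>B'\<^esub>" "h (star B x) = star B' (h x)"
    if "x \<in> carrier B" "y \<in> carrier B" for x y
    using h that by (auto simp: semilinear_star_iso_def ring_iso_def ring_hom_def)
  have [simp]: "h (r \<odot>\<^bsub>B\<^esub> x) = e r \<odot>\<^bsub>B'\<^esub> h x" if "r \<in> carrier k" "x \<in> carrier B" for r x
    using h that by (auto simp: semilinear_star_iso_def)
  have h1: "h \<one>\<^bsub>B\<^esub> = \<one>\<^bsub>B'\<^esub>"
    using h by (auto simp: semilinear_star_iso_def ring_iso_def ring_hom_def)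
  have hom: "h \<in> hom (add_monoid B) (add_monoid B')"
    by (auto simp: hom_def)
  interpret add: group_hom "add_monoid B" "add_monoid B'" h
    by unfold_locales (rule hom)
  have h0: "h \<zero>\<^bsub>B\<^esub> = \<zero>\<^bsub>B'\<^esub>" using add.hom_one by simp
  have neg: "h (\<ominus>\<^bsub>B\<^esub> x) = \<ominus>\<^bsub>B'\<^esub> h x" if "x \<in> carrier B" for x
    using add.hom_inv[of x] that by (simp add: a_inv_def)
  have "bij_betw (map_prod h h) (carrier B \<times> carrier B) (carrier B' \<times> carrier B')"
    by (rule bij_betw_map_prod[OF bij bij])
  then show ?thesis
    by (auto simp: semilinear_star_iso_def ring_iso_def ring_hom_def h0 h1 neg)
qed

lemma octonions_functorial:
  assumes k: "octonion_constants k \<mu>1 \<mu>2 \<mu>3" and k': "octonion_constants k' (e \<mu>1) (e \<mu>2) (e \<mu>3)"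
    and e: "e \<in> ring_iso k k'"
  obtains h where "semilinear_star_iso k e (octonions k \<mu>1 \<mu>2 \<mu>3) (octonions k' (e \<mu>1) (e \<mu>2) (e \<mu>3)) h"
proof -
  have "semilinear_star_iso k e (cd_base k) (cd_base k') e"
    using e by (auto simp: semilinear_star_iso_def ring_iso_def ring_hom_def)
  with k k' show ?thesis
    by (intro that) (auto simp only: octonions_def octonion_constants_def cancellable_scalar_def
      intro!: semilinear_star_iso_cayley_dickson)
qed

section \<open>Change of scalars\<close>

lemma restrict_scalars_simps [simp]:
  "carrier (restrict_scalars h A) = carrier A" "mult (restrict_scalars h A) = mult A"
  "\<one>\<^bsub>restrict_scalars h A\<^esub> = \<one>\<^bsub>A\<^esub>" "\<zero>\<^bsub>restrict_scalars h A\<^esub> = \<zero>\<^bsub>A\<^esub>" "add (restrict_scalars h A) = add A"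
  "r \<odot>\<^bsub>restrict_scalars h A\<^esub> x = h r \<odot>\<^bsub>A\<^esub> x"
  by (simp_all add: restrict_scalars_def)

lemma self_algebra_simps [simp]:
  "carrier (self_algebra A) = carrier A" "mult (self_algebra A) = mult A"
  "\<one>\<^bsub>self_algebra A\<^esub> = \<one>\<^bsub>A\<^esub>" "\<zero>\<^bsub>self_algebra A\<^esub> = \<zero>\<^bsub>A\<^esub>" "add (self_algebra A) = add A"
  "r \<odot>\<^bsub>self_algebra A\<^esub> x = r \<otimes>\<^bsub>A\<^esub> x"
  by (simp_all add: self_algebra_def)

lemma a_inv_restrict_scalars [simp]: "a_inv (restrict_scalars h A) = a_inv A"
  by (auto simp: a_inv_def m_inv_def fun_eq_iff)

lemma a_inv_self_algebra [simp]: "a_inv (self_algebra A) = a_inv A"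
  by (auto simp: a_inv_def m_inv_def fun_eq_iff)

lemma a_minus_restrict_scalars [simp]: "a_minus (restrict_scalars h A) = a_minus A"
  by (auto simp: a_minus_def fun_eq_iff)

lemma a_minus_self_algebra [simp]: "a_minus (self_algebra A) = a_minus A"
  by (auto simp: a_minus_def fun_eq_iff)

lemma alternative_algebra_restrict_scalars:
  assumes "alternative_algebra k A" "cring R" "c \<in> ring_hom R k"
  shows "alternative_algebra R (restrict_scalars c A)"
proof -
  interpret A: alternative_algebra k A by fact
  have c [simp]: "c r \<in> carrier k" "c (r \<oplus>\<^bsub>R\<^esub> s) = c r \<oplus>\<^bsub>k\<^esub> c s" "c (r \<otimes>\<^bsub>R\<^esub> s) = c r \<otimes>\<^bsub>k\<^esub> c s"
    "c \<one>\<^bsub>R\<^esub> = \<one>\<^bsub>k\<^esub>"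
    if "r \<in> carrier R" "s \<in> carrier R" for r s
    using that assms(3) by (auto simp: ring_hom_def)
  have c1: "c \<one>\<^bsub>R\<^esub> = \<one>\<^bsub>k\<^esub>" using assms(3) by (auto simp: ring_hom_def)
  have "abelian_group (restrict_scalars c A)"
    by (rule abelian_groupI) (auto simp: A.M.a_ac intro!: bexI[of _ "\<ominus>\<^bsub>A\<^esub> x" for x] A.M.l_neg)
  then have "module R (restrict_scalars c A)"
    by (intro moduleI assms) (auto simp: A.smult_l_distr A.smult_r_distr A.smult_assoc1 c1)
  then have "unital_algebra R (restrict_scalars c A)"
    by (rule unital_algebra.intro)
      (unfold_locales, auto simp: A.mult_add_left A.mult_add_right A.mult_smult_left A.mult_smult_right)
  then show ?thesis
    by (rule alternative_algebra.intro)
      (unfold_locales, auto simp: associator_def A.left_alternative[unfolded associator_def]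
        A.right_alternative[unfolded associator_def])
qed

lemma (in alternative_algebra) alternative_algebra_over_center:
  "alternative_algebra (A\<lparr>carrier := alt_center A\<rparr>) (self_algebra A)"
proof -
  have "abelian_group (self_algebra A)"
    by (rule abelian_groupI) (auto simp: M.a_ac intro!: bexI[of _ "\<ominus>\<^bsub>A\<^esub> x" for x] M.l_neg)
  then have "module (A\<lparr>carrier := alt_center A\<rparr>) (self_algebra A)"
    by (intro moduleI center_cring) (auto simp: alt_centerD(1,3) bilinear)
  then have "unital_algebra (A\<lparr>carrier := alt_center A\<rparr>) (self_algebra A)"
    by (rule unital_algebra.intro)
      (unfold_locales, auto simp: bilinear alt_centerD(3,4))
  then show ?thesis
    by (rule alternative_algebra.intro)
      (unfold_locales, auto simp: associator_def left_alternative[unfolded associator_def]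
        right_alternative[unfolded associator_def])
qed

section \<open>Polynomials in three variables\<close>

lemma ring_hom_preserves_half:
  assumes "cring k" "cring k'" "c \<in> ring_hom k k'" and half: "\<one>\<^bsub>k\<^esub> \<oplus>\<^bsub>k\<^esub> \<one>\<^bsub>k\<^esub> \<in> Units k"
  shows "\<one>\<^bsub>k'\<^esub> \<oplus>\<^bsub>k'\<^esub> \<one>\<^bsub>k'\<^esub> \<in> Units k'"
proof -
  interpret ring_hom_cring k k' c
    by (rule ring_hom_cringI) (fact assms)+
  let ?h = "inv\<^bsub>k\<^esub> (\<one>\<^bsub>k\<^esub> \<oplus>\<^bsub>k\<^esub> \<one>\<^bsub>k\<^esub>)"
  have [simp]: "?h \<in> carrier k" using half by simp
  have "c ?h \<otimes>\<^bsub>k'\<^esub> (\<one>\<^bsub>k'\<^esub> \<oplus>\<^bsub>k'\<^esub> \<one>\<^bsub>k'\<^esub>) = c (?h \<otimes>\<^bsub>k\<^esub> (\<one>\<^bsub>k\<^esub> \<oplus>\<^bsub>k\<^esub> \<one>\<^bsub>k\<^esub>))"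
    by (subst hom_mult) simp_all
  also have "\<dots> = \<one>\<^bsub>k'\<^esub>" using half by simp
  finally show ?thesis
    by (auto simp: Units_def S.m_comm intro!: bexI[of _ "c ?h"])
qed

lemma UP_cringI: "cring R \<Longrightarrow> UP_cring R"
  by (simp add: UP_cring_def)

lemma UP_generated:
  assumes R: "cring R"
    and const: "\<And>a. a \<in> carrier R \<Longrightarrow> monom (UP R) a 0 \<in> S" and var: "monom (UP R) \<one>\<^bsub>R\<^esub> 1 \<in> S"
    and add: "\<And>p q. \<lbrakk>p \<in> S; q \<in> S\<rbrakk> \<Longrightarrow> p \<oplus>\<^bsub>UP R\<^esub> q \<in> S"
    and mult: "\<And>p q. \<lbrakk>p \<in> S; q \<in> S\<rbrakk> \<Longrightarrow> p \<otimes>\<^bsub>UP R\<^esub> q \<in> S"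
  shows "carrier (UP R) \<subseteq> S"
proof
  interpret P: UP_cring R "UP R" by (rule UP_cringI[OF R])
  have pow: "monom (UP R) \<one>\<^bsub>R\<^esub> n \<in> S" for n
  proof (induction n)
    case 0 then show ?case using const[of "\<one>\<^bsub>R\<^esub>"] by simp
  next
    case (Suc n) then show ?case by (simp only: P.monom_one_Suc mult var)
  qed
  have mon: "monom (UP R) a n \<in> S" if "a \<in> carrier R" for a n
  proof -
    have "monom (UP R) a n = monom (UP R) a 0 \<otimes>\<^bsub>UP R\<^esub> monom (UP R) \<one>\<^bsub>R\<^esub> n"
      using that P.monom_mult[of a "\<one>\<^bsub>R\<^esub>" 0 n] by simp
    then show ?thesis by (simp only: mult const that pow)
  qed
  fix p assume p: "p \<in> carrier (UP R)"
  have "(\<Oplus>\<^bsub>UP R\<^esub>i\<in>I. monom (UP R) (coeff (UP R) p i) i) \<in> S" if "finite I" for I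
    using that
  proof induction
    case empty
    have "\<zero>\<^bsub>UP R\<^esub> = monom (UP R) \<zero>\<^bsub>R\<^esub> 0" by simp
    then show ?case using const[of "\<zero>\<^bsub>R\<^esub>"] by simp
  next
    case (insert i I)
    then show ?case using p by (simp add: add mon Pi_def)
  qed
  then show "p \<in> S" using P.up_repr[OF p] by (metis finite_atMost)
qed

context
  fixes R :: "('a, 'm) ring_scheme"
  assumes R: "cring R"
begin

interpretation P1: UP_cring R "UP R" by (rule UP_cringI[OF R])
interpretation P2: UP_cring "UP R" "UP (UP R)" by (rule UP_cringI[OF P1.UP_cring])
interpretation P3: UP_cring "UP (UP R)" "UP (UP (UP R))" by (rule UP_cringI[OF P2.UP_cring])

lemma poly3_ring_cring: "cring (poly3_ring R)"
  unfolding poly3_ring_def by (rule P3.UP_cring)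

lemma poly3_const_hom: "poly3_const R \<in> ring_hom R (poly3_ring R)"
proof -
  from ring_hom_trans[OF ring_hom_trans[OF P1.const_ring_hom P2.const_ring_hom] P3.const_ring_hom]
  show ?thesis by (simp add: poly3_ring_def poly3_const_def[abs_def] comp_def)
qed

lemma poly3_var_closed [simp]: "poly3_var R j \<in> carrier (poly3_ring R)"
  by (cases j) (simp_all add: poly3_ring_def)

lemma poly3_generated:
  assumes const: "\<And>a. a \<in> carrier R \<Longrightarrow> poly3_const R a \<in> S" and var: "\<And>j. poly3_var R j \<in> S"
    and add: "\<And>p q. \<lbrakk>p \<in> S; q \<in> S\<rbrakk> \<Longrightarrow> p \<oplus>\<^bsub>poly3_ring R\<^esub> q \<in> S"
    and mult: "\<And>p q. \<lbrakk>p \<in> S; q \<in> S\<rbrakk> \<Longrightarrow> p \<otimes>\<^bsub>poly3_ring R\<^esub> q \<in> S"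
  shows "carrier (poly3_ring R) \<subseteq> S"
proof -
  let ?c3 = "\<lambda>p. monom (UP (UP (UP R))) p 0" and ?c2 = "\<lambda>p. monom (UP (UP R)) p 0"
  note hom = ring_hom_mult[OF P2.const_ring_hom] ring_hom_mult[OF P3.const_ring_hom]
  have 1: "carrier (UP R) \<subseteq> {p \<in> carrier (UP R). ?c3 (?c2 p) \<in> S}"
    using const var[of G1] add mult
    by (intro UP_generated R) (auto simp: poly3_const_def poly3_ring_def hom)
  have 2: "carrier (UP (UP R)) \<subseteq> {p \<in> carrier (UP (UP R)). ?c3 p \<in> S}"
    using 1 var[of G2] add mult
    by (intro UP_generated P1.UP_cring) (auto simp: poly3_ring_def hom)
  show ?thesis
    unfolding poly3_ring_def using 2 var[of G3] add mult
    by (intro UP_generated P2.UP_cring) (auto simp: poly3_ring_def)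
qed

lemma cancellable_const:
  assumes "cring k" "cancellable_scalar k (cd_base k) \<mu>"
  shows "cancellable_scalar (UP k) (cd_base (UP k)) (monom (UP k) \<mu> 0)"
proof -
  interpret P: UP_cring k "UP k" by (rule UP_cringI) fact
  have mu: "\<mu> \<in> carrier k" and c: "\<And>b. b \<in> carrier k \<Longrightarrow> \<mu> \<otimes>\<^bsub>k\<^esub> b = \<zero>\<^bsub>k\<^esub> \<Longrightarrow> b = \<zero>\<^bsub>k\<^esub>"
    using assms(2) by (auto simp: cancellable_scalar_def)
  have "p = \<zero>\<^bsub>UP k\<^esub>" if p: "p \<in> carrier (UP k)" and z: "monom (UP k) \<mu> 0 \<otimes>\<^bsub>UP k\<^esub> p = \<zero>\<^bsub>UP k\<^esub>" for p
  proof (rule P.up_eqI)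
    fix n
    have "coeff (UP k) (\<mu> \<odot>\<^bsub>UP k\<^esub> p) n = \<zero>\<^bsub>k\<^esub>"
      using z p mu by (simp add: P.monom_mult_is_smult)
    then show "coeff (UP k) p n = coeff (UP k) \<zero>\<^bsub>UP k\<^esub> n"
      using p mu by (simp add: c)
  qed (use p in auto)
  then show ?thesis
    unfolding cancellable_scalar_def cd_base_simps using P.monom_closed[OF mu] by blast
qed

text \<open>
  Multiplication by the variable shifts the coefficients.
\<close>

lemma cancellable_variable:
  assumes "cring k"
  shows "cancellable_scalar (UP k) (cd_base (UP k)) (monom (UP k) \<one>\<^bsub>k\<^esub> 1)"
proof -
  interpret P: UP_cring k "UP k" by (rule UP_cringI) fact
  have "p = \<zero>\<^bsub>UP k\<^esub>" if p: "p \<in> carrier (UP k)" and z: "monom (UP k) \<one>\<^bsub>k\<^esub> 1 \<otimes>\<^bsub>UP k\<^esub> p = \<zero>\<^bsub>UP k\<^esub>" for p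
  proof (rule P.up_eqI)
    fix n
    have "coeff (UP k) (monom (UP k) \<one>\<^bsub>k\<^esub> 1 \<otimes>\<^bsub>UP k\<^esub> p) (n + 1) = \<one>\<^bsub>k\<^esub> \<otimes>\<^bsub>k\<^esub> coeff (UP k) p n"
      using p by (intro P.coeff_monom_mult) auto
    then show "coeff (UP k) p n = coeff (UP k) \<zero>\<^bsub>UP k\<^esub> n"
      unfolding z using p by simp
  qed (use p in auto)
  then show ?thesis
    unfolding cancellable_scalar_def cd_base_simps using P.monom_closed[OF P.R.one_closed] by blast
qed

lemma poly3_var_cancellable:
  "cancellable_scalar (poly3_ring R) (cd_base (poly3_ring R)) (poly3_var R j)"
  unfolding poly3_ring_def
  by (cases j) (simp_all add: cancellable_const cancellable_variable R P1.UP_cring P2.UP_cring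
    del: P1.monom_one P2.monom_one One_nat_def)

lemma poly3_eval:
  assumes Z: "cring Z" and c: "c \<in> ring_hom R Z" and s: "\<And>j. s j \<in> carrier Z"
  obtains e where "e \<in> ring_hom (poly3_ring R) Z" "\<And>a. a \<in> carrier R \<Longrightarrow> e (poly3_const R a) = c a"
    "\<And>j. e (poly3_var R j) = s j"
proof -
  interpret E1: UP_pre_univ_prop R Z c "UP R"
    using R Z c by (intro UP_pre_univ_propI)
  define e1 where "e1 = eval R Z c (s G1)"
  have e1: "e1 \<in> ring_hom (UP R) Z" unfolding e1_def by (rule E1.eval_ring_hom[OF s])
  interpret E2: UP_pre_univ_prop "UP R" Z e1 "UP (UP R)"
    using P1.UP_cring Z e1 by (intro UP_pre_univ_propI)
  define e2 where "e2 = eval (UP R) Z e1 (s G2)"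
  have e2: "e2 \<in> ring_hom (UP (UP R)) Z" unfolding e2_def by (rule E2.eval_ring_hom[OF s])
  interpret E3: UP_pre_univ_prop "UP (UP R)" Z e2 "UP (UP (UP R))"
    using P2.UP_cring Z e2 by (intro UP_pre_univ_propI)
  define e3 where "e3 = eval (UP (UP R)) Z e2 (s G3)"
  show ?thesis
  proof (rule that[of e3])
    show "e3 \<in> ring_hom (poly3_ring R) Z"
      unfolding e3_def poly3_ring_def by (rule E3.eval_ring_hom[OF s])
    have e3_const: "e3 (monom (UP (UP (UP R))) p 0) = e2 p" if "p \<in> carrier (UP (UP R))" for p
      unfolding e3_def using s that by (rule E3.eval_const)
    have e2_const: "e2 (monom (UP (UP R)) p 0) = e1 p" if "p \<in> carrier (UP R)" for p
      unfolding e2_def using s that by (rule E2.eval_const)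
    have e1_const: "e1 (monom (UP R) a 0) = c a" if "a \<in> carrier R" for a
      unfolding e1_def using s that by (rule E1.eval_const)
    show "e3 (poly3_const R a) = c a" if "a \<in> carrier R" for a
      using that by (simp add: poly3_const_def e3_const e2_const e1_const)
    have "e3 (poly3_var R G3) = s G3" "e3 (poly3_var R G2) = s G2" "e3 (poly3_var R G1) = s G1"
      using E1.eval_monom1[OF s, of G1, folded e1_def] E2.eval_monom1[OF s, of G2, folded e2_def]
        E3.eval_monom1[OF s, of G3, folded e3_def]
      by (simp_all only: poly3_var.simps e3_const e2_const P1.monom_closed P1.R.one_closed
        P2.monom_closed P1.one_closed)
    then show "e3 (poly3_var R j) = s j" for j
      by (cases j) simp_all
  qed
qed

end

section \<open>Gradings\<close>

lemma (in unital_algebra) homogeneous_closed: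
  assumes "homogeneous R A g d n x" "\<And>j. g j \<in> carrier A"
  shows "x \<in> carrier A"
  using assms(1) by induction (auto simp: assms(2))

text \<open>
  Additive maps \<open>\<pi> n\<close> that vanish on homogeneous elements of degree other than \<open>n\<close> and are injective
  on those of degree \<open>n\<close> make homogeneous decompositions unique.  Decompositions exist because
  sums of homogeneous elements form a subalgebra that contains the generators.
\<close>

lemma (in unital_algebra) algebra_grading_by_projections:
  fixes d :: "'j \<Rightarrow> 'i::monoid_add" and N :: "('p, 'q) ring_scheme"
  assumes gen: "carrier A = subalgebra_gen R A (range g)" and g: "\<And>j. g j \<in> carrier A"
    and N: "abelian_group N"
    and pi_closed: "\<And>n x. x \<in> carrier A \<Longrightarrow> \<pi> n x \<in> carrier N"
    and pi_add: "\<And>n x y. \<lbrakk>x \<in> carrier A; y \<in> carrier A\<rbrakk> \<Longrightarrow> \<pi> n (x \<^bold>+ y) = \<pi> n x \<oplus>\<^bsub>N\<^esub> \<pi> n y"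
    and pi_other: "\<And>m n x. \<lbrakk>homogeneous R A g d m x; m \<noteq> n\<rbrakk> \<Longrightarrow> \<pi> n x = \<zero>\<^bsub>N\<^esub>"
    and pi_inj: "\<And>n x. \<lbrakk>homogeneous R A g d n x; \<pi> n x = \<zero>\<^bsub>N\<^esub>\<rbrakk> \<Longrightarrow> x = \<^bold>0"
  shows "algebra_grading R A (component R A g d)"
proof -
  interpret N: abelian_group N by fact
  let ?H = "homogeneous R A g d"
  have hc: "x \<in> carrier A" if "?H n x" for n x
    by (rule homogeneous_closed[OF that g])
  have neg: "?H n (\<ominus>\<^bsub>A\<^esub> x)" if "?H n x" for n x
    using homogeneous.smult[OF _ that, of "\<ominus>\<^bsub>R\<^esub> \<one>\<^bsub>R\<^esub>"] hc[OF that] by (simp add: smult_l_minus)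
  define dec where "dec x f \<longleftrightarrow> (\<forall>n. ?H n (f n)) \<and> finite {n. f n \<noteq> \<^bold>0} \<and>
      x = (\<Oplus>\<^bsub>A\<^esub>n\<in>{n. f n \<noteq> \<^bold>0}. f n)" for x f
  have dec_superset: "x = (\<Oplus>\<^bsub>A\<^esub>n\<in>I. f n)" if "dec x f" "finite I" "{n. f n \<noteq> \<^bold>0} \<subseteq> I" for x f I
    using that hc unfolding dec_def
    by (auto simp: Pi_def intro!: M.add.finprod_mono_neutral_cong_left)
  have decI: "\<exists>f. dec x f" if "finite I" "\<And>n. ?H n (f n)" "\<And>n. n \<notin> I \<Longrightarrow> f n = \<^bold>0"
      "x = (\<Oplus>\<^bsub>A\<^esub>n\<in>I. f n)" for x f I
  proof -
    have "{n. f n \<noteq> \<^bold>0} \<subseteq> I" using that(3) by auto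
    moreover have "(\<Oplus>\<^bsub>A\<^esub>n\<in>{n. f n \<noteq> \<^bold>0}. f n) = (\<Oplus>\<^bsub>A\<^esub>n\<in>I. f n)"
      using that hc calculation by (intro M.add.finprod_mono_neutral_cong_left) (auto simp: Pi_def)
    ultimately have "dec x f"
      using that finite_subset unfolding dec_def by auto
    then show ?thesis by blast
  qed
  have dec_hom: "\<exists>f. dec x f" if "?H n x" for n x
    by (rule decI[of "{n}" "\<lambda>m. if m = n then x else \<^bold>0"]) (use that hc in \<open>auto intro: homogeneous.zero\<close>)
  have dec_add: "\<exists>f. dec (x \<^bold>+ y) f" if "dec x f" "dec y f'" for x y f f'
  proof -
    let ?I = "{n. f n \<noteq> \<^bold>0} \<union> {n. f' n \<noteq> \<^bold>0}"
    have "finite ?I" using that by (auto simp: dec_def)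
    moreover have "x = (\<Oplus>\<^bsub>A\<^esub>n\<in>?I. f n)" "y = (\<Oplus>\<^bsub>A\<^esub>n\<in>?I. f' n)"
      using that calculation by (auto intro!: dec_superset)
    moreover have "(\<Oplus>\<^bsub>A\<^esub>n\<in>?I. f n) \<^bold>+ (\<Oplus>\<^bsub>A\<^esub>n\<in>?I. f' n) = (\<Oplus>\<^bsub>A\<^esub>n\<in>?I. f n \<^bold>+ f' n)"
      using that hc by (intro M.finsum_addf[symmetric]) (auto simp: dec_def)
    ultimately show ?thesis
      using that by (intro decI[of ?I "\<lambda>n. f n \<^bold>+ f' n"]) (auto simp: dec_def intro: homogeneous.add)
  qed
  have dec_induct: "x \<in> S" if x: "dec x f" and S: "\<^bold>0 \<in> S"
      "\<And>n x y. \<lbrakk>x \<in> S; x \<in> carrier A; ?H n y\<rbrakk> \<Longrightarrow> x \<^bold>+ y \<in> S" for x f S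
  proof -
    have "(\<Oplus>\<^bsub>A\<^esub>n\<in>I. f n) \<in> S" if "finite I" for I
      using that
    proof induction
      case empty then show ?case using S by simp
    next
      case (insert n I)
      have "f m \<in> carrier A" for m using x hc by (auto simp: dec_def)
      with insert S(2)[of "\<Oplus>\<^bsub>A\<^esub>n\<in>I. f n" n "f n"] x show ?case
        by (simp add: dec_def Pi_def M.a_comm)
    qed
    with x show ?thesis unfolding dec_def by auto
  qed
  have dec_zero: "\<exists>f. dec \<^bold>0 f" by (rule dec_hom[OF homogeneous.zero])
  have dec_mult_hom: "\<exists>f. dec (u \<cdot> x) f" if u: "?H m u" and x: "dec x f" for u x m f
  proof -
    have "x \<in> {x. \<exists>f. dec (u \<cdot> x) f}"
    proof (rule dec_induct[OF x])
      show "\<^bold>0 \<in> {x. \<exists>f. dec (u \<cdot> x) f}" using dec_zero hc[OF u] by simp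
      show "x \<^bold>+ y \<in> {x. \<exists>f. dec (u \<cdot> x) f}"
        if "x \<in> {x. \<exists>f. dec (u \<cdot> x) f}" "x \<in> carrier A" "?H n y" for n x y
        using that hc[OF u] hc[OF that(3)] dec_hom[OF homogeneous.mult[OF u that(3)]]
        by (auto simp: bilinear intro: dec_add)
    qed
    then show ?thesis by simp
  qed
  have dec_closed: "x \<in> carrier A" if "dec x f" for x f
    using that hc by (auto simp: dec_def intro!: M.finsum_closed)
  have dec_mult: "\<exists>f. dec (x \<cdot> y) f" if x: "dec x f" and y: "dec y f'" for x y f f'
  proof -
    have "x \<in> {x. \<exists>f. dec (x \<cdot> y) f}"
    proof (rule dec_induct[OF x])
      show "\<^bold>0 \<in> {x. \<exists>f. dec (x \<cdot> y) f}" using dec_zero dec_closed[OF y] by simp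
      show "x \<^bold>+ u \<in> {x. \<exists>f. dec (x \<cdot> y) f}"
        if "x \<in> {x. \<exists>f. dec (x \<cdot> y) f}" "x \<in> carrier A" "?H n u" for n x u
        using that hc[OF that(3)] dec_closed[OF y] dec_mult_hom[OF that(3) y]
        by (auto simp: bilinear intro: dec_add)
    qed
    then show ?thesis by simp
  qed
  have ex: "\<exists>f. dec x f" if "x \<in> carrier A" for x
    using that unfolding gen
  proof induction
    case (gen x)
    then show ?case using dec_hom[OF homogeneous.gen] by auto
  next
    case one
    show ?case by (rule dec_hom[OF homogeneous.one])
  next
    case (smult r x)
    then obtain f where x: "dec x f" by blast
    have "r \<odot>\<^bsub>A\<^esub> x = (r \<odot>\<^bsub>A\<^esub> \<one>\<^bsub>A\<^esub>) \<cdot> x"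
      using smult(1) dec_closed[OF x] by (simp add: mult_smult_left)
    moreover have "?H 0 (r \<odot>\<^bsub>A\<^esub> \<one>\<^bsub>A\<^esub>)"
      using smult(1) by (intro homogeneous.smult homogeneous.one)
    ultimately show ?case using dec_mult_hom[OF _ x] by metis
  qed (use dec_add dec_mult in blast)+
  have pi_zero: "\<pi> n \<^bold>0 = \<zero>\<^bsub>N\<^esub>" for n
    using pi_add[of "\<^bold>0" "\<^bold>0" n] pi_closed[of "\<^bold>0" n] by simp
  have pi_dec: "\<pi> n x = \<pi> n (f n)" if x: "dec x f" for x f n
  proof -
    have f: "f m \<in> carrier A" "?H m (f m)" for m using x hc by (auto simp: dec_def)
    have "\<pi> n (\<Oplus>\<^bsub>A\<^esub>m\<in>I. f m) = (if n \<in> I then \<pi> n (f n) else \<zero>\<^bsub>N\<^esub>)" if "finite I" for I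
      using that
    proof induction
      case (insert m I)
      then show ?case using f pi_other[OF f(2)[of m], of n]
        by (auto simp: Pi_def pi_add pi_closed)
    qed (simp add: pi_zero)
    then show ?thesis using x pi_zero by (auto simp: dec_def)
  qed
  have uniq: "f = f'" if x: "dec x f" "dec x f'" for x f f'
  proof
    fix n
    have H: "?H n (f n)" "?H n (f' n)" using x by (auto simp: dec_def)
    have [simp]: "f n \<in> carrier A" "f' n \<in> carrier A" using H hc by auto
    have "\<pi> n (f n \<^bold>- f' n) \<oplus>\<^bsub>N\<^esub> \<pi> n (f' n) = \<pi> n (f n)"
      by (simp flip: pi_add) (simp add: a_minus_def M.a_assoc M.l_neg)
    then have "\<pi> n (f n \<^bold>- f' n) \<oplus>\<^bsub>N\<^esub> \<pi> n (f' n) = \<zero>\<^bsub>N\<^esub> \<oplus>\<^bsub>N\<^esub> \<pi> n (f' n)"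
      using pi_dec[OF x(1), of n] pi_dec[OF x(2), of n] by (simp add: pi_closed)
    then have "\<pi> n (f n \<^bold>- f' n) = \<zero>\<^bsub>N\<^esub>"
      by (simp add: pi_closed N.add.right_cancel)
    moreover have "?H n (f n \<^bold>- f' n)"
      using H by (auto simp: a_minus_def intro: homogeneous.add neg)
    ultimately have "f n \<^bold>- f' n = \<^bold>0" using pi_inj by blast
    then show "f n = f' n" by (simp add: minus_eq_zero_iff)
  qed
  show ?thesis
    unfolding algebra_grading_def component_def
  proof (intro conjI allI ballI)
    show "submodule {x. ?H n x} R A" for n
      by (rule submoduleI) (use hc in \<open>auto intro: homogeneous.zero homogeneous.add homogeneous.smult neg\<close>)
    show "\<one>\<^bsub>A\<^esub> \<in> {x. ?H 0 x}" by (simp add: homogeneous.one)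
    show "x \<cdot> y \<in> {x. ?H (m + n) x}" if "x \<in> {x. ?H m x}" "y \<in> {x. ?H n x}" for m n x y
      using that by (simp add: homogeneous.mult)
    show "\<exists>!f. (\<forall>n. f n \<in> {x. ?H n x}) \<and> finite {n. f n \<noteq> \<^bold>0} \<and> x = (\<Oplus>\<^bsub>A\<^esub>n\<in>{n. f n \<noteq> \<^bold>0}. f n)"
      if "x \<in> carrier A" for x
      using ex[OF that] uniq[of x] unfolding dec_def mem_Collect_eq by blast
  qed
qed

text \<open>
  What makes homogeneous decompositions unique; their existence will follow from generation by
  homogeneous elements.
\<close>

definition graded_projections ::
  "('b, 'n) ring_scheme \<Rightarrow> ('i \<Rightarrow> 'b set) \<Rightarrow> ('i \<Rightarrow> 'b \<Rightarrow> 'b) \<Rightarrow> bool" where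
  "graded_projections M H \<pi> \<longleftrightarrow>
     (\<forall>n. H n \<subseteq> carrier M \<and> \<zero>\<^bsub>M\<^esub> \<in> H n \<and> (\<forall>x\<in>H n. \<ominus>\<^bsub>M\<^esub> x \<in> H n) \<and>
       (\<forall>x\<in>H n. \<forall>y\<in>H n. x \<oplus>\<^bsub>M\<^esub> y \<in> H n)) \<and>
     (\<forall>n. \<forall>x\<in>carrier M. \<pi> n x \<in> carrier M) \<and>
     (\<forall>n. \<forall>x\<in>carrier M. \<forall>y\<in>carrier M. \<pi> n (x \<oplus>\<^bsub>M\<^esub> y) = \<pi> n x \<oplus>\<^bsub>M\<^esub> \<pi> n y) \<and>
     (\<forall>n. \<forall>x\<in>H n. \<pi> n x = x) \<and> (\<forall>m n. \<forall>x\<in>H m. m \<noteq> n \<longrightarrow> \<pi> n x = \<zero>\<^bsub>M\<^esub>)"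

text \<open>
  The degree \<open>n\<close> part of \<open>v M\<close> for a new symbol \<open>v\<close> of degree \<open>d\<close>; it is zero when \<open>d\<close> cannot be
  subtracted from \<open>n\<close>.
\<close>

definition shift ::
  "('b, 'n) ring_scheme \<Rightarrow> 'i::cancel_comm_monoid_add \<Rightarrow> ('i \<Rightarrow> 'b set) \<Rightarrow> 'i \<Rightarrow> 'b set" where
  "shift M d H n = {\<zero>\<^bsub>M\<^esub>} \<union> (if \<exists>m. n = m + d then H (n - d) else {})"

definition shift_proj ::
  "('b, 'n) ring_scheme \<Rightarrow> 'i::cancel_comm_monoid_add \<Rightarrow> ('i \<Rightarrow> 'b \<Rightarrow> 'b) \<Rightarrow> 'i \<Rightarrow> 'b \<Rightarrow> 'b" where
  "shift_proj M d \<pi> n x = (if \<exists>m. n = m + d then \<pi> (n - d) x else \<zero>\<^bsub>M\<^esub>)"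

lemma graded_projectionsD:
  assumes "graded_projections M H \<pi>"
  shows "x \<in> H n \<Longrightarrow> x \<in> carrier M" "\<zero>\<^bsub>M\<^esub> \<in> H n" "x \<in> H n \<Longrightarrow> \<ominus>\<^bsub>M\<^esub> x \<in> H n"
    "\<lbrakk>x \<in> H n; y \<in> H n\<rbrakk> \<Longrightarrow> x \<oplus>\<^bsub>M\<^esub> y \<in> H n" "x \<in> carrier M \<Longrightarrow> \<pi> n x \<in> carrier M"
    "\<lbrakk>x \<in> carrier M; y \<in> carrier M\<rbrakk> \<Longrightarrow> \<pi> n (x \<oplus>\<^bsub>M\<^esub> y) = \<pi> n x \<oplus>\<^bsub>M\<^esub> \<pi> n y"
    "x \<in> H n \<Longrightarrow> \<pi> n x = x" "\<lbrakk>x \<in> H m; m \<noteq> n\<rbrakk> \<Longrightarrow> \<pi> n x = \<zero>\<^bsub>M\<^esub>" "\<pi> n \<zero>\<^bsub>M\<^esub> = \<zero>\<^bsub>M\<^esub>"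
  using assms unfolding graded_projections_def by blast+

lemma graded_projections_shift:
  assumes M: "abelian_group M" and G: "graded_projections M H \<pi>"
  shows "graded_projections M (shift M d H) (shift_proj M d \<pi>)"
proof -
  interpret abelian_group M by fact
  have neg0: "\<ominus>\<^bsub>M\<^esub> \<zero>\<^bsub>M\<^esub> = \<zero>\<^bsub>M\<^esub>" by (rule minus_equality) auto
  note D = graded_projectionsD[OF G]
  show ?thesis
    unfolding graded_projections_def shift_def shift_proj_def
    by (intro conjI allI ballI impI subsetI) (auto split: if_splits simp: D neg0 dest: D(1))
qed

lemma shift_iff: "x \<in> shift M d H n \<longleftrightarrow> x = \<zero>\<^bsub>M\<^esub> \<or> (\<exists>m. n = m + d \<and> x \<in> H m)"
  by (auto simp: shift_def)

lemma shift_mult: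
  assumes "\<And>m n x y. \<lbrakk>x \<in> F m; y \<in> G n\<rbrakk> \<Longrightarrow> f x y \<in> K (m + n)"
    and "\<And>x. x \<in> X \<Longrightarrow> f x \<zero>\<^bsub>N\<^esub> = \<zero>\<^bsub>L\<^esub>" "\<And>y. y \<in> Y \<Longrightarrow> f \<zero>\<^bsub>M\<^esub> y = \<zero>\<^bsub>L\<^esub>"
    and "\<And>m. F m \<subseteq> X" "\<And>m. G m \<subseteq> Y" "\<zero>\<^bsub>M\<^esub> \<in> X" "\<zero>\<^bsub>N\<^esub> \<in> Y"
    and x: "x \<in> shift M a F m" and y: "y \<in> shift N b G n"
  shows "f x y \<in> shift L (a + b) K (m + n)"
proof -
  consider "x = \<zero>\<^bsub>M\<^esub>" | "y = \<zero>\<^bsub>N\<^esub>" | m' n' where "m = m' + a" "x \<in> F m'" "n = n' + b" "y \<in> G n'"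
    using x y by (auto simp: shift_def split: if_splits)
  then show ?thesis
  proof cases
    case 3
    have "m + n = (m' + n') + (a + b)" using 3 by (simp add: ac_simps)
    then show ?thesis using assms(1)[OF 3(2,4)]
      by (auto simp: shift_def intro!: exI[of _ "m' + n'"])
  qed (use assms x y in \<open>auto simp: shift_def split: if_splits; blast\<close>)+
qed

lemma shift_zero: "\<zero>\<^bsub>M\<^esub> \<in> H n \<Longrightarrow> shift M 0 H n = H n"
  by (auto simp: shift_def)

lemma shift_self: "x \<in> H 0 \<Longrightarrow> x \<in> shift M d H d"
  by (auto simp: shift_def intro: exI[of _ 0])

definition graded_ring ::
  "('b, 'n) ring_scheme \<Rightarrow> ('i::cancel_comm_monoid_add \<Rightarrow> 'b set) \<Rightarrow> ('i \<Rightarrow> 'b \<Rightarrow> 'b) \<Rightarrow> bool" where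
  "graded_ring k H \<pi> \<longleftrightarrow> graded_projections k H \<pi> \<and> \<one>\<^bsub>k\<^esub> \<in> H 0 \<and>
     (\<forall>m n. \<forall>x\<in>H m. \<forall>y\<in>H n. x \<otimes>\<^bsub>k\<^esub> y \<in> H (m + n))"

lemma graded_ring_trivial:
  assumes "cring R"
  shows "graded_ring R (\<lambda>n. if n = 0 then carrier R else {\<zero>\<^bsub>R\<^esub>}) (\<lambda>n x. if n = 0 then x else \<zero>\<^bsub>R\<^esub>)"
proof -
  interpret cring R by fact
  show ?thesis
    by (auto simp: graded_ring_def graded_projections_def split: if_splits)
qed

definition multiple :: "nat \<Rightarrow> 'i::cancel_comm_monoid_add \<Rightarrow> 'i" where
  "multiple i d = (\<Sum>_<i. d)"

lemma multiple_simps [simp]: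
  "multiple 0 d = 0" "multiple (Suc 0) d = d" "multiple (i + j) d = multiple i d + multiple j d"
  by (simp_all add: multiple_def) (induction j, simp_all add: ac_simps)

text \<open>
  The grading of \<open>k[X]\<close> that extends the one of \<open>k\<close> and gives the variable \<open>X\<close> the degree \<open>d\<close>.
\<close>

definition up_grading ::
  "('a, 'm) ring_scheme \<Rightarrow> 'i::cancel_comm_monoid_add \<Rightarrow> ('i \<Rightarrow> 'a set) \<Rightarrow> 'i \<Rightarrow> (nat \<Rightarrow> 'a) set" where
  "up_grading k d H n = {p \<in> carrier (UP k). \<forall>i. coeff (UP k) p i \<in> shift k (multiple i d) H n}"

definition up_proj ::
  "('a, 'm) ring_scheme \<Rightarrow> 'i::cancel_comm_monoid_add \<Rightarrow> ('i \<Rightarrow> 'a \<Rightarrow> 'a) \<Rightarrow> 'i \<Rightarrow> (nat \<Rightarrow> 'a) \<Rightarrow> nat \<Rightarrow> 'a" where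
  "up_proj k d \<pi> n p = (\<lambda>i. shift_proj k (multiple i d) \<pi> n (coeff (UP k) p i))"

lemma graded_ring_UP:
  assumes k: "cring k" and G: "graded_ring k H \<pi>"
  shows "graded_ring (UP k) (up_grading k d H) (up_proj k d \<pi>)"
proof -
  interpret P: UP_cring k "UP k" by (rule UP_cringI) fact
  have Gp: "graded_projections k H \<pi>" using G by (simp add: graded_ring_def)
  note S = graded_projectionsD[OF graded_projections_shift[OF P.R.abelian_group_axioms Gp]]
  have coeff_up: "coeff (UP k) f = f" if "f \<in> carrier (UP k)" for f
    using that by (simp add: UP_def)
  have proj_closed: "up_proj k d \<pi> n p \<in> carrier (UP k)" if p: "p \<in> carrier (UP k)" for n p
  proof -
    obtain b where b: "bound \<zero>\<^bsub>k\<^esub> b (coeff (UP k) p)"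
      using p coeff_up[OF p] by (auto simp: UP_def)
    have "up_proj k d \<pi> n p \<in> up k"
    proof
      show "up_proj k d \<pi> n p i \<in> carrier k" for i
        using p S(5) by (simp add: up_proj_def)
      show "\<exists>b. bound \<zero>\<^bsub>k\<^esub> b (up_proj k d \<pi> n p)"
        using b S(9) by (auto simp: bound_def up_proj_def intro!: exI[of _ b])
    qed
    then show ?thesis by (simp add: UP_def)
  qed
  have coeff_proj: "coeff (UP k) (up_proj k d \<pi> n p) i = shift_proj k (multiple i d) \<pi> n (coeff (UP k) p i)"
    if "p \<in> carrier (UP k)" for n p i
    using coeff_up[OF proj_closed[OF that]] by (simp add: up_proj_def)
  have finsum_in: "(\<Oplus>\<^bsub>k\<^esub>i\<in>I. f i) \<in> shift k a H n" if "finite I" "\<And>i. i \<in> I \<Longrightarrow> f i \<in> shift k a H n" for I f a n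
    using that
  proof induction
    case (insert i I)
    have "f \<in> I \<rightarrow> carrier k" "f i \<in> carrier k" using insert(4) S(1) by blast+
    then show ?case using insert by (simp add: S(4))
  qed (simp add: S(2))
  have mult: "p \<otimes>\<^bsub>UP k\<^esub> q \<in> up_grading k d H (m + n)"
    if p: "p \<in> up_grading k d H m" and q: "q \<in> up_grading k d H n" for m n p q
  proof -
    have [simp]: "p \<in> carrier (UP k)" "q \<in> carrier (UP k)" using p q by (auto simp: up_grading_def)
    have pq: "coeff (UP k) p i \<in> shift k (multiple i d) H m" "coeff (UP k) q i \<in> shift k (multiple i d) H n" for i
      using p q by (auto simp: up_grading_def)
    have "coeff (UP k) p i \<otimes>\<^bsub>k\<^esub> coeff (UP k) q (l - i) \<in> shift k (multiple l d) H (m + n)" if "i \<le> l" for i l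
    proof -
      have "coeff (UP k) p i \<otimes>\<^bsub>k\<^esub> coeff (UP k) q (l - i)
          \<in> shift k (multiple i d + multiple (l - i) d) H (m + n)"
        using G graded_projectionsD(1)[OF Gp]
        by (intro shift_mult[OF _ _ _ _ _ _ _ pq, where X = "carrier k" and Y = "carrier k"])
          (auto simp: graded_ring_def)
      then show ?thesis using that multiple_simps(3)[of i "l - i" d] by simp
    qed
    then show ?thesis by (auto simp: up_grading_def intro!: finsum_in)
  qed
  have "graded_projections (UP k) (up_grading k d H) (up_proj k d \<pi>)"
    unfolding graded_projections_def
  proof (intro conjI allI ballI impI)
    show "up_grading k d H n \<subseteq> carrier (UP k)" "\<zero>\<^bsub>UP k\<^esub> \<in> up_grading k d H n" for n
      by (auto simp: up_grading_def S(2))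
    show "\<ominus>\<^bsub>UP k\<^esub> p \<in> up_grading k d H n" if "p \<in> up_grading k d H n" for n p
      using that by (auto simp: up_grading_def S(3))
    show "p \<oplus>\<^bsub>UP k\<^esub> q \<in> up_grading k d H n" if "p \<in> up_grading k d H n" "q \<in> up_grading k d H n" for n p q
      using that by (auto simp: up_grading_def S(4))
    show "up_proj k d \<pi> n p \<in> carrier (UP k)" if "p \<in> carrier (UP k)" for n p
      by (rule proj_closed[OF that])
    show "up_proj k d \<pi> n (p \<oplus>\<^bsub>UP k\<^esub> q) = up_proj k d \<pi> n p \<oplus>\<^bsub>UP k\<^esub> up_proj k d \<pi> n q"
      if "p \<in> carrier (UP k)" "q \<in> carrier (UP k)" for n p q
      using that by (intro P.up_eqI) (simp_all add: proj_closed coeff_proj S(6))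
    show "up_proj k d \<pi> n p = p" if "p \<in> up_grading k d H n" for n p
      using that by (intro P.up_eqI) (auto simp: up_grading_def proj_closed coeff_proj S(7))
    show "up_proj k d \<pi> n p = \<zero>\<^bsub>UP k\<^esub>" if "p \<in> up_grading k d H m" "m \<noteq> n" for m n p
      using that(1)
      by (intro P.up_eqI) (auto simp: up_grading_def proj_closed coeff_proj intro!: S(8)[OF _ that(2)])
  qed
  moreover have "\<one>\<^bsub>UP k\<^esub> \<in> up_grading k d H 0"
    using G by (auto simp: up_grading_def graded_ring_def shift_zero S(2) shift_self)
  ultimately show ?thesis using mult by (auto simp: graded_ring_def)
qed

lemma const_in_up_grading:
  assumes "cring k" "graded_ring k H \<pi>" "a \<in> H n"
  shows "monom (UP k) a 0 \<in> up_grading k d H n"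
proof -
  interpret P: UP_cring k "UP k" by (rule UP_cringI) fact
  have "a \<in> carrier k" using assms(2,3) by (auto simp: graded_ring_def graded_projections_def)
  then show ?thesis using assms(3) by (auto simp: up_grading_def shift_def)
qed

lemma variable_in_up_grading:
  assumes "cring k" "graded_ring k H \<pi>"
  shows "monom (UP k) \<one>\<^bsub>k\<^esub> 1 \<in> up_grading k d H d"
proof -
  interpret P: UP_cring k "UP k" by (rule UP_cringI) fact
  show ?thesis using assms(2) by (auto simp: up_grading_def graded_ring_def intro: shift_self)
     (auto simp: shift_def)
qed

definition graded_star_algebra ::
  "('a, 'm) ring_scheme \<Rightarrow> ('i::cancel_comm_monoid_add \<Rightarrow> 'a set) \<Rightarrow> ('a, 'b, 'n) star_algebra_scheme
    \<Rightarrow> ('i \<Rightarrow> 'b set) \<Rightarrow> ('i \<Rightarrow> 'b \<Rightarrow> 'b) \<Rightarrow> bool" where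
  "graded_star_algebra k K B H \<pi> \<longleftrightarrow> graded_projections B H \<pi> \<and> \<one>\<^bsub>B\<^esub> \<in> H 0 \<and>
     (\<forall>m n. \<forall>x\<in>H m. \<forall>y\<in>H n. x \<otimes>\<^bsub>B\<^esub> y \<in> H (m + n)) \<and>
     (\<forall>m n. \<forall>r\<in>K m. \<forall>x\<in>H n. r \<odot>\<^bsub>B\<^esub> x \<in> H (m + n)) \<and>
     (\<forall>n. \<forall>x\<in>H n. star B x \<in> H n)"

lemma graded_star_algebra_base:
  assumes "graded_ring k K \<pi>"
  shows "graded_star_algebra k K (cd_base k) K \<pi>"
  using assms by (auto simp: graded_star_algebra_def graded_ring_def graded_projections_def)

definition cd_grading ::
  "('b, 'n) ring_scheme \<Rightarrow> 'i::cancel_comm_monoid_add \<Rightarrow> ('i \<Rightarrow> 'b set) \<Rightarrow> 'i \<Rightarrow> ('b \<times> 'b) set" where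
  "cd_grading B d H n = H n \<times> shift B d H n"

definition cd_proj ::
  "('b, 'n) ring_scheme \<Rightarrow> 'i::cancel_comm_monoid_add \<Rightarrow> ('i \<Rightarrow> 'b \<Rightarrow> 'b) \<Rightarrow> 'i \<Rightarrow> 'b \<times> 'b \<Rightarrow> 'b \<times> 'b" where
  "cd_proj B d \<pi> n = map_prod (\<pi> n) (shift_proj B d \<pi> n)"

text \<open>
  With \<open>v\<close> of degree \<open>d\<close>, the formula for the product is homogeneous because \<open>\<mu> = v\<^sup>2\<close> has degree \<open>2 d\<close>.
\<close>

lemma graded_star_algebra_cayley_dickson:
  assumes B: "scalar_involution_algebra k B" and G: "graded_star_algebra k K B H \<pi>"
    and K: "\<And>n. K n \<subseteq> carrier k" and mu: "\<mu> \<in> K (d + d)"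
  shows "graded_star_algebra k K (cayley_dickson B \<mu>) (cd_grading B d H) (cd_proj B d \<pi>)"
proof -
  interpret B: scalar_involution_algebra k B by fact
  have [simp]: "\<mu> \<in> carrier k" using K mu by blast
  have Gp: "graded_projections B H \<pi>" using G by (simp add: graded_star_algebra_def)
  note D = graded_projectionsD[OF Gp]
  note S = graded_projectionsD[OF graded_projections_shift[OF B.M.abelian_group_axioms Gp, of d]]
  have one: "\<one>\<^bsub>B\<^esub> \<in> H 0" and mult: "\<And>m n x y. \<lbrakk>x \<in> H m; y \<in> H n\<rbrakk> \<Longrightarrow> x \<otimes>\<^bsub>B\<^esub> y \<in> H (m + n)"
    and smult: "\<And>m n r x. \<lbrakk>r \<in> K m; x \<in> H n\<rbrakk> \<Longrightarrow> r \<odot>\<^bsub>B\<^esub> x \<in> H (m + n)"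
    and star: "\<And>n x. x \<in> H n \<Longrightarrow> star B x \<in> H n"
    using G by (auto simp: graded_star_algebra_def)
  have shift_star: "star B x \<in> shift B d H n" if "x \<in> shift B d H n" for x n
    using that star by (auto simp: shift_iff)
  have shift_smult: "r \<odot>\<^bsub>B\<^esub> x \<in> shift B d H (m + n)" if "r \<in> K m" "x \<in> shift B d H n" for r x m n
    using that smult[of r m] K[of m]
    by (auto simp: shift_iff add.assoc[symmetric] subset_iff)
  have ac: "x \<otimes>\<^bsub>B\<^esub> y \<in> shift B d H (m + n)" if "x \<in> H m" "y \<in> shift B d H n" for x y m n
    using that mult[of x m] D(1)[of x m] by (auto simp: shift_iff add.assoc[symmetric])
  have ca: "y \<otimes>\<^bsub>B\<^esub> x \<in> shift B d H (m + n)" if "y \<in> H n" "x \<in> shift B d H m" for x y m n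
    using ac[OF that] by (simp add: add.commute)
  have bd: "\<mu> \<odot>\<^bsub>B\<^esub> (y \<otimes>\<^bsub>B\<^esub> star B x) \<in> H (m + n)"
    if x: "x \<in> shift B d H m" and y: "y \<in> shift B d H n" for x y m n
  proof (cases "x = \<zero>\<^bsub>B\<^esub> \<or> y = \<zero>\<^bsub>B\<^esub>")
    case True
    then show ?thesis using S(1)[OF x] S(1)[OF y] by (auto simp: D(2))
  next
    case False
    then obtain m' n' where "m = m' + d" "x \<in> H m'" "n = n' + d" "y \<in> H n'"
      using x y by (auto simp: shift_iff)
    then show ?thesis
      using smult[OF mu mult[OF _ star, of y n' x m']] by (simp add: ac_simps)
  qed
  have [simp]: "x \<in> carrier B" if "x \<in> H n" for x n using that D(1) by blast
  have [simp]: "x \<in> carrier B" if "x \<in> shift B d H n" for x n using that S(1) by blast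
  have "graded_projections (cayley_dickson B \<mu>) (cd_grading B d H) (cd_proj B d \<pi>)"
    unfolding graded_projections_def cd_grading_def cd_proj_def
    by (auto simp: D S B.cayley_dickson_neg)
  then show ?thesis
    using one mult smult star shift_smult ac ca bd shift_star
    by (auto simp: graded_star_algebra_def cd_grading_def S D)
qed

section \<open>Homomorphisms and generators\<close>

lemma (in unital_algebra) subalgebra_gen_closed:
  assumes "S \<subseteq> carrier A" shows "subalgebra_gen R A S \<subseteq> carrier A"
proof
  fix x assume "x \<in> subalgebra_gen R A S"
  then show "x \<in> carrier A" by induction (use assms in auto)
qed

lemma algebra_homD:
  assumes "f \<in> algebra_hom R A B"
  shows "x \<in> carrier A \<Longrightarrow> f x \<in> carrier B"
    "\<lbrakk>x \<in> carrier A; y \<in> carrier A\<rbrakk> \<Longrightarrow> f (x \<otimes>\<^bsub>A\<^esub> y) = f x \<otimes>\<^bsub>B\<^esub> f y"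
    "\<lbrakk>x \<in> carrier A; y \<in> carrier A\<rbrakk> \<Longrightarrow> f (x \<oplus>\<^bsub>A\<^esub> y) = f x \<oplus>\<^bsub>B\<^esub> f y"
    "f \<one>\<^bsub>A\<^esub> = \<one>\<^bsub>B\<^esub>" "\<lbrakk>r \<in> carrier R; x \<in> carrier A\<rbrakk> \<Longrightarrow> f (r \<odot>\<^bsub>A\<^esub> x) = r \<odot>\<^bsub>B\<^esub> f x"
  using assms by (auto simp: algebra_hom_def ring_hom_def)

lemma algebra_hom_zero:
  assumes "f \<in> algebra_hom R A B" "unital_algebra R A" "unital_algebra R B"
  shows "f \<zero>\<^bsub>A\<^esub> = \<zero>\<^bsub>B\<^esub>"
proof -
  interpret A: unital_algebra R A by fact
  interpret B: unital_algebra R B by fact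
  show ?thesis
    using algebra_homD(5)[OF assms(1), of "\<zero>\<^bsub>R\<^esub>" "\<zero>\<^bsub>A\<^esub>"] algebra_homD(1)[OF assms(1), of "\<zero>\<^bsub>A\<^esub>"]
    by simp
qed

lemma algebra_hom_inverse_on_generators:
  assumes A: "unital_algebra R A" and f: "f \<in> algebra_hom R A B" and g: "g \<in> algebra_hom R B A"
    and gen: "carrier A = subalgebra_gen R A S" and S: "\<And>s. s \<in> S \<Longrightarrow> g (f s) = s"
    and x: "x \<in> carrier A"
  shows "g (f x) = x"
proof -
  interpret A: unital_algebra R A by fact
  note f = algebra_homD[OF f] and g = algebra_homD[OF g]
  have "x \<in> carrier A \<and> g (f x) = x"
    using x unfolding gen
  proof induction
    case (gen x)
    then show ?case using S by (auto intro: subalgebra_gen.gen)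
  qed (simp_all flip: gen add: f g)
  then show ?thesis by simp
qed

lemma algebra_hom_homogeneous:
  assumes f: "f \<in> algebra_hom R A B" and A: "unital_algebra R A" and B: "unital_algebra R B"
    and g: "\<And>j. g j \<in> carrier A" and fg: "\<And>j. f (g j) = g' j"
    and x: "homogeneous R A g d n x"
  shows "homogeneous R B g' d n (f x)"
proof -
  note D = algebra_homD[OF f] and cl = unital_algebra.homogeneous_closed[OF A _ g]
  show ?thesis using x
  proof induction
    case (zero n) then show ?case by (simp add: algebra_hom_zero[OF f A B] homogeneous.zero)
  next
    case one then show ?case by (simp add: D homogeneous.one)
  next
    case (gen j) then show ?case by (simp add: fg homogeneous.gen)
  next
    case (add n x y) then show ?case using cl[OF add(1)] cl[OF add(2)] by (simp add: D homogeneous.add)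
  next
    case (smult a n x) then show ?case using cl[OF smult(2)] by (simp add: D homogeneous.smult)
  next
    case (mult m x n y) then show ?case using cl[OF mult(1)] cl[OF mult(2)] by (simp add: D homogeneous.mult)
  qed
qed

section \<open>Cayley polynomials\<close>

context
  fixes R :: "('a, 'm) ring_scheme"
  assumes R: "cring R" and half: "\<one>\<^bsub>R\<^esub> \<oplus>\<^bsub>R\<^esub> \<one>\<^bsub>R\<^esub> \<in> Units R"
begin

declare poly3_var.simps [simp del] octonion_gen.simps [simp del]

text \<open>
  \<open>DR\<close> is \<open>D\<close> with the scalars restricted to \<open>R\<close>, and \<open>w\<close> lists the basic generators
  \<open>v\<^sub>1, v\<^sub>2, v\<^sub>3\<close>.
\<close>

abbreviation (input) "C \<equiv> cayley_polys R"
abbreviation (input) "t \<equiv> cayley_gen R"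
abbreviation (input) "P \<equiv> poly3_ring R"
abbreviation (input) "z \<equiv> poly3_var R"
abbreviation (input) "D \<equiv> poly3_octonions R"
abbreviation (input) "DR \<equiv> poly3_octonions_base R"
abbreviation (input) "w \<equiv> poly3_octonion_gen R"
abbreviation (input) "Z \<equiv> C\<lparr>carrier := alt_center C\<rparr>"

interpretation C: alternative_algebra R C
  unfolding cayley_polys_def by (rule presented_alternative[OF R])

lemma cayley_gen_closed: "t j \<in> carrier C"
  by (auto simp: cayley_polys_def cayley_gen_def presented_consts)

text \<open>
  Generation holds because the elements are classes of terms; a negative is the multiple by \<open>-1\<close>.
\<close>

lemma cayley_polys_generated: "carrier C = subalgebra_gen R C (range t)"
proof
  show "subalgebra_gen R C (range t) \<subseteq> carrier C"
    using cayley_gen_closed by (intro C.subalgebra_gen_closed) auto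
  have "alt_class R cayley_relations s \<in> subalgebra_gen R C (range t)" if "s \<in> aterms R" for s
    using that
  proof (induction s)
    case (TGen j)
    then show ?case by (intro subalgebra_gen.gen) (auto simp: cayley_gen_def)
  next
    case TZero
    have "\<zero>\<^bsub>R\<^esub> \<odot>\<^bsub>C\<^esub> \<one>\<^bsub>C\<^esub> \<in> subalgebra_gen R C (range t)"
      by (intro subalgebra_gen.smult subalgebra_gen.one) simp
    then have "\<zero>\<^bsub>C\<^esub> \<in> subalgebra_gen R C (range t)" by simp
    then show ?case by (simp add: cayley_polys_def presented_consts)
  next
    case TOne
    then show ?case
      using subalgebra_gen.one[of C R "range t"] by (simp add: cayley_polys_def presented_consts)
  next
    case (TAdd s1 s2)
    then show ?case
      using subalgebra_gen.add[of _ R C "range t"] by (simp add: cayley_polys_def flip: presented_ops)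
  next
    case (TMult s1 s2)
    then show ?case
      using subalgebra_gen.mult[of _ R C "range t"] by (simp add: cayley_polys_def flip: presented_ops)
  next
    case (TSmult a s)
    then show ?case
      using subalgebra_gen.smult[of a R _ C "range t"] by (simp add: cayley_polys_def flip: presented_ops)
  next
    case (TNeg s)
    let ?x = "alt_class R cayley_relations s"
    have x: "?x \<in> carrier C" using TNeg by (auto simp: cayley_polys_def presented_consts)
    have "alt_class R cayley_relations (TNeg s) = \<ominus>\<^bsub>C\<^esub> ?x"
      using presented_eval[OF R, of "TNeg s" cayley_relations] presented_eval[OF R, of s cayley_relations] TNeg
      by (simp add: cayley_polys_def)
    also have "\<dots> = (\<ominus>\<^bsub>R\<^esub> \<one>\<^bsub>R\<^esub>) \<odot>\<^bsub>C\<^esub> ?x" using x by (simp add: C.smult_l_minus)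
    also have "\<dots> \<in> subalgebra_gen R C (range t)"
      using TNeg by (intro subalgebra_gen.smult) auto
    finally show ?case .
  qed
  then show "carrier C \<subseteq> subalgebra_gen R C (range t)"
    by (auto simp: cayley_polys_def presented_consts)
qed

lemma range_gen3: "range f = {f G1, f G2, f G3}"
  by (auto intro: gen3.exhaust) (metis gen3.exhaust)

lemma cayley_gen_triple: "C.cayley_triple (t G1) (t G2) (t G3)"
proof -
  have rel: "aterm_eval C t s = aterm_eval C t s'"
    if "(s, s') \<in> cayley_relations" "s \<in> aterms R" "s' \<in> aterms R" for s s'
    using presented_relation[OF R that] by (simp add: cayley_polys_def cayley_gen_def[abs_def])
  show ?thesis
    unfolding C.cayley_triple_def
    using rel[of "TMult (TGen G2) (TGen G1)" "TNeg (TMult (TGen G1) (TGen G2))"]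
      rel[of "TMult (TGen G3) (TGen G1)" "TNeg (TMult (TGen G1) (TGen G3))"]
      rel[of "TMult (TGen G3) (TGen G2)" "TNeg (TMult (TGen G2) (TGen G3))"]
      rel[of "TMult (TMult (TGen G1) (TGen G2)) (TGen G3)" "TNeg (TMult (TGen G1) (TMult (TGen G2) (TGen G3)))"]
    by (simp add: cayley_relations_def Let_def cayley_gen_closed)
qed

lemma cayley_gen_sq_central: "cayley_gen_sq R j \<in> alt_center C"
proof -
  note t = cayley_gen_triple
  have 1: "t G1 \<otimes>\<^bsub>C\<^esub> t G1 \<in> alt_center C"
    by (rule C.cayley_triple_square_central[OF half t]) (simp add: cayley_polys_generated range_gen3)
  have 2: "t G2 \<otimes>\<^bsub>C\<^esub> t G2 \<in> alt_center C"
    by (rule C.cayley_triple_square_central[OF half C.cayley_triple_swap_left[OF t]])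
      (simp add: cayley_polys_generated range_gen3 insert_commute)
  have 3: "t G3 \<otimes>\<^bsub>C\<^esub> t G3 \<in> alt_center C"
    by (rule C.cayley_triple_square_central[OF half C.cayley_triple_swap_left[OF C.cayley_triple_swap_right[OF t]]])
      (simp add: cayley_polys_generated range_gen3 insert_commute)
  show ?thesis using 1 2 3 by (cases j) (simp_all add: cayley_gen_sq_def)
qed

lemma poly3_octonion_constants: "octonion_constants P (z G1) (z G2) (z G3)"
  by (intro octonion_constantsI poly3_ring_cring[OF R] poly3_var_cancellable[OF R]
      ring_hom_preserves_half[OF R poly3_ring_cring[OF R] poly3_const_hom[OF R] half])

interpretation O: octonion_process P "z G1" "z G2" "z G3"
  by unfold_locales (rule poly3_octonion_constants)

lemma D_eq: "D = octonions P (z G1) (z G2) (z G3)"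
  by (simp add: poly3_octonions_def)

lemma w_eq: "w = octonion_gen P (z G1) (z G2)"
  by (simp add: poly3_octonion_gen_def)

lemma D_alternative: "alternative_algebra P D"
  unfolding D_eq by (rule O.alternative_algebra_axioms)

interpretation D: alternative_algebra P D by (rule D_alternative)

interpretation DR: alternative_algebra R DR
  unfolding poly3_octonions_base_def
  by (rule alternative_algebra_restrict_scalars[OF D_alternative R poly3_const_hom[OF R]])

lemma DR_simps:
  "carrier DR = carrier D" "mult DR = mult D" "\<one>\<^bsub>DR\<^esub> = \<one>\<^bsub>D\<^esub>" "\<zero>\<^bsub>DR\<^esub> = \<zero>\<^bsub>D\<^esub>" "add DR = add D"
  "r \<odot>\<^bsub>DR\<^esub> x = poly3_const R r \<odot>\<^bsub>D\<^esub> x" "a_inv DR = a_inv D"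
  by (simp_all add: poly3_octonions_base_def)

lemma w_closed: "w j \<in> carrier D"
  unfolding w_eq D_eq by (rule O.gen_closed)

text \<open>
  The polynomial scalars are not given in advance but arise from \<open>z\<^sub>j = v\<^sub>j\<^sup>2\<close>.
\<close>

lemma DR_generated: "carrier DR = subalgebra_gen R DR (range w)" (is "_ = ?S")
proof
  show "?S \<subseteq> carrier DR"
    using w_closed by (intro DR.subalgebra_gen_closed) (auto simp: DR_simps)
  have gen: "w j \<in> ?S" for j by (intro subalgebra_gen.gen) auto
  have add: "x \<oplus>\<^bsub>D\<^esub> y \<in> ?S" and mult: "x \<otimes>\<^bsub>D\<^esub> y \<in> ?S" if "x \<in> ?S" "y \<in> ?S" for x y
    using subalgebra_gen.add[OF that] subalgebra_gen.mult[OF that] by (simp_all add: DR_simps)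
  have "carrier P \<subseteq> {p \<in> carrier P. p \<odot>\<^bsub>D\<^esub> \<one>\<^bsub>D\<^esub> \<in> ?S}"
  proof (rule poly3_generated[OF R])
    show "poly3_const R a \<in> {p \<in> carrier P. p \<odot>\<^bsub>D\<^esub> \<one>\<^bsub>D\<^esub> \<in> ?S}" if "a \<in> carrier R" for a
      using subalgebra_gen.smult[OF that subalgebra_gen.one, of DR "range w"]
        ring_hom_closed[OF poly3_const_hom[OF R] that] by (simp add: DR_simps)
    show "z j \<in> {p \<in> carrier P. p \<odot>\<^bsub>D\<^esub> \<one>\<^bsub>D\<^esub> \<in> ?S}" for j
      using mult[OF gen gen, of j j] O.gen_square poly3_var_closed[OF R, of j]
      by (cases j) (simp_all add: w_eq D_eq)
    show "p \<oplus>\<^bsub>P\<^esub> q \<in> {p \<in> carrier P. p \<odot>\<^bsub>D\<^esub> \<one>\<^bsub>D\<^esub> \<in> ?S}"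
      if "p \<in> {p \<in> carrier P. p \<odot>\<^bsub>D\<^esub> \<one>\<^bsub>D\<^esub> \<in> ?S}" "q \<in> {p \<in> carrier P. p \<odot>\<^bsub>D\<^esub> \<one>\<^bsub>D\<^esub> \<in> ?S}" for p q
      using that add by (simp add: D.smult_l_distr)
    show "p \<otimes>\<^bsub>P\<^esub> q \<in> {p \<in> carrier P. p \<odot>\<^bsub>D\<^esub> \<one>\<^bsub>D\<^esub> \<in> ?S}"
      if "p \<in> {p \<in> carrier P. p \<odot>\<^bsub>D\<^esub> \<one>\<^bsub>D\<^esub> \<in> ?S}" "q \<in> {p \<in> carrier P. p \<odot>\<^bsub>D\<^esub> \<one>\<^bsub>D\<^esub> \<in> ?S}" for p q
    proof -
      have "(p \<otimes>\<^bsub>P\<^esub> q) \<odot>\<^bsub>D\<^esub> \<one>\<^bsub>D\<^esub> = (p \<odot>\<^bsub>D\<^esub> \<one>\<^bsub>D\<^esub>) \<otimes>\<^bsub>D\<^esub> (q \<odot>\<^bsub>D\<^esub> \<one>\<^bsub>D\<^esub>)"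
        using that by (simp add: D.mult_smult_left D.smult_assoc1)
      then show ?thesis using that mult by simp
    qed
  qed
  then show "carrier DR \<subseteq> ?S"
    unfolding DR_simps unfolding D_eq
    by (intro O.octonions_generated) (use gen add mult in \<open>auto simp: D_eq w_eq\<close>)
qed

lemma scalar_hom: "(\<lambda>r. r \<odot>\<^bsub>C\<^esub> \<one>\<^bsub>C\<^esub>) \<in> ring_hom R Z"
  by (auto simp: ring_hom_def C.smult_one_central C.smult_l_distr C.mult_smult_left C.smult_assoc1)

text \<open>
  The universal property of the presentation gives \<open>\<phi>\<close>, since the generators of \<open>D\<close> satisfy the
  Cayley relations.  In the other direction the squares of the generators \<open>t\<^sub>j\<close> are central, so
  \<open>z\<^sub>j \<mapsto> t\<^sub>j\<^sup>2\<close> defines a homomorphism \<open>e\<close> from the polynomial ring to the center.  Through \<open>e\<close> the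
  Cayley polynomials become an algebra over the polynomial ring, and \<open>octonion_extension\<close> gives
  \<open>\<psi>\<close>.  Both composites fix generators, hence everything.
\<close>

lemma cayley_polys_isomorphism:
  obtains e \<phi> \<psi> where "e \<in> ring_hom P Z" "\<And>a. a \<in> carrier R \<Longrightarrow> e (poly3_const R a) = a \<odot>\<^bsub>C\<^esub> \<one>\<^bsub>C\<^esub>"
    "\<And>j. e (z j) = cayley_gen_sq R j"
    "\<phi> \<in> algebra_hom R C DR" "\<And>j. \<phi> (t j) = w j"
    "\<psi> \<in> algebra_hom R DR C" "\<And>j. \<psi> (w j) = t j"
    "\<And>p. p \<in> carrier P \<Longrightarrow> \<psi> (p \<odot>\<^bsub>D\<^esub> \<one>\<^bsub>D\<^esub>) = e p"
    "\<And>x. x \<in> carrier C \<Longrightarrow> \<psi> (\<phi> x) = x" "\<And>x. x \<in> carrier D \<Longrightarrow> \<phi> (\<psi> x) = x"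
proof -
  have "\<exists>!f. f \<in> extensional (carrier (presented_alt_algebra R cayley_relations)) \<and>
      f \<in> algebra_hom R (presented_alt_algebra R cayley_relations) DR \<and>
      (\<forall>j. f (alt_class R cayley_relations (TGen j)) = w j)"
  proof (rule presented_universal[OF R DR.alternative_algebra_axioms])
    show "w j \<in> carrier DR" for j by (simp add: DR_simps w_closed)
    show "aterm_eval DR w s = aterm_eval DR w s'" if "(s, s') \<in> cayley_relations" for s s'
      using that O.gen_cayley_triple unfolding O.cayley_triple_def cayley_relations_def
      by (auto simp: Let_def DR_simps D_eq w_eq)
  qed
  then obtain \<phi> where phi: "\<phi> \<in> algebra_hom R C DR" "\<And>j. \<phi> (t j) = w j"
    by (auto simp: cayley_polys_def cayley_gen_def)
  have sq: "cayley_gen_sq R j \<in> carrier Z" for j by (simp add: cayley_gen_sq_central)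
  obtain e where e: "e \<in> ring_hom P Z" "\<And>a. a \<in> carrier R \<Longrightarrow> e (poly3_const R a) = a \<odot>\<^bsub>C\<^esub> \<one>\<^bsub>C\<^esub>"
    "\<And>j. e (z j) = cayley_gen_sq R j"
    using poly3_eval[OF R C.center_cring scalar_hom, of "cayley_gen_sq R", OF sq] by metis
  let ?A = "restrict_scalars e (self_algebra C)"
  interpret A: alternative_algebra P ?A
    by (rule alternative_algebra_restrict_scalars[OF C.alternative_algebra_over_center
          poly3_ring_cring[OF R] e(1)])
  have "A.cayley_triple (t G1) (t G2) (t G3)"
    using cayley_gen_triple unfolding A.cayley_triple_def C.cayley_triple_def by simp
  then obtain \<psi> where psi: "\<psi> \<in> algebra_hom P D ?A" "\<psi> (w G1) = t G1" "\<psi> (w G2) = t G2" "\<psi> (w G3) = t G3"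
    unfolding D_eq w_eq
    by (rule A.octonion_extension[OF poly3_octonion_constants])
      (simp_all add: e(3) cayley_gen_sq_def cayley_gen_closed)
  have psi_w: "\<psi> (w j) = t j" for j using psi by (cases j) simp_all
  note psiD = algebra_homD[OF psi(1)]
  have e_closed: "e p \<in> carrier C" if "p \<in> carrier P" for p
    using ring_hom_closed[OF e(1) that] C.alt_centerD(1) by simp
  have psi_hom: "\<psi> \<in> algebra_hom R DR C"
    using psiD ring_hom_closed[OF poly3_const_hom[OF R]]
    by (auto simp: algebra_hom_def ring_hom_def DR_simps e(2) C.mult_smult_left)
  show ?thesis
  proof (rule that[OF e phi psi_hom psi_w])
    show "\<psi> (p \<odot>\<^bsub>D\<^esub> \<one>\<^bsub>D\<^esub>) = e p" if "p \<in> carrier P" for p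
      using psiD that e_closed by simp
    show "\<psi> (\<phi> x) = x" if "x \<in> carrier C" for x
      by (rule algebra_hom_inverse_on_generators[OF C.unital_algebra_axioms phi(1) psi_hom
            cayley_polys_generated _ that]) (auto simp: phi psi_w)
    show "\<phi> (\<psi> x) = x" if "x \<in> carrier D" for x
      by (rule algebra_hom_inverse_on_generators[OF DR.unital_algebra_axioms psi_hom phi(1)
            DR_generated]) (use that in \<open>auto simp: phi psi_w DR_simps\<close>)
  qed
qed

text \<open>
  The isomorphism matches the centers, and the center of \<open>D\<close> consists of the scalars.
\<close>

lemma cayley_polys_center:
  assumes e: "e \<in> ring_hom P Z" and phi: "\<phi> \<in> algebra_hom R C DR" and psi: "\<psi> \<in> algebra_hom R DR C"
    and psi_e: "\<And>p. p \<in> carrier P \<Longrightarrow> \<psi> (p \<odot>\<^bsub>D\<^esub> \<one>\<^bsub>D\<^esub>) = e p"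
    and inv: "\<And>x. x \<in> carrier C \<Longrightarrow> \<psi> (\<phi> x) = x" "\<And>x. x \<in> carrier D \<Longrightarrow> \<phi> (\<psi> x) = x"
  shows "alt_center C = e ` carrier P"
proof
  show "e ` carrier P \<subseteq> alt_center C" using ring_hom_closed[OF e] by auto
  note f = algebra_homD[OF phi, unfolded DR_simps] and g = algebra_homD[OF psi, unfolded DR_simps]
  show "alt_center C \<subseteq> e ` carrier P"
  proof
    fix x assume x: "x \<in> alt_center C"
    note xD = C.alt_centerD[OF x]
    have "\<phi> x \<in> alt_center D"
    proof (rule D.alt_centerI)
      show "\<phi> x \<in> carrier D" using xD(1) by (rule f(1))
      show "\<phi> x \<otimes>\<^bsub>D\<^esub> y = y \<otimes>\<^bsub>D\<^esub> \<phi> x" if "y \<in> carrier D" for y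
        using xD(1) xD(2)[OF g(1)[OF that]] f(2)[of x "\<psi> y"] f(2)[of "\<psi> y" x] g(1)[OF that] inv(2)[OF that]
        by simp
      show "(\<phi> x \<otimes>\<^bsub>D\<^esub> y) \<otimes>\<^bsub>D\<^esub> y' = \<phi> x \<otimes>\<^bsub>D\<^esub> (y \<otimes>\<^bsub>D\<^esub> y')" if "y \<in> carrier D" "y' \<in> carrier D" for y y'
        using xD(1) arg_cong[OF xD(3)[OF g(1)[OF that(1)] g(1)[OF that(2)]], of \<phi>] that
        by (simp add: f(2) g(1) inv(2) C.mult_closed)
    qed
    then obtain p where p: "p \<in> carrier P" "\<phi> x = p \<odot>\<^bsub>D\<^esub> \<one>\<^bsub>D\<^esub>"
      using O.octonion_center by (auto simp: D_eq)
    then have "x = e p" using inv(1)[OF xD(1)] psi_e[OF p(1)] by simp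
    then show "x \<in> e ` carrier P" using p(1) by blast
  qed
qed

lemma cayley_polys_center_generated:
  assumes e: "e \<in> ring_hom P Z" and const: "\<And>a. a \<in> carrier R \<Longrightarrow> e (poly3_const R a) = a \<odot>\<^bsub>C\<^esub> \<one>\<^bsub>C\<^esub>"
    and var: "\<And>j. e (z j) = cayley_gen_sq R j" and center: "alt_center C = e ` carrier P"
  shows "alt_center C = subalgebra_gen R C (range (cayley_gen_sq R))" (is "_ = ?S")
proof
  have "carrier P \<subseteq> {p \<in> carrier P. e p \<in> ?S}"
  proof (rule poly3_generated[OF R])
    show "poly3_const R a \<in> {p \<in> carrier P. e p \<in> ?S}" if "a \<in> carrier R" for a
      using subalgebra_gen.smult[OF that subalgebra_gen.one, of C "range (cayley_gen_sq R)"]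
        ring_hom_closed[OF poly3_const_hom[OF R] that] that by (simp add: const)
    show "z j \<in> {p \<in> carrier P. e p \<in> ?S}" for j
      using poly3_var_closed[OF R] by (auto simp: var intro: subalgebra_gen.gen)
    show "p \<oplus>\<^bsub>P\<^esub> q \<in> {p \<in> carrier P. e p \<in> ?S}" "p \<otimes>\<^bsub>P\<^esub> q \<in> {p \<in> carrier P. e p \<in> ?S}"
      if "p \<in> {p \<in> carrier P. e p \<in> ?S}" "q \<in> {p \<in> carrier P. e p \<in> ?S}" for p q
      using that ring_hom_add[OF e] ring_hom_mult[OF e]
      by (auto intro: subalgebra_gen.add subalgebra_gen.mult)
  qed
  then show "alt_center C \<subseteq> ?S" using center by auto
  show "?S \<subseteq> alt_center C"
  proof
    fix x assume "x \<in> ?S"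
    then show "x \<in> alt_center C"
      by induction (auto simp: cayley_gen_sq_central C.one_in_center C.add_in_center C.mult_in_center
        C.smult_in_center)
  qed
qed

lemma poly3_algebra_iso_center:
  assumes e: "e \<in> ring_iso P Z" and const: "\<And>a. a \<in> carrier R \<Longrightarrow> e (poly3_const R a) = a \<odot>\<^bsub>C\<^esub> \<one>\<^bsub>C\<^esub>"
  shows "e \<in> algebra_iso R (poly3_algebra R) Z"
proof -
  have hom: "e \<in> ring_hom P Z" using e by (simp add: ring_iso_def)
  have "e (poly3_const R a \<otimes>\<^bsub>P\<^esub> p) = a \<odot>\<^bsub>C\<^esub> e p" if "a \<in> carrier R" "p \<in> carrier P" for a p
    using ring_hom_mult[OF hom ring_hom_closed[OF poly3_const_hom[OF R]]] that
      C.alt_centerD(1)[of "e p"] ring_hom_closed[OF hom]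
    by (simp add: const C.mult_smult_left)
  then show ?thesis
    using e by (simp add: algebra_iso_def algebra_hom_def poly3_algebra_def ring_iso_def ring_hom_def)
qed

text \<open>
  The isomorphism \<open>e\<close> of the scalar rings carries \<open>D\<close> to the octonion algebra with constants
  \<open>e z\<^sub>j = t\<^sub>j\<^sup>2\<close> over the center; composed with \<open>\<phi>\<close> it is linear over the center.
\<close>

lemma cayley_polys_octonion_algebra_over_center:
  assumes e: "e \<in> ring_iso P Z" and var: "\<And>j. e (z j) = cayley_gen_sq R j"
    and phi: "\<phi> \<in> ring_iso C D" and phi_e: "\<And>p. p \<in> carrier P \<Longrightarrow> \<phi> (e p) = p \<odot>\<^bsub>D\<^esub> \<one>\<^bsub>D\<^esub>"
  shows "is_octonion_algebra Z (cayley_gen_sq R G1) (cayley_gen_sq R G2) (cayley_gen_sq R G3) (self_algebra C)"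
proof -
  have hom: "e \<in> ring_hom P Z" and bij: "bij_betw e (carrier P) (alt_center C)"
    using e by (auto simp: ring_iso_def)
  interpret e: ring_hom_cring P Z e
    by (rule ring_hom_cringI[OF poly3_ring_cring[OF R] C.center_cring hom])
  have cancel: "cancellable_scalar Z (cd_base Z) (cayley_gen_sq R j)" for j
    unfolding cancellable_scalar_def cd_base_simps
  proof (intro conjI ballI impI)
    show "cayley_gen_sq R j \<in> carrier Z" by (simp add: cayley_gen_sq_central)
    fix b assume b: "b \<in> carrier Z" and zero: "cayley_gen_sq R j \<otimes>\<^bsub>Z\<^esub> b = \<zero>\<^bsub>Z\<^esub>"
    obtain p where p: "p \<in> carrier P" "b = e p" using bij b by (auto simp: bij_betw_def)
    have zp: "z j \<otimes>\<^bsub>P\<^esub> p \<in> carrier P" using p poly3_var_closed[OF R] by simp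
    have "e (z j \<otimes>\<^bsub>P\<^esub> p) = e \<zero>\<^bsub>P\<^esub>"
      using zero p poly3_var_closed[OF R, of j] by (simp only: e.hom_mult var e.hom_zero)
    then have "z j \<otimes>\<^bsub>P\<^esub> p = \<zero>\<^bsub>P\<^esub>"
      using bij zp unfolding bij_betw_def by (metis O.B0.R.zero_closed inj_onD)
    then have "p = \<zero>\<^bsub>P\<^esub>"
      using poly3_var_cancellable[OF R, of j] p(1) unfolding cancellable_scalar_def cd_base_simps by blast
    then show "b = \<zero>\<^bsub>Z\<^esub>" using p(2) e.hom_zero by simp
  qed
  have oc: "octonion_constants Z (cayley_gen_sq R G1) (cayley_gen_sq R G2) (cayley_gen_sq R G3)"
    by (intro octonion_constantsI C.center_cring cancel
        ring_hom_preserves_half[OF R C.center_cring scalar_hom half])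
  obtain h where h: "semilinear_star_iso P e D
      (octonions Z (cayley_gen_sq R G1) (cayley_gen_sq R G2) (cayley_gen_sq R G3)) h"
    using octonions_functorial[OF poly3_octonion_constants _ e] oc by (auto simp: var D_eq)
  let ?O = "octonions Z (cayley_gen_sq R G1) (cayley_gen_sq R G2) (cayley_gen_sq R G3)"
  have hiso: "h \<in> ring_iso D ?O" and hs: "\<And>r x. r \<in> carrier P \<Longrightarrow> x \<in> carrier D \<Longrightarrow> h (r \<odot>\<^bsub>D\<^esub> x) = e r \<odot>\<^bsub>?O\<^esub> h x"
    using h by (auto simp: semilinear_star_iso_def)
  have iso: "h \<circ> \<phi> \<in> ring_iso C ?O"
    by (rule ring_iso_set_trans[OF phi hiso])
  have phi_hom: "\<phi> \<in> ring_hom C D" using phi by (simp add: ring_iso_def)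
  have "h (\<phi> (c \<otimes>\<^bsub>C\<^esub> x)) = c \<odot>\<^bsub>?O\<^esub> h (\<phi> x)" if c: "c \<in> carrier Z" and x: "x \<in> carrier C" for c x
  proof -
    obtain p where p: "p \<in> carrier P" "c = e p" using bij c by (auto simp: bij_betw_def)
    have "\<phi> (c \<otimes>\<^bsub>C\<^esub> x) = p \<odot>\<^bsub>D\<^esub> \<phi> x"
      using ring_hom_mult[OF phi_hom _ x, of c] C.alt_centerD(1)[of c] c p(1) ring_hom_closed[OF phi_hom x]
      by (simp add: p(2) phi_e D.mult_smult_left)
    then show ?thesis using hs[OF p(1) ring_hom_closed[OF phi_hom x]] p(2) by simp
  qed
  then have "h \<circ> \<phi> \<in> algebra_iso Z (self_algebra C) ?O"
    using iso by (auto simp: algebra_iso_def algebra_hom_def ring_iso_def ring_hom_def)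
  then show ?thesis using oc by (auto simp: is_octonion_algebra_def)
qed

lemma graded_poly3_ring:
  fixes d1 d2 d3 :: "'i::cancel_comm_monoid_add"
  obtains K \<kappa> where "graded_ring P K \<kappa>" "\<And>a. a \<in> carrier R \<Longrightarrow> poly3_const R a \<in> K 0"
    "z G1 \<in> K d1" "z G2 \<in> K d2" "z G3 \<in> K d3"
proof -
  define K0 where "K0 = (\<lambda>n::'i. if n = 0 then carrier R else {\<zero>\<^bsub>R\<^esub>})"
  define K1 where "K1 = up_grading R d1 K0"
  define K2 where "K2 = up_grading (UP R) d2 K1"
  define K3 where "K3 = up_grading (UP (UP R)) d3 K2"
  note c1 = UP_cring.UP_cring[OF UP_cringI[OF R]]
  note c2 = UP_cring.UP_cring[OF UP_cringI[OF c1]]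
  have g0: "graded_ring R K0 (\<lambda>n x. if n = 0 then x else \<zero>\<^bsub>R\<^esub>)"
    unfolding K0_def by (rule graded_ring_trivial[OF R])
  note g1 = graded_ring_UP[OF R g0, of d1, folded K1_def]
  note g2 = graded_ring_UP[OF c1 g1, of d2, folded K2_def]
  note g3 = graded_ring_UP[OF c2 g2, of d3, folded K3_def]
  note const1 = const_in_up_grading[OF R g0, of _ _ d1, folded K1_def]
  note const2 = const_in_up_grading[OF c1 g1, of _ _ d2, folded K2_def]
  note const3 = const_in_up_grading[OF c2 g2, of _ _ d3, folded K3_def]
  show ?thesis
  proof (rule that)
    show "graded_ring P K3 (up_proj (UP (UP R)) d3 (up_proj (UP R) d2 (up_proj R d1 (\<lambda>n x. if n = 0 then x else \<zero>\<^bsub>R\<^esub>))))"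
      using g3 by (simp add: poly3_ring_def)
    show "poly3_const R a \<in> K3 0" if "a \<in> carrier R" for a
      unfolding poly3_const_def using that by (intro const3 const2 const1) (simp add: K0_def)
    show "z G1 \<in> K3 d1"
      unfolding poly3_var.simps
      by (intro const3 const2 variable_in_up_grading[OF R g0, of d1, folded K1_def])
    show "z G2 \<in> K3 d2"
      unfolding poly3_var.simps
      by (intro const3 variable_in_up_grading[OF c1 g1, of d2, folded K2_def])
    show "z G3 \<in> K3 d3"
      unfolding poly3_var.simps
      by (rule variable_in_up_grading[OF c2 g2, of d3, folded K3_def])
  qed
qed

lemma cd_embed_graded: "x \<in> H n \<Longrightarrow> cd_embed B x \<in> cd_grading B d H n"
  by (simp add: cd_embed_def cd_grading_def shift_iff)

lemma cd_generator_graded: "\<lbrakk>\<zero>\<^bsub>B\<^esub> \<in> H d; \<one>\<^bsub>B\<^esub> \<in> H 0\<rbrakk> \<Longrightarrow> cd_generator B \<in> cd_grading B d H d"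
  by (simp add: cd_generator_def cd_grading_def shift_self)

lemma graded_star_algebra_units:
  assumes "graded_star_algebra k K B H \<pi>"
  shows "\<zero>\<^bsub>B\<^esub> \<in> H n" "\<one>\<^bsub>B\<^esub> \<in> H 0"
  using assms unfolding graded_star_algebra_def by (auto dest: graded_projectionsD(2))

text \<open>
  Here \<open>z\<^sub>j\<close> is given the degree \<open>d\<^sub>j + d\<^sub>j\<close>, because it is the square of the generator \<open>v\<^sub>j\<close> of degree
  \<open>d\<^sub>j\<close>.
\<close>

lemma poly3_octonions_graded_projections:
  obtains H \<pi> where "graded_projections D H \<pi>" "\<And>n x. homogeneous R DR w deg3 n x \<Longrightarrow> x \<in> H n"
proof -
  define d where "d = deg3"
  obtain K \<kappa> where K: "graded_ring P K \<kappa>" and const: "\<And>a. a \<in> carrier R \<Longrightarrow> poly3_const R a \<in> K 0"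
    and var: "z G1 \<in> K (d G1 + d G1)" "z G2 \<in> K (d G2 + d G2)" "z G3 \<in> K (d G3 + d G3)"
    using graded_poly3_ring[of "d G1 + d G1" "d G2 + d G2" "d G3 + d G3"] by metis
  have Kc: "K n \<subseteq> carrier P" for n using K unfolding graded_ring_def by (blast dest: graded_projectionsD(1))
  let ?B0 = "cd_base P" and ?B1 = "cd1 P (z G1)" and ?B2 = "cd2 P (z G1) (z G2)"
  define H1 where "H1 = cd_grading ?B0 (d G1) K"
  define H2 where "H2 = cd_grading ?B1 (d G2) H1"
  define H3 where "H3 = cd_grading ?B2 (d G3) H2"
  note g0 = graded_star_algebra_base[OF K]
  note g1 = graded_star_algebra_cayley_dickson[OF O.B0.scalar_involution_algebra_axioms g0 Kc var(1), folded H1_def]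
  note g2 = graded_star_algebra_cayley_dickson[OF O.B1.scalar_involution_algebra_axioms g1 Kc var(2), folded H2_def]
  note g3 = graded_star_algebra_cayley_dickson[OF O.B2.scalar_involution_algebra_axioms g2 Kc var(3), folded H3_def]
  note units = graded_star_algebra_units[OF g0] graded_star_algebra_units[OF g1]
    graded_star_algebra_units[OF g2]
  have w: "w j \<in> H3 (d j)" for j
    unfolding H1_def H2_def H3_def w_eq
    by (cases j; simp only: octonion_gen.simps;
      intro cd_embed_graded cd_generator_graded units[unfolded H1_def H2_def])
  note g3' = g3[unfolded graded_star_algebra_def, folded octonions_def, folded D_eq]
  show ?thesis
  proof (rule that)
    show "graded_projections D H3 (cd_proj ?B2 (d G3) (cd_proj ?B1 (d G2) (cd_proj ?B0 (d G1) \<kappa>)))"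
      using g3' by blast
    then have zero3: "\<zero>\<^bsub>D\<^esub> \<in> H3 n" "\<lbrakk>x \<in> H3 n; y \<in> H3 n\<rbrakk> \<Longrightarrow> x \<oplus>\<^bsub>D\<^esub> y \<in> H3 n" for x y n
      by (blast dest: graded_projectionsD)+
    show "x \<in> H3 n" if "homogeneous R DR w deg3 n x" for n x
      using that
    proof induction
      case (smult a n x)
      then have "poly3_const R a \<odot>\<^bsub>D\<^esub> x \<in> H3 (0 + n)" using g3' const by blast
      then show ?case by (simp add: DR_simps)
    next
      case (mult m x n y)
      then have "x \<otimes>\<^bsub>D\<^esub> y \<in> H3 (m + n)" using g3' by blast
      then show ?case by (simp add: DR_simps)
    next
      case one
      then show ?case using g3' by (simp add: DR_simps)
    next
      case (gen j)
      then show ?case using w[of j] by (simp add: d_def)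
    qed (simp_all add: DR_simps zero3)
  qed
qed

text \<open>
  Projections of \<open>D\<close> composed with \<open>\<phi>\<close> serve as projections of the Cayley polynomials, so both
  gradings come from the same family.
\<close>

lemma cayley_polys_graded_isomorphic:
  assumes phi: "\<phi> \<in> algebra_hom R C DR" "\<And>j. \<phi> (t j) = w j"
    and psi: "\<psi> \<in> algebra_hom R DR C" "\<And>j. \<psi> (w j) = t j"
    and inv: "\<And>x. x \<in> carrier C \<Longrightarrow> \<psi> (\<phi> x) = x" "\<And>x. x \<in> carrier D \<Longrightarrow> \<phi> (\<psi> x) = x"
    and iso: "\<phi> \<in> algebra_iso R C DR"
  shows "graded_isomorphic R C (component R C t deg3) DR (component R DR w deg3)"
proof -
  obtain H \<pi> where G: "graded_projections D H \<pi>" and H: "\<And>n x. homogeneous R DR w deg3 n x \<Longrightarrow> x \<in> H n"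
    using poly3_octonions_graded_projections by metis
  note GD = graded_projectionsD[OF G]
  have w: "w j \<in> carrier DR" for j by (simp add: DR_simps w_closed)
  note f = algebra_homD[OF phi(1)]
  have fwd: "homogeneous R DR w deg3 n (\<phi> x)" if "homogeneous R C t deg3 n x" for n x
    by (rule algebra_hom_homogeneous[OF phi(1) C.unital_algebra_axioms DR.unital_algebra_axioms
          cayley_gen_closed phi(2) that])
  have bwd: "homogeneous R C t deg3 n (\<psi> x)" if "homogeneous R DR w deg3 n x" for n x
    by (rule algebra_hom_homogeneous[OF psi(1) DR.unital_algebra_axioms C.unital_algebra_axioms
          w psi(2) that])
  have "algebra_grading R DR (component R DR w deg3)"
  proof (rule DR.algebra_grading_by_projections[where \<pi> = \<pi> and N = D])
    show "x = \<zero>\<^bsub>DR\<^esub>" if "homogeneous R DR w deg3 n x" "\<pi> n x = \<zero>\<^bsub>D\<^esub>" for n x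
      using GD(7)[OF H[OF that(1)]] that(2) by (simp add: DR_simps)
  qed (use GD(5,6) GD(8)[OF H] D.M.abelian_group_axioms DR_generated w in \<open>auto simp: DR_simps\<close>)
  moreover have "algebra_grading R C (component R C t deg3)"
  proof (rule C.algebra_grading_by_projections[where \<pi> = "\<lambda>n x. \<pi> n (\<phi> x)" and N = D])
    show "x = \<zero>\<^bsub>C\<^esub>" if "homogeneous R C t deg3 n x" "\<pi> n (\<phi> x) = \<zero>\<^bsub>D\<^esub>" for n x
    proof -
      have "\<phi> x = \<zero>\<^bsub>DR\<^esub>" using GD(7)[OF H[OF fwd[OF that(1)]]] that(2) by (simp add: DR_simps)
      then show ?thesis
        using inv(1)[OF C.homogeneous_closed[OF that(1) cayley_gen_closed]]
          algebra_hom_zero[OF psi(1) DR.unital_algebra_axioms C.unital_algebra_axioms] by simp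
    qed
  qed (use GD(5,6) GD(8)[OF H[OF fwd]] D.M.abelian_group_axioms cayley_polys_generated
      cayley_gen_closed f in \<open>auto simp: DR_simps\<close>)
  moreover have "\<phi> ` component R C t deg3 n = component R DR w deg3 n" for n
  proof
    show "\<phi> ` component R C t deg3 n \<subseteq> component R DR w deg3 n"
      unfolding component_def using fwd by blast
    show "component R DR w deg3 n \<subseteq> \<phi> ` component R C t deg3 n"
    proof
      fix x assume "x \<in> component R DR w deg3 n"
      then have x: "homogeneous R DR w deg3 n x" by (simp add: component_def)
      then have "x = \<phi> (\<psi> x)"
        using inv(2) DR.homogeneous_closed[OF x w] by (simp add: DR_simps)
      with bwd[OF x] show "x \<in> \<phi> ` component R C t deg3 n" unfolding component_def by blast
    qed
  qed
  ultimately show ?thesis using iso by (auto simp: graded_isomorphic_def)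
qed

lemma cayley_polys_structure:
  "(octonion_constants P (z G1) (z G2) (z G3)) \<and>
    (graded_isomorphic R C (component R C t deg3) DR (component R DR w deg3)) \<and>
    (alt_center C = subalgebra_gen R C (range (cayley_gen_sq R))) \<and>
    (\<exists>f\<in>algebra_iso R (poly3_algebra R) Z. \<forall>j. f (z j) = cayley_gen_sq R j) \<and>
    (is_octonion_algebra Z (cayley_gen_sq R G1) (cayley_gen_sq R G2) (cayley_gen_sq R G3) (self_algebra C))"
proof -
  obtain e \<phi> \<psi> where e: "e \<in> ring_hom P Z" "\<And>a. a \<in> carrier R \<Longrightarrow> e (poly3_const R a) = a \<odot>\<^bsub>C\<^esub> \<one>\<^bsub>C\<^esub>"
      "\<And>j. e (z j) = cayley_gen_sq R j"
    and phi: "\<phi> \<in> algebra_hom R C DR" "\<And>j. \<phi> (t j) = w j"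
    and psi: "\<psi> \<in> algebra_hom R DR C" "\<And>j. \<psi> (w j) = t j"
    and psi_e: "\<And>p. p \<in> carrier P \<Longrightarrow> \<psi> (p \<odot>\<^bsub>D\<^esub> \<one>\<^bsub>D\<^esub>) = e p"
    and inv: "\<And>x. x \<in> carrier C \<Longrightarrow> \<psi> (\<phi> x) = x" "\<And>x. x \<in> carrier D \<Longrightarrow> \<phi> (\<psi> x) = x"
    using cayley_polys_isomorphism by blast
  note f = algebra_homD[OF phi(1), unfolded DR_simps] and g = algebra_homD[OF psi(1), unfolded DR_simps]
  have bij: "bij_betw \<phi> (carrier C) (carrier D)"
    using f(1) g(1) inv by (intro bij_betw_byWitness[where f' = \<psi>]) auto
  have phi_iso: "\<phi> \<in> ring_iso C D" "\<phi> \<in> algebra_iso R C DR"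
    using bij phi(1) by (auto simp: ring_iso_def algebra_iso_def algebra_hom_def ring_hom_def DR_simps)
  have center: "alt_center C = e ` carrier P"
    by (rule cayley_polys_center[OF e(1) phi(1) psi(1) psi_e inv])
  have phi_e: "\<phi> (e p) = p \<odot>\<^bsub>D\<^esub> \<one>\<^bsub>D\<^esub>" if "p \<in> carrier P" for p
    using inv(2)[of "p \<odot>\<^bsub>D\<^esub> \<one>\<^bsub>D\<^esub>"] psi_e[OF that] that by simp
  have "inj_on e (carrier P)"
  proof (rule inj_onI)
    fix p q assume p: "p \<in> carrier P" and q: "q \<in> carrier P" and "e p = e q"
    then have "p \<odot>\<^bsub>D\<^esub> \<one>\<^bsub>D\<^esub> = q \<odot>\<^bsub>D\<^esub> \<one>\<^bsub>D\<^esub>" using phi_e by metis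
    then have "(p \<ominus>\<^bsub>P\<^esub> q) \<odot>\<^bsub>D\<^esub> \<one>\<^bsub>D\<^esub> = \<zero>\<^bsub>D\<^esub>"
      using p q by (simp add: a_minus_def D.smult_l_distr D.smult_l_minus D.M.r_neg)
    then have "p \<ominus>\<^bsub>P\<^esub> q = \<zero>\<^bsub>P\<^esub>"
      using O.B3.faithful[of "p \<ominus>\<^bsub>P\<^esub> q"] p q by (simp add: D_eq)
    then show "p = q" using p q by (metis a_minus_def O.B0.R.minus_equality O.B0.R.minus_minus O.B0.R.a_inv_closed)
  qed
  then have e_iso: "e \<in> ring_iso P Z"
    using e(1) center by (simp add: ring_iso_def bij_betw_def)
  show ?thesis
    using poly3_octonion_constants cayley_polys_graded_isomorphic[OF phi psi inv phi_iso(2)]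
      cayley_polys_center_generated[OF e center] poly3_algebra_iso_center[OF e_iso e(2)] e(3)
      cayley_polys_octonion_algebra_over_center[OF e_iso e(3) phi_iso(1) phi_e]
    by blast
qed

end

theorem theorem3p3:
  fixes R :: "('a, 'm) ring_scheme"
  assumes "cring R"
    and "\<one>\<^bsub>R\<^esub> \<oplus>\<^bsub>R\<^esub> \<one>\<^bsub>R\<^esub> \<in> Units R"
  shows "(octonion_constants (poly3_ring R) (poly3_var R G1) (poly3_var R G2) (poly3_var R G3)) \<and>
    (graded_isomorphic R
      (cayley_polys R) (component R (cayley_polys R) (cayley_gen R) deg3)
      (poly3_octonions_base R) (component R (poly3_octonions_base R) (poly3_octonion_gen R) deg3)) \<and>
    (alt_center (cayley_polys R) =
      subalgebra_gen R (cayley_polys R) (range (cayley_gen_sq R))) \<and>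
    (\<exists>f\<in>algebra_iso R (poly3_algebra R)
        (cayley_polys R\<lparr>carrier := alt_center (cayley_polys R)\<rparr>).
      \<forall>j. f (poly3_var R j) = cayley_gen_sq R j) \<and>
    (is_octonion_algebra (cayley_polys R\<lparr>carrier := alt_center (cayley_polys R)\<rparr>)
      (cayley_gen_sq R G1) (cayley_gen_sq R G2) (cayley_gen_sq R G3)
      (self_algebra (cayley_polys R)))"
  by (rule cayley_polys_structure[OF assms])

end
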